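(* Let $\sigma$ be the generalized braiding on $\Omega\otimes_{\mathcal{B}}\Omega$, and for $x,y\in\{+,-\}$ let $\sigma_{xy}:\Omega_x\otimes_{\mathcal{B}}\Omega_y\to\Omega_y\otimes_{\mathcal{B}}\Omega_x$ be its restriction to $\Omega_x\otimes_{\mathcal{B}}\Omega_y$. Then $$(\sigma_{++}-q^{(\alpha_s,\alpha_s)}\mathrm{id})\circ(\sigma_{++}+\mathrm{id})=0,\qquad(\sigma_{--}-q^{-(\alpha_s,\alpha_s)}\mathrm{id})\circ(\sigma_{--}+\mathrm{id})=0,$$ $$\sigma_{-+}\circ\sigma_{+-}=\mathrm{id},\qquad\sigma_{+-}\circ\sigma_{-+}=\mathrm{id}.$$
   Context: **Quantum group data.** Fix an integer $r\ge 1$, a real number $0<q<1$ and $s\in\{1,r\}$. $U_q(\mathfrak{sl}_{r+1})$ is the quantized enveloping algebra with generators $K_i^{\pm1},E_i,F_i$, $1\le i\le r$ (Klimyk–Schmüdgen conventions: $\Delta(K_i)=K_i\otimes K_i$, $\Delta(E_i)=E_i\otimes K_i+1\otimes E_i$, $\Delta(F_i)=F_i\otimes 1+K_i^{-1}\otimes F_i$; $K_i$ acts on a vector of weight $\mu$ by $q^{(\alpha_i,\mu)}$). Here $\alpha_i$ are the simple roots, $\omega_i$ the fundamental weights, $\rho=\sum_i\omega_i$, $w_0$ the longest Weyl group element, $(\cdot,\cdot)$ the invariant form with $(\alpha_i,\alpha_i)=2$. Put $a=(\alpha_s,\alpha_s)=2$, $w=(\omega_s,\omega_s)$, $m=(\omega_s,2\rho)=r$.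 $V(\lambda)$ is the simple type 1 module of highest weight $\lambda$, $V=V(\omega_s)$, and $V^*$ is its dual with $(Xf)(v)=f(S(X)v)$, $S$ the antipode. $\hat{R}_{X,Y}:X\otimes Y\to Y\otimes X$ is the braiding on finite-dimensional type 1 modules determined by being a module map with $\hat{R}_{V(\lambda),V(\mu)}(v\otimes u)=q^{(\lambda,w_0\mu)}u\otimes v$ for $v$ a highest weight vector of $V(\lambda)$ and $u$ a lowest weight vector of $V(\mu)$. Let $(v_i)$ be a weight basis of $V$ with weights $\lambda_i$ and dual basis $(f^i)$ of $V^*$. Define $\mathsf{E}:V^*\otimes V\to\mathbb{C}$, $\mathsf{E}(f^i\otimes v_j)=\delta_{ij}$, and $\mathsf{E}':V\otimes V^*\to\mathbb{C}$, $\mathsf{E}'(v_i\otimes f^j)=q^{(\lambda_i,2\rho)}\delta_{ij}$. Subscripts indicate the tensor legs on which a map acts; products of maps are compositions (rightmost first), legs being renumbered after each contraction. Put $$\mathsf{S}_{123}=(\hat{R}_{V,V^*})_{23}(\hat{R}_{V,V})_{12}(\hat{R}_{V,V^*}^{-1})_{23},\quad \tilde{\mathsf{S}}_{234}=(\hat{R}_{V,V^*})_{23}(\hat{R}_{V^*,V^*}^{-1})_{34}(\hat{R}_{V,V^*}^{-1})_{23},\quad \mathsf{T}_{1234}=\mathsf{S}_{123}\tilde{\mathsf{S}}_{234}=\tilde{\mathsf{S}}_{234}\mathsf{S}_{123}$$ (acting on $V\otimes V^*\otimes V$, $V^*\otimes V\otimes V^*$, $V\otimes V^*\otimes V\otimes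 V^*$ at the indicated legs). **Index-free notation.** A family $x=(x^{ij})_{1\le i,j\le r+1}$ is identified with $\sum_{i,j}v_i\otimes f^j\otimes x^{ij}$; products of families $xy$ (also $x\otimes y$) denote $\sum v_i\otimes f^j\otimes v_k\otimes f^l\otimes x^{ij}y^{kl}$ (resp. with $\otimes_{\mathcal{B}}$), and similarly for more factors. The maps above act on the $V,V^*$ legs; other maps act on components. Elements such as $g_{+-}$ below carry no legs. **Algebra and first-order calculus.** $\mathcal{B}$ is the unital algebra generated by $p^{ij}$, $1\le i,j\le r+1$, with relations $\mathsf{S}_{123}pp=q^{w}pp$, $\tilde{\mathsf{S}}_{234}pp=q^{-w}pp$, $\mathsf{E}'_{12}p=q^{m}$ (the algebra of the quantum projective space). The Heckenberger–Kolb first-order differential calculus is $\Omega=\Omega_+\oplus\Omega_-$, with $\Omega_+,\Omega_-$ generated as left $\mathcal{B}$-modules by $\partial p^{ij}$, resp. $\bar\partial p^{ij}$, with relations $$\tilde{\mathsf{S}}_{234}p\,\partial p=q^{-w}p\,\partial p,\quad \mathsf{E}'_{12}\partial p=0,\qquad \mathsf{S}_{123}p\,\bar\partial p=q^{w}p\,\bar\partial p,\quad \mathsf{E}'_{12}\bar\partial p=0,$$ and right module structure $\partial p\,p=q^{a}\mathsf{T}_{1234}p\,\partial p$, $\bar\partial p\,p=q^{-a}\mathsf{T}_{1234}p\,\bar\partial p$. **Metric components.** $g_{+-}=\mathsf{E}'_{12}\mathsf{E}_{23}\,\partial p\otimes\bar\partial p$ and $g_{-+}=\mathsf{E}'_{12}\mathsf{E}_{23}\,\bar\partial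 p\otimes\partial p$ in $\Omega\otimes_{\mathcal{B}}\Omega$ (central elements). **Generalized braiding.** $\sigma$ is the (well-defined) $\mathcal{B}$-bimodule map $\Omega\otimes_{\mathcal{B}}\Omega\to\Omega\otimes_{\mathcal{B}}\Omega$ given by $$\sigma(\partial p\otimes\partial p)=q^{a}\mathsf{S}_{123}\tilde{\mathsf{S}}_{234}\,\partial p\otimes\partial p,\qquad \sigma(\bar\partial p\otimes\bar\partial p)=q^{-a}\mathsf{S}_{123}\tilde{\mathsf{S}}_{234}\,\bar\partial p\otimes\bar\partial p,$$ $$\sigma(\partial p\otimes\bar\partial p)=q^{2a-2w}\mathsf{S}_{123}\tilde{\mathsf{S}}_{234}^{-1}\,\bar\partial p\otimes\partial p+(1-q^{a})q^{a}q^{-m}\,p\,g_{-+}\,p,$$ $$\sigma(\bar\partial p\otimes\partial p)=q^{2w-2a}\mathsf{S}_{123}^{-1}\tilde{\mathsf{S}}_{234}\,\partial p\otimes\bar\partial p+(1-q^{-a})q^{-m}\,p\,g_{+-}\,p.$$ *)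

theory Defs
  imports "HOL-Analysis.Analysis" "HOL-Library.Poly_Mapping"
begin

section \<open>Weights of type A\<close>

text \<open>
  Weights of \<open>sl\<^sub>r\<^sub>+\<^sub>1\<close> are given by their coordinates \<open>1, \<dots>, r + 1\<close> in the orthonormal
  basis \<open>\<epsilon>\<^sub>1, \<dots>, \<epsilon>\<^sub>r\<^sub>+\<^sub>1\<close>, so that the invariant form is the standard one, the simple roots are
  \<open>\<epsilon>\<^sub>i - \<epsilon>\<^sub>i\<^sub>+\<^sub>1\<close>, and the longest Weyl group element reverses the coordinates. Coordinates
  outside \<open>{1..r + 1}\<close> are irrelevant.
\<close>

type_synonym weight = "nat \<Rightarrow> real"

definition ip :: "nat \<Rightarrow> weight \<Rightarrow> weight \<Rightarrow> real" where
  "ip r \<mu> \<nu> = (\<Sum>k = 1..r + 1. \<mu> k * \<nu> k)"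

definition simple_root :: "nat \<Rightarrow> weight" where
  "simple_root i k = (if k = i then 1 else if k = i + 1 then - 1 else 0)"

definition fund_weight :: "nat \<Rightarrow> nat \<Rightarrow> weight" where
  "fund_weight r i k = (if k \<le> i then 1 else 0) - real i / real (r + 1)"

definition two_rho :: "nat \<Rightarrow> weight" where
  "two_rho r k = 2 * (\<Sum>i = 1..r. fund_weight r i k)"

definition w0 :: "nat \<Rightarrow> weight \<Rightarrow> weight" where
  "w0 r \<mu> k = \<mu> (r + 2 - k)"

definition weight_lattice :: "nat \<Rightarrow> weight set" where
  "weight_lattice r =
     {\<mu>. \<exists>c :: nat \<Rightarrow> int. \<mu> = (\<lambda>k. \<Sum>i = 1..r. of_int (c i) * fund_weight r i k)}"

section \<open>Modules over the quantized enveloping algebra\<close>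

datatype uq_gen = Kgen nat | Kinv nat | Egen nat | Fgen nat

definition uq_gens :: "nat \<Rightarrow> uq_gen set" where
  "uq_gens r = Kgen ` {1..r} \<union> Kinv ` {1..r} \<union> Egen ` {1..r} \<union> Fgen ` {1..r}"

text \<open>
  A finite-dimensional module is a family of matrices satisfying the defining relations of
  \<open>U\<^sub>q(sl\<^sub>r\<^sub>+\<^sub>1)\<close>; the values at generators with index outside \<open>{1..r}\<close> are irrelevant.
\<close>

definition uq_module :: "nat \<Rightarrow> real \<Rightarrow> (uq_gen \<Rightarrow> complex^'n^'n) \<Rightarrow> bool" where
  "uq_module r q \<pi> \<longleftrightarrow>
    (\<forall>i\<in>{1..r}. \<pi> (Kgen i) ** \<pi> (Kinv i) = mat 1 \<and> \<pi> (Kinv i) ** \<pi> (Kgen i) = mat 1) \<and>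
    (\<forall>i\<in>{1..r}. \<forall>j\<in>{1..r}.
      \<pi> (Kgen i) ** \<pi> (Kgen j) = \<pi> (Kgen j) ** \<pi> (Kgen i) \<and>
      \<pi> (Kgen i) ** \<pi> (Egen j) ** \<pi> (Kinv i)
        = (q powr ip r (simple_root i) (simple_root j)) *\<^sub>R \<pi> (Egen j) \<and>
      \<pi> (Kgen i) ** \<pi> (Fgen j) ** \<pi> (Kinv i)
        = (q powr (- ip r (simple_root i) (simple_root j))) *\<^sub>R \<pi> (Fgen j) \<and>
      \<pi> (Egen i) ** \<pi> (Fgen j) - \<pi> (Fgen j) ** \<pi> (Egen i)
        = (if i = j then (1 / (q - 1 / q)) *\<^sub>R (\<pi> (Kgen i) - \<pi> (Kinv i)) else 0)) \<and>
    (\<forall>i\<in>{1..r}. \<forall>j\<in>{1..r}. \<forall>X\<in>{Egen, Fgen}.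
      (i = j + 1 \<or> j = i + 1 \<longrightarrow>
        \<pi> (X i) ** \<pi> (X i) ** \<pi> (X j)
        - (q + 1 / q) *\<^sub>R (\<pi> (X i) ** \<pi> (X j) ** \<pi> (X i))
        + \<pi> (X j) ** \<pi> (X i) ** \<pi> (X i) = 0) \<and>
      (i + 1 < j \<or> j + 1 < i \<longrightarrow> \<pi> (X i) ** \<pi> (X j) = \<pi> (X j) ** \<pi> (X i)))"

definition weight_vector ::
  "nat \<Rightarrow> real \<Rightarrow> (uq_gen \<Rightarrow> complex^'n^'n) \<Rightarrow> weight \<Rightarrow> complex^'n \<Rightarrow> bool" where
  "weight_vector r q \<pi> \<mu> v \<longleftrightarrow>
    (\<forall>i\<in>{1..r}. \<pi> (Kgen i) *v v = (q powr ip r (simple_root i) \<mu>) *\<^sub>R v)"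

definition highest_weight_vector ::
  "nat \<Rightarrow> real \<Rightarrow> (uq_gen \<Rightarrow> complex^'n^'n) \<Rightarrow> weight \<Rightarrow> complex^'n \<Rightarrow> bool" where
  "highest_weight_vector r q \<pi> \<mu> v \<longleftrightarrow>
    v \<noteq> 0 \<and> weight_vector r q \<pi> \<mu> v \<and> (\<forall>i\<in>{1..r}. \<pi> (Egen i) *v v = 0)"

definition lowest_weight_vector ::
  "nat \<Rightarrow> real \<Rightarrow> (uq_gen \<Rightarrow> complex^'n^'n) \<Rightarrow> weight \<Rightarrow> complex^'n \<Rightarrow> bool" where
  "lowest_weight_vector r q \<pi> \<mu> v \<longleftrightarrow>
    v \<noteq> 0 \<and> weight_vector r q \<pi> \<mu> v \<and> (\<forall>i\<in>{1..r}. \<pi> (Fgen i) *v v = 0)"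

text \<open>The matrices \<open>\<pi>\<close> define the simple module \<open>V(\<lambda>)\<close>.\<close>

definition simple_module ::
  "nat \<Rightarrow> real \<Rightarrow> weight \<Rightarrow> (uq_gen \<Rightarrow> complex^'n^'n) \<Rightarrow> bool" where
  "simple_module r q \<mu> \<pi> \<longleftrightarrow>
    uq_module r q \<pi> \<and>
    (\<forall>W. vec.subspace W \<and> (\<forall>g\<in>uq_gens r. \<forall>v\<in>W. \<pi> g *v v \<in> W) \<longrightarrow> W = {0} \<or> W = UNIV) \<and>
    (\<exists>v. highest_weight_vector r q \<pi> \<mu> v)"

text \<open>
  The dual module in the dual basis, \<open>(X f)(v) = f(S(X) v)\<close>, with antipode
  \<open>S(K\<^sub>i) = K\<^sub>i\<^sup>-\<^sup>1\<close>, \<open>S(E\<^sub>i) = - E\<^sub>i K\<^sub>i\<^sup>-\<^sup>1\<close>, \<open>S(F\<^sub>i) = - K\<^sub>i F\<^sub>i\<close>.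
\<close>

fun dual_rep :: "(uq_gen \<Rightarrow> complex^'n^'n) \<Rightarrow> uq_gen \<Rightarrow> complex^'n^'n" where
  "dual_rep \<pi> (Kgen i) = transpose (\<pi> (Kinv i))"
| "dual_rep \<pi> (Kinv i) = transpose (\<pi> (Kgen i))"
| "dual_rep \<pi> (Egen i) = transpose (- (\<pi> (Egen i) ** \<pi> (Kinv i)))"
| "dual_rep \<pi> (Fgen i) = transpose (- (\<pi> (Kgen i) ** \<pi> (Fgen i)))"

definition kron :: "complex^'n^'n \<Rightarrow> complex^'m^'m \<Rightarrow> complex^('n \<times> 'm)^('n \<times> 'm)" where
  "kron A B = (\<chi> I J. A $ fst I $ fst J * B $ snd I $ snd J)"

definition tensor_vec :: "complex^'n \<Rightarrow> complex^'m \<Rightarrow> complex^('n \<times> 'm)" where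
  "tensor_vec v u = (\<chi> I. v $ fst I * u $ snd I)"

fun tensor_rep ::
  "(uq_gen \<Rightarrow> complex^'n^'n) \<Rightarrow> (uq_gen \<Rightarrow> complex^'m^'m)
    \<Rightarrow> uq_gen \<Rightarrow> complex^('n \<times> 'm)^('n \<times> 'm)" where
  "tensor_rep \<pi> \<rho> (Kgen i) = kron (\<pi> (Kgen i)) (\<rho> (Kgen i))"
| "tensor_rep \<pi> \<rho> (Kinv i) = kron (\<pi> (Kinv i)) (\<rho> (Kinv i))"
| "tensor_rep \<pi> \<rho> (Egen i) = kron (\<pi> (Egen i)) (\<rho> (Kgen i)) + kron (mat 1) (\<rho> (Egen i))"
| "tensor_rep \<pi> \<rho> (Fgen i) = kron (\<pi> (Fgen i)) (mat 1) + kron (\<pi> (Kinv i)) (\<rho> (Fgen i))"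

text \<open>
  \<open>R\<close> is the matrix of the braiding \<open>V(\<mu>) \<otimes> V(\<nu>) \<rightarrow> V(\<nu>) \<otimes> V(\<mu>)\<close>, where \<open>\<pi>\<close> and \<open>\<rho>\<close> give
  the simple modules of highest weights \<open>\<mu>\<close> and \<open>\<nu>\<close>. The two conditions determine \<open>R\<close>, since
  highest weight vector tensor lowest weight vector generates the tensor product.
\<close>

definition is_braiding ::
  "nat \<Rightarrow> real \<Rightarrow> (uq_gen \<Rightarrow> complex^'n^'n) \<Rightarrow> weight \<Rightarrow> (uq_gen \<Rightarrow> complex^'m^'m) \<Rightarrow> weight
    \<Rightarrow> complex^('n \<times> 'm)^('m \<times> 'n) \<Rightarrow> bool" where
  "is_braiding r q \<pi> \<mu> \<rho> \<nu> R \<longleftrightarrow>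
    (\<forall>g\<in>uq_gens r. R ** tensor_rep \<pi> \<rho> g = tensor_rep \<rho> \<pi> g ** R) \<and>
    (\<forall>v u. highest_weight_vector r q \<pi> \<mu> v \<and> lowest_weight_vector r q \<rho> (w0 r \<nu>) u \<longrightarrow>
      R *v tensor_vec v u = (q powr ip r \<mu> (w0 r \<nu>)) *\<^sub>R tensor_vec u v)"

section \<open>Families and maps acting on legs\<close>

text \<open>
  A family \<open>(x\<^sup>i\<^sup>j)\<close> stands for \<open>\<Sum> v\<^sub>i \<otimes> f\<^sup>j \<otimes> x\<^sup>i\<^sup>j\<close>, and a product of two families for
  a function of the four leg indices. Since \<open>V\<close> and \<open>V\<^sup>*\<close> have the same index type, all maps
  on four legs are matrices over the same index type.
\<close>

type_synonym 'n legs4 = "'n \<times> 'n \<times> 'n \<times> 'n"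

definition leg12 :: "complex^('n::finite \<times> 'n)^('n \<times> 'n) \<Rightarrow> complex^('n legs4)^('n legs4)" where
  "leg12 A = (\<chi> I J. case (I, J) of ((i1, i2, i3, i4), (j1, j2, j3, j4)) \<Rightarrow>
     if i3 = j3 \<and> i4 = j4 then A $ (i1, i2) $ (j1, j2) else 0)"

definition leg23 :: "complex^('n::finite \<times> 'n)^('n \<times> 'n) \<Rightarrow> complex^('n legs4)^('n legs4)" where
  "leg23 A = (\<chi> I J. case (I, J) of ((i1, i2, i3, i4), (j1, j2, j3, j4)) \<Rightarrow>
     if i1 = j1 \<and> i4 = j4 then A $ (i2, i3) $ (j2, j3) else 0)"

definition leg34 :: "complex^('n::finite \<times> 'n)^('n \<times> 'n) \<Rightarrow> complex^('n legs4)^('n legs4)" where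
  "leg34 A = (\<chi> I J. case (I, J) of ((i1, i2, i3, i4), (j1, j2, j3, j4)) \<Rightarrow>
     if i1 = j1 \<and> i2 = j2 then A $ (i3, i4) $ (j3, j4) else 0)"

text \<open>In the following, \<open>sc\<close> is the complex scalar multiplication on the components.\<close>

definition leg_map ::
  "(complex \<Rightarrow> 'x \<Rightarrow> 'x::comm_monoid_add) \<Rightarrow> complex^'j^'i \<Rightarrow> ('j \<Rightarrow> 'x) \<Rightarrow> 'i \<Rightarrow> 'x" where
  "leg_map sc A x I = (\<Sum>J\<in>UNIV. sc (A $ I $ J) (x J))"

fun family_prod ::
  "('x \<Rightarrow> 'y \<Rightarrow> 'z) \<Rightarrow> ('n \<times> 'n \<Rightarrow> 'x) \<Rightarrow> ('n \<times> 'n \<Rightarrow> 'y) \<Rightarrow> 'n legs4 \<Rightarrow> 'z" where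
  "family_prod f x y (i, j, k, l) = f (x (i, j)) (y (k, l))"

text \<open>The contraction of the legs 2 and 3 with \<open>E : V\<^sup>* \<otimes> V \<rightarrow> \<complex>\<close>.\<close>

definition E23 :: "(complex \<Rightarrow> 'x \<Rightarrow> 'x::comm_monoid_add) \<Rightarrow> ('n::finite legs4 \<Rightarrow> 'x) \<Rightarrow> 'n \<times> 'n \<Rightarrow> 'x"
  where "E23 sc x = (\<lambda>(i, l). \<Sum>j\<in>UNIV. \<Sum>k\<in>UNIV. sc (if j = k then 1 else 0) (x (i, j, k, l)))"

text \<open>
  The contraction of the two legs \<open>V \<otimes> V\<^sup>*\<close> with \<open>E'\<close>, where \<open>wt i\<close> is the weight of \<open>v\<^sub>i\<close>.
\<close>

definition E12' ::
  "nat \<Rightarrow> real \<Rightarrow> ('n::finite \<Rightarrow> weight) \<Rightarrow> (complex \<Rightarrow> 'x \<Rightarrow> 'x::comm_monoid_add)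
    \<Rightarrow> ('n \<times> 'n \<Rightarrow> 'x) \<Rightarrow> 'x" where
  "E12' r q wt sc y = (\<Sum>i\<in>UNIV. \<Sum>j\<in>UNIV.
     sc (if i = j then complex_of_real (q powr ip r (wt i) (two_rho r)) else 0) (y (i, j)))"

text \<open>The components of \<open>A x - c x\<close>.\<close>

definition eigen_relators ::
  "(complex \<Rightarrow> 'x \<Rightarrow> 'x::ab_group_add) \<Rightarrow> complex^'i^'i \<Rightarrow> complex \<Rightarrow> ('i \<Rightarrow> 'x) \<Rightarrow> 'x set" where
  "eigen_relators sc A c x = range (\<lambda>I. leg_map sc A x I - sc c (x I))"

section \<open>Algebras, modules and bimodules by generators and relations\<close>

text \<open>
  A complex algebra is a ring \<open>'b\<close> with a unital ring homomorphism \<open>\<iota>\<close> from \<open>\<complex>\<close> to its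
  center; a left module over it is a complex vector space by \<open>c x = \<iota> c \<cdot> x\<close>.
\<close>

definition complex_algebra :: "(complex \<Rightarrow> 'b::ring_1) \<Rightarrow> bool" where
  "complex_algebra \<iota> \<longleftrightarrow>
    \<iota> 1 = 1 \<and> (\<forall>c d. \<iota> (c + d) = \<iota> c + \<iota> d) \<and> (\<forall>c d. \<iota> (c * d) = \<iota> c * \<iota> d) \<and>
    (\<forall>c b. \<iota> c * b = b * \<iota> c)"

text \<open>
  Lists are the free monoid, hence \<open>'g list \<Rightarrow>\<^sub>0 complex\<close> with the convolution product of
  \<^theory>\<open>HOL-Library.Poly_Mapping\<close> is the free unital algebra on \<open>'g\<close>.
\<close>

instantiation list :: (type) monoid_add
begin

definition zero_list :: "'a list" where "zero_list = []"
definition plus_list :: "'a list \<Rightarrow> 'a list \<Rightarrow> 'a list" where "plus_list = append"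

instance by standard (simp_all add: zero_list_def plus_list_def)

end

type_synonym 'g free_algebra = "'g list \<Rightarrow>\<^sub>0 complex"

definition free_scalar :: "complex \<Rightarrow> 'g free_algebra" where
  "free_scalar c = Poly_Mapping.single [] c"

definition free_gen :: "'g \<Rightarrow> 'g free_algebra" where
  "free_gen g = Poly_Mapping.single [g] 1"

definition free_eval :: "(complex \<Rightarrow> 'b::ring_1) \<Rightarrow> ('g \<Rightarrow> 'b) \<Rightarrow> 'g free_algebra \<Rightarrow> 'b" where
  "free_eval \<iota> x f =
    (\<Sum>u\<in>Poly_Mapping.keys f. \<iota> (Poly_Mapping.lookup f u) * prod_list (map x u))"

inductive_set two_sided_ideal :: "'a::ring_1 set \<Rightarrow> 'a set" for X where
  zero: "0 \<in> two_sided_ideal X"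
| step: "x \<in> X \<Longrightarrow> y \<in> two_sided_ideal X \<Longrightarrow> b * x * c + y \<in> two_sided_ideal X"

text \<open>The algebra \<open>'b\<close> is presented by the generators \<open>x g\<close> and the relators \<open>Rel\<close>.\<close>

definition presented_algebra ::
  "(complex \<Rightarrow> 'b::ring_1) \<Rightarrow> ('g \<Rightarrow> 'b) \<Rightarrow> 'g free_algebra set \<Rightarrow> bool" where
  "presented_algebra \<iota> x Rel \<longleftrightarrow>
    complex_algebra \<iota> \<and> surj (free_eval \<iota> x) \<and>
    {f. free_eval \<iota> x f = 0} = two_sided_ideal Rel"

definition bimodule ::
  "(complex \<Rightarrow> 'b::ring_1) \<Rightarrow> ('b \<Rightarrow> 'x::ab_group_add \<Rightarrow> 'x) \<Rightarrow> ('x \<Rightarrow> 'b \<Rightarrow> 'x) \<Rightarrow> bool" where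
  "bimodule \<iota> la ra \<longleftrightarrow>
    (\<forall>b x y. la b (x + y) = la b x + la b y) \<and> (\<forall>b c x. la (b + c) x = la b x + la c x) \<and>
    (\<forall>b c x. la (b * c) x = la b (la c x)) \<and> (\<forall>x. la 1 x = x) \<and>
    (\<forall>b x y. ra (x + y) b = ra x b + ra y b) \<and> (\<forall>b c x. ra x (b + c) = ra x b + ra x c) \<and>
    (\<forall>b c x. ra x (b * c) = ra (ra x b) c) \<and> (\<forall>x. ra x 1 = x) \<and>
    (\<forall>b c x. ra (la b x) c = la b (ra x c)) \<and>
    (\<forall>c x. la (\<iota> c) x = ra x (\<iota> c))"

text \<open>
  The free left module on the finite set \<open>'g\<close> is \<open>'b^'g\<close>, with the action \<open>(*s)\<close> and the
  basis \<open>axis g 1\<close>.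
\<close>

definition module_eval ::
  "('b \<Rightarrow> 'x \<Rightarrow> 'x::comm_monoid_add) \<Rightarrow> ('g::finite \<Rightarrow> 'x) \<Rightarrow> 'b^'g \<Rightarrow> 'x" where
  "module_eval la x f = (\<Sum>g\<in>UNIV. la (f $ g) (x g))"

inductive_set left_submodule :: "('b::ring_1^'g) set \<Rightarrow> ('b^'g) set" for X where
  zero: "0 \<in> left_submodule X"
| step: "x \<in> X \<Longrightarrow> y \<in> left_submodule X \<Longrightarrow> b *s x + y \<in> left_submodule X"

text \<open>The left submodule \<open>N\<close> is presented by the generators \<open>x g\<close> and the relators \<open>Rel\<close>.\<close>

definition presented_left_module ::
  "('b::ring_1 \<Rightarrow> 'x \<Rightarrow> 'x::ab_group_add) \<Rightarrow> 'x set \<Rightarrow> ('g::finite \<Rightarrow> 'x) \<Rightarrow> ('b^'g) set \<Rightarrow> bool" where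
  "presented_left_module la N x Rel \<longleftrightarrow>
    range (module_eval la x) = N \<and> {f. module_eval la x f = 0} = left_submodule Rel"

inductive_set additive_span :: "'a::ab_group_add set \<Rightarrow> 'a set" for X where
  zero: "0 \<in> additive_span X"
| add: "x \<in> X \<Longrightarrow> y \<in> additive_span X \<Longrightarrow> y + x \<in> additive_span X"
| diff: "x \<in> X \<Longrightarrow> y \<in> additive_span X \<Longrightarrow> y - x \<in> additive_span X"

definition int_multiple :: "int \<Rightarrow> 'a::ab_group_add \<Rightarrow> 'a" where
  "int_multiple k x = (\<Sum>i<nat k. x) - (\<Sum>i<nat (- k). x)"

text \<open>\<open>'a \<Rightarrow>\<^sub>0 int\<close> is the free abelian group on \<open>'a\<close>, with basis \<^const>\<open>frag_of\<close>.\<close>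

definition frag_eval :: "('a \<Rightarrow> 't::ab_group_add) \<Rightarrow> ('a \<Rightarrow>\<^sub>0 int) \<Rightarrow> 't" where
  "frag_eval f z = (\<Sum>a\<in>Poly_Mapping.keys z. int_multiple (Poly_Mapping.lookup z a) (f a))"

definition balanced_relators ::
  "('b \<Rightarrow> 'x \<Rightarrow> 'x::ab_group_add) \<Rightarrow> ('x \<Rightarrow> 'b \<Rightarrow> 'x) \<Rightarrow> ('x \<times> 'x \<Rightarrow>\<^sub>0 int) set" where
  "balanced_relators la ra =
     {frag_of (x + x', y) - frag_of (x, y) - frag_of (x', y) | x x' y. True} \<union>
     {frag_of (x, y + y') - frag_of (x, y) - frag_of (x, y') | x y y'. True} \<union>
     {frag_of (ra x b, y) - frag_of (x, la b y) | x b y. True}"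

text \<open>
  The bimodule \<open>'t\<close>, with \<open>tens\<close>, is the tensor square over \<open>'b\<close> of the bimodule \<open>'x\<close>: the
  quotient of the free abelian group on pairs by the balancing relations.
\<close>

definition tensor_square ::
  "(complex \<Rightarrow> 'b::ring_1) \<Rightarrow> ('b \<Rightarrow> 'x::ab_group_add \<Rightarrow> 'x) \<Rightarrow> ('x \<Rightarrow> 'b \<Rightarrow> 'x)
    \<Rightarrow> ('b \<Rightarrow> 't::ab_group_add \<Rightarrow> 't) \<Rightarrow> ('t \<Rightarrow> 'b \<Rightarrow> 't) \<Rightarrow> ('x \<Rightarrow> 'x \<Rightarrow> 't) \<Rightarrow> bool" where
  "tensor_square \<iota> la ra lt rt tens \<longleftrightarrow>
    bimodule \<iota> lt rt \<and>
    (\<forall>b x y. lt b (tens x y) = tens (la b x) y) \<and>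
    (\<forall>b x y. rt (tens x y) b = tens x (ra y b)) \<and>
    surj (frag_eval (\<lambda>(x, y). tens x y)) \<and>
    {z. frag_eval (\<lambda>(x, y). tens x y) z = 0} = additive_span (balanced_relators la ra)"

text \<open>For submodules that are direct summands, this is their tensor product.\<close>

definition tensor_sub :: "('x \<Rightarrow> 'x \<Rightarrow> 't::ab_group_add) \<Rightarrow> 'x set \<Rightarrow> 'x set \<Rightarrow> 't set" where
  "tensor_sub tens X Y = additive_span {tens x y | x y. x \<in> X \<and> y \<in> Y}"

section \<open>The quantum projective space and its calculus\<close>

text \<open>
  The matrices \<open>\<pi>\<close> give \<open>V = V(\<omega>\<^sub>s)\<close> in a weight basis \<open>(v\<^sub>i)\<close> with weights \<open>wt i\<close>.
  \<open>RVV\<close>, \<open>RVD\<close>, \<open>RDD\<close> are the braidings on \<open>V \<otimes> V\<close>, \<open>V \<otimes> V\<^sup>*\<close>, \<open>V\<^sup>* \<otimes> V\<^sup>*\<close>, where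
  \<open>V\<^sup>* = V(- w\<^sub>0 \<omega>\<^sub>s)\<close>.
\<close>

locale projective_space_data =
  fixes r s :: nat
    and q :: real
    and \<pi> :: "uq_gen \<Rightarrow> complex^'n^'n"
    and wt :: "'n \<Rightarrow> weight"
    and RVV RVD RDD :: "complex^('n \<times> 'n)^('n \<times> 'n)"
  assumes r: "1 \<le> r" and s: "s = 1 \<or> s = r" and q: "0 < q" "q < 1"
    and dim: "CARD('n) = r + 1"
    and V: "simple_module r q (fund_weight r s) \<pi>"
    and weight_basis: "\<And>i. wt i \<in> weight_lattice r \<and> weight_vector r q \<pi> (wt i) (axis i 1)"
    and RVV: "is_braiding r q \<pi> (fund_weight r s) \<pi> (fund_weight r s) RVV"
    and RVD: "is_braiding r q \<pi> (fund_weight r s)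
                (dual_rep \<pi>) (\<lambda>k. - w0 r (fund_weight r s) k) RVD"
    and RDD: "is_braiding r q (dual_rep \<pi>) (\<lambda>k. - w0 r (fund_weight r s) k)
                (dual_rep \<pi>) (\<lambda>k. - w0 r (fund_weight r s) k) RDD"
begin

definition a :: real where "a = ip r (simple_root s) (simple_root s)"
definition w :: real where "w = ip r (fund_weight r s) (fund_weight r s)"
definition m :: real where "m = ip r (fund_weight r s) (two_rho r)"

definition qc :: "real \<Rightarrow> complex" where "qc x = complex_of_real (q powr x)"

text \<open>\<open>S\<^sub>1\<^sub>2\<^sub>3\<close>, \<open>S~\<^sub>2\<^sub>3\<^sub>4\<close> and \<open>T\<^sub>1\<^sub>2\<^sub>3\<^sub>4\<close>, as maps on \<open>V \<otimes> V\<^sup>* \<otimes> V \<otimes> V\<^sup>*\<close>.\<close>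

definition S :: "complex^('n legs4)^('n legs4)" where
  "S = leg23 RVD ** leg12 RVV ** leg23 (matrix_inv RVD)"

definition St :: "complex^('n legs4)^('n legs4)" where
  "St = leg23 RVD ** leg34 (matrix_inv RDD) ** leg23 (matrix_inv RVD)"

definition T :: "complex^('n legs4)^('n legs4)" where
  "T = S ** St"

definition algebra_relators :: "('n \<times> 'n) free_algebra set" where
  "algebra_relators =
    (let sc = (\<lambda>c x. free_scalar c * x); pp = family_prod (*) free_gen free_gen in
      eigen_relators sc S (qc w) pp \<union> eigen_relators sc St (qc (- w)) pp \<union>
      {E12' r q wt sc free_gen - free_scalar (qc m)})"

text \<open>
  The relators of \<open>\<Omega>\<^sub>+\<close> and \<open>\<Omega>\<^sub>-\<close> in the free left module, whose basis elements
  \<open>axis g 1\<close> stand for the generators \<open>\<partial>p\<^sup>i\<^sup>j\<close>, respectively their conjugates.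
\<close>

definition forms_plus_relators ::
  "(complex \<Rightarrow> 'b::ring_1) \<Rightarrow> ('n \<times> 'n \<Rightarrow> 'b) \<Rightarrow> ('b^('n \<times> 'n)) set" where
  "forms_plus_relators \<iota> p =
    (let sc = (\<lambda>c x. \<iota> c *s x); e = (\<lambda>g. axis g 1) in
      eigen_relators sc St (qc (- w)) (family_prod (*s) p e) \<union> {E12' r q wt sc e})"

definition forms_minus_relators ::
  "(complex \<Rightarrow> 'b::ring_1) \<Rightarrow> ('n \<times> 'n \<Rightarrow> 'b) \<Rightarrow> ('b^('n \<times> 'n)) set" where
  "forms_minus_relators \<iota> p =
    (let sc = (\<lambda>c x. \<iota> c *s x); e = (\<lambda>g. axis g 1) in
      eigen_relators sc S (qc w) (family_prod (*s) p e) \<union> {E12' r q wt sc e})"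

end

text \<open>
  \<open>dp\<close> and \<open>dbp\<close> are the families of generators of \<open>\<Omega>\<^sub>+\<close> and \<open>\<Omega>\<^sub>-\<close>, which are complementary
  in \<open>\<Omega> = 'o\<close>; \<open>lo\<close>, \<open>ro\<close> and \<open>lt\<close>, \<open>rt\<close> are the left and right actions on \<open>\<Omega>\<close> and on
  \<open>\<Omega> \<otimes> \<Omega> = 't\<close>.
\<close>

locale heckenberger_kolb_calculus = projective_space_data r s q \<pi> wt RVV RVD RDD
  for r s q and \<pi> :: "uq_gen \<Rightarrow> complex^'n^'n" and wt RVV RVD RDD +
  fixes \<iota> :: "complex \<Rightarrow> 'b::ring_1"
    and p :: "'n \<times> 'n \<Rightarrow> 'b"
    and lo :: "'b \<Rightarrow> 'o::ab_group_add \<Rightarrow> 'o"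
    and ro :: "'o \<Rightarrow> 'b \<Rightarrow> 'o"
    and \<Omega>p \<Omega>m :: "'o set"
    and dp dbp :: "'n \<times> 'n \<Rightarrow> 'o"
    and lt :: "'b \<Rightarrow> 't::ab_group_add \<Rightarrow> 't"
    and rt :: "'t \<Rightarrow> 'b \<Rightarrow> 't"
    and tens :: "'o \<Rightarrow> 'o \<Rightarrow> 't"
  assumes algebra: "presented_algebra \<iota> p algebra_relators"
    and bimodule: "bimodule \<iota> lo ro"
    and direct_sum: "\<Omega>p \<inter> \<Omega>m = {0}" "\<And>x. \<exists>y\<in>\<Omega>p. \<exists>z\<in>\<Omega>m. x = y + z"
    and forms_plus: "presented_left_module lo \<Omega>p dp (forms_plus_relators \<iota> p)"
    and forms_minus: "presented_left_module lo \<Omega>m dbp (forms_minus_relators \<iota> p)"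
    and right_plus: "\<And>I. family_prod ro dp p I
          = lo (\<iota> (qc a)) (leg_map (\<lambda>c. lo (\<iota> c)) T (family_prod lo p dp) I)"
    and right_minus: "\<And>I. family_prod ro dbp p I
          = lo (\<iota> (qc (- a))) (leg_map (\<lambda>c. lo (\<iota> c)) T (family_prod lo p dbp) I)"
    and tensor: "tensor_square \<iota> lo ro lt rt tens"
begin

definition g_pm :: 't where
  "g_pm = E12' r q wt (\<lambda>c. lt (\<iota> c)) (E23 (\<lambda>c. lt (\<iota> c)) (family_prod tens dp dbp))"

definition g_mp :: 't where
  "g_mp = E12' r q wt (\<lambda>c. lt (\<iota> c)) (E23 (\<lambda>c. lt (\<iota> c)) (family_prod tens dbp dp))"

end

locale generalized_braiding =
  heckenberger_kolb_calculus r s q \<pi> wt RVV RVD RDD \<iota> p lo ro \<Omega>p \<Omega>m dp dbp lt rt tens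
  for r s q and \<pi> :: "uq_gen \<Rightarrow> complex^'n^'n" and wt RVV RVD RDD
    and \<iota> :: "complex \<Rightarrow> 'b::ring_1" and p
    and lo :: "'b \<Rightarrow> 'o::ab_group_add \<Rightarrow> 'o" and ro \<Omega>p \<Omega>m dp dbp
    and lt :: "'b \<Rightarrow> 't::ab_group_add \<Rightarrow> 't" and rt tens +
  fixes \<sigma> :: "'t \<Rightarrow> 't"
  assumes \<sigma>_add: "\<And>t u. \<sigma> (t + u) = \<sigma> t + \<sigma> u"
    and \<sigma>_left: "\<And>b t. \<sigma> (lt b t) = lt b (\<sigma> t)"
    and \<sigma>_right: "\<And>t b. \<sigma> (rt t b) = rt (\<sigma> t) b"
    and \<sigma>_pp: "\<And>I. \<sigma> (family_prod tens dp dp I)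
          = lt (\<iota> (qc a)) (leg_map (\<lambda>c. lt (\<iota> c)) (S ** St) (family_prod tens dp dp) I)"
    and \<sigma>_mm: "\<And>I. \<sigma> (family_prod tens dbp dbp I)
          = lt (\<iota> (qc (- a))) (leg_map (\<lambda>c. lt (\<iota> c)) (S ** St) (family_prod tens dbp dbp) I)"
    and \<sigma>_pm: "\<And>I. \<sigma> (family_prod tens dp dbp I)
          = lt (\<iota> (qc (2 * a - 2 * w)))
              (leg_map (\<lambda>c. lt (\<iota> c)) (S ** matrix_inv St) (family_prod tens dbp dp) I)
            + lt (\<iota> ((1 - qc a) * qc a * qc (- m)))
              (family_prod (\<lambda>x y. rt (lt x g_mp) y) p p I)"
    and \<sigma>_mp: "\<And>I. \<sigma> (family_prod tens dbp dp I)
          = lt (\<iota> (qc (2 * w - 2 * a)))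
              (leg_map (\<lambda>c. lt (\<iota> c)) (matrix_inv S ** St) (family_prod tens dp dbp) I)
            + lt (\<iota> ((1 - qc (- a)) * qc (- m)))
              (family_prod (\<lambda>x y. rt (lt x g_pm) y) p p I)"

end

theory Submission
  imports Defs
begin

text \<open>
  \<^bold>\<open>Reduction to matrices.\<close> For \<open>s \<in> {1, r}\<close> the module \<open>V\<close> is a chain: each \<open>F\<^sub>i\<close> moves exactly one
  weight vector, to the next one. Hence the highest weight vector tensored with a lowest one generates
  \<open>V \<otimes> V\<close> under the quantum group, and applying the \<open>E\<^sub>i\<close> and \<open>F\<^sub>i\<close> to the prescribed value of the
  braiding there yields all its columns. In a basis ordered along the chain the braidings of \<open>V\<close> with
  itself and of its dual with itself are the R-matrices of Hecke type, and that of \<open>V\<close> with its dual is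
  the inverse of the first, turned around by the pairing \<open>E'\<close> (\<open>braidings_explicit\<close>). The rest of the
  proof uses only the following facts about the maps \<open>S\<close> on legs 123 and \<open>T\<close> on legs 234 (the map
  called \<open>S~\<close> in the definitions), with \<open>c = q\<^bsup>w + m\<^esup>\<close>: both satisfy quadratic equations, with
  eigenvalues \<open>q\<^bsup>w\<^esup>, - q\<^bsup>w - a\<^esup>\<close> of \<open>S\<close> and their inverses for \<open>T\<close>; they commute; copies of \<open>S\<close>
  shifted by two legs satisfy the braid relation, and so do those of \<open>T\<close>; and
  \<open>E'\<^sub>1\<^sub>2 S = c E\<^sub>2\<^sub>3\<close>, \<open>E\<^sub>2\<^sub>3 T = c\<^sup>-\<^sup>1 E'\<^sub>3\<^sub>4\<close>.

  \<^bold>\<open>The diagonal components.\<close> Contracting the middle legs of \<open>\<partial>p p\<close> gives back \<open>\<partial>p\<close>, so a relation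
  for \<open>p \<partial>p\<close> can be contracted, inside \<open>\<partial>p p \<otimes> \<partial>p\<close>, to one for \<open>\<partial>p \<otimes> \<partial>p\<close>: it is an eigenvector
  of \<open>T\<close> for \<open>q\<^bsup>- w\<^esup>\<close>. Therefore \<open>\<sigma>\<close> acts on this family as \<open>q\<^bsup>a - w\<^esup> S\<close>, which has the
  eigenvalues \<open>q\<^bsup>a\<^esup>\<close> and \<open>- 1\<close>. For the conjugate forms, \<open>S\<close> and \<open>T\<close> exchange their roles.

  \<^bold>\<open>The mixed components.\<close> The elements \<open>g\<^sub>+\<^sub>-\<close> and \<open>g\<^sub>-\<^sub>+\<close> commute with \<open>p\<close>, so the families
  \<open>p g p\<close> are \<open>p p g\<close> and thus eigenvectors of both \<open>S\<close> and \<open>T\<close>. Contracting the formulas for \<open>\<sigma>\<close>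
  shows that \<open>\<sigma>\<close> exchanges the two metrics. Applying \<open>\<sigma>\<close> twice to \<open>\<partial>p \<otimes> \<partial>p\<^sup>-\<close> or \<open>\<partial>p\<^sup>- \<otimes> \<partial>p\<close>, where
  \<open>\<partial>p\<^sup>-\<close> stands for the conjugate form, the operators \<open>S T\<^sup>-\<^sup>1\<close> and \<open>S\<^sup>-\<^sup>1 T\<close> cancel, and so do the
  coefficients of \<open>p g p\<close>.

  \<^bold>\<open>All elements.\<close> The generating families span the tensor products as left modules, because the
  one-forms they are made of span sub-bimodules, and \<open>\<sigma>\<close> is left linear.
\<close>

section \<open>Families indexed by words of legs\<close>

text \<open>
  A tensor with any number of legs is a function of a sequence \<open>\<nu>\<close> of indices, of which it reads
  only the first few. Operators and contractions at different legs are then functions between the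
  same types, and a contraction renumbers the later legs by shifting the sequence, so that identities
  on four, six or eight legs need no further types.
\<close>

definition leg_op ::
  "(complex \<Rightarrow> 'x \<Rightarrow> 'x::comm_monoid_add) \<Rightarrow> nat \<Rightarrow> complex^('n::finite \<times> 'n)^('n \<times> 'n)
    \<Rightarrow> ((nat \<Rightarrow> 'n) \<Rightarrow> 'x) \<Rightarrow> (nat \<Rightarrow> 'n) \<Rightarrow> 'x" where
  "leg_op sc k K x \<nu> =
    (\<Sum>J\<in>UNIV. sc (K $ (\<nu> k, \<nu> (Suc k)) $ J) (x (\<nu>(k := fst J, Suc k := snd J))))"

text \<open>
  The two new legs carry the same index: contractions only pair equal indices, with weights \<open>d\<close>. The
  weights 1 give the evaluation \<open>E\<close>, the weights \<open>q\<^bsup>(\<lambda>\<^sub>i, 2\<rho>)\<^esup>\<close> give \<open>E'\<close>.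
\<close>

definition insert_pair :: "nat \<Rightarrow> 'n \<Rightarrow> (nat \<Rightarrow> 'n) \<Rightarrow> nat \<Rightarrow> 'n" where
  "insert_pair k i \<nu> l = (if l < k then \<nu> l else if l < k + 2 then i else \<nu> (l - 2))"

definition contract ::
  "(complex \<Rightarrow> 'x \<Rightarrow> 'x::comm_monoid_add) \<Rightarrow> nat \<Rightarrow> ('n::finite \<Rightarrow> complex)
    \<Rightarrow> ((nat \<Rightarrow> 'n) \<Rightarrow> 'x) \<Rightarrow> (nat \<Rightarrow> 'n) \<Rightarrow> 'x" where
  "contract sc k d x \<nu> = (\<Sum>i\<in>UNIV. sc (d i) (x (insert_pair k i \<nu>)))"

locale leg_space = module sc for sc :: "complex \<Rightarrow> 'x \<Rightarrow> 'x::ab_group_add"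
begin

abbreviation "op \<equiv> leg_op sc"
abbreviation "con \<equiv> contract sc"
abbreviation smul :: "complex \<Rightarrow> ('i \<Rightarrow> 'x) \<Rightarrow> 'i \<Rightarrow> 'x" where "smul c x \<equiv> (\<lambda>i. sc c (x i))"

lemma op_smul: "op k K (smul c x) = smul c (op k K x)"
  unfolding leg_op_def by (simp add: scale_sum_right mult.commute)

lemma con_smul: "con k d (smul c x) = smul c (con k d x)"
  unfolding contract_def by (simp add: scale_sum_right mult.commute)

lemma op_add: "op k K (\<lambda>i. x i + y i) = (\<lambda>i. op k K x i + op k K y i)"
  unfolding leg_op_def by (simp add: scale_right_distrib sum.distrib)

lemma con_add: "con k d (\<lambda>i. x i + y i) = (\<lambda>i. con k d x i + con k d y i)"
  unfolding contract_def by (simp add: scale_right_distrib sum.distrib)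

lemma smul_one: "smul 1 x = x"
  by simp

lemma op_matrix_product:
  fixes x :: "(nat \<Rightarrow> 'n::finite) \<Rightarrow> 'x"
  shows "op k K (op k L x) = op k (K ** L) x"
proof
  fix \<nu> :: "nat \<Rightarrow> 'n"
  have "op k K (op k L x) \<nu> = (\<Sum>J\<in>UNIV. \<Sum>J'\<in>UNIV.
      sc (K $ (\<nu> k, \<nu> (Suc k)) $ J * L $ J $ J') (x (\<nu>(k := fst J', Suc k := snd J'))))"
    unfolding leg_op_def by (simp add: scale_sum_right fun_upd_twist)
  also have "\<dots> = (\<Sum>J'\<in>UNIV. \<Sum>J\<in>UNIV.
      sc (K $ (\<nu> k, \<nu> (Suc k)) $ J * L $ J $ J') (x (\<nu>(k := fst J', Suc k := snd J'))))"
    by (rule sum.swap)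
  also have "\<dots> = op k (K ** L) x \<nu>"
    unfolding leg_op_def matrix_matrix_mult_def by (simp add: scale_sum_left)
  finally show "op k K (op k L x) \<nu> = op k (K ** L) x \<nu>" .
qed

lemma op_mat_1:
  fixes x :: "(nat \<Rightarrow> 'n::finite) \<Rightarrow> 'x"
  shows "op k (mat 1) x = x"
proof
  fix \<nu> :: "nat \<Rightarrow> 'n"
  have "op k (mat 1) x \<nu> = (\<Sum>J\<in>UNIV. if (\<nu> k, \<nu> (Suc k)) = J
      then x (\<nu>(k := fst J, Suc k := snd J)) else 0)"
    unfolding leg_op_def mat_def by (intro sum.cong) auto
  also have "\<dots> = x \<nu>"
    by (subst sum.delta') auto
  finally show "op k (mat 1) x \<nu> = x \<nu>" .
qed

lemma op_commute:
  fixes x :: "(nat \<Rightarrow> 'n::finite) \<Rightarrow> 'x"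
  assumes "k + 2 \<le> l"
  shows "op k K (op l L x) = op l L (op k K x)"
proof
  fix \<nu> :: "nat \<Rightarrow> 'n"
  have ne: "k \<noteq> l" "Suc k \<noteq> l" "k \<noteq> Suc l" "l \<noteq> k" "l \<noteq> Suc k" "Suc l \<noteq> k" using assms by auto
  have upd: "\<nu>(k := a, Suc k := b, l := c, Suc l := d) = \<nu>(l := c, Suc l := d, k := a, Suc k := b)"
    for a b c d using ne by (auto simp: fun_eq_iff)
  show "op k K (op l L x) \<nu> = op l L (op k K x) \<nu>"
    unfolding leg_op_def using ne
    by (simp add: scale_sum_right upd, subst sum.swap, simp add: mult.commute)
qed

lemma con_op_before:
  fixes x :: "(nat \<Rightarrow> 'n::finite) \<Rightarrow> 'x"
  assumes "l + 2 \<le> k"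
  shows "con k d (op l K x) = op l K (con k d x)"
proof
  fix \<nu> :: "nat \<Rightarrow> 'n"
  have upd: "(insert_pair k i \<nu>)(l := a, Suc l := b) = insert_pair k i (\<nu>(l := a, Suc l := b))"
    for i a b using assms by (auto simp: fun_eq_iff insert_pair_def)
  have at: "insert_pair k i \<nu> l = \<nu> l" "insert_pair k i \<nu> (Suc l) = \<nu> (Suc l)" for i
    using assms by (auto simp: insert_pair_def)
  show "con k d (op l K x) \<nu> = op l K (con k d x) \<nu>"
    unfolding leg_op_def contract_def
    by (simp add: scale_sum_right upd at, subst sum.swap, simp add: mult.commute)
qed

lemma con_op_after:
  fixes x :: "(nat \<Rightarrow> 'n::finite) \<Rightarrow> 'x"
  assumes "k \<le> l"
  shows "con k d (op (l + 2) K x) = op l K (con k d x)"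
proof
  fix \<nu> :: "nat \<Rightarrow> 'n"
  have upd: "(insert_pair k i \<nu>)(Suc (Suc l) := a, Suc (Suc (Suc l)) := b)
      = insert_pair k i (\<nu>(l := a, Suc l := b))"
    for i a b using assms by (auto simp: fun_eq_iff insert_pair_def)
  have at: "insert_pair k i \<nu> (Suc (Suc l)) = \<nu> l"
      "insert_pair k i \<nu> (Suc (Suc (Suc l))) = \<nu> (Suc l)" for i
    using assms by (auto simp: insert_pair_def)
  show "con k d (op (l + 2) K x) \<nu> = op l K (con k d x) \<nu>"
    unfolding leg_op_def contract_def
    by (simp add: scale_sum_right upd at, subst sum.swap, simp add: mult.commute)
qed

lemma con_con:
  fixes x :: "(nat \<Rightarrow> 'n::finite) \<Rightarrow> 'x"
  assumes "k \<le> l"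
  shows "con k d (con (l + 2) e x) = con l e (con k d x)"
proof
  fix \<nu> :: "nat \<Rightarrow> 'n"
  have upd: "insert_pair (Suc (Suc l)) j (insert_pair k i \<nu>) = insert_pair k i (insert_pair l j \<nu>)" for i j
    using assms by (auto simp: fun_eq_iff insert_pair_def numeral_2_eq_2 less_Suc_eq_le Suc_diff_le)
  show "con k d (con (l + 2) e x) \<nu> = con l e (con k d x) \<nu>"
    unfolding contract_def
    by (simp add: scale_sum_right upd, subst sum.swap, simp add: mult.commute)
qed

end

section \<open>The Hecke type R-matrix\<close>

text \<open>
  The standard braiding \<open>v\<^sub>i \<otimes> v\<^sub>j \<mapsto> u s v\<^sub>j \<otimes> v\<^sub>i\<close>, plus a diagonal correction for the pairs that are in
  descending order with respect to \<open>f\<close>. It is \<open>u\<close> on \<open>v\<^sub>i \<otimes> v\<^sub>i\<close>, so for \<open>s = q\<^sup>-\<^sup>1\<close> it is the R-matrix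
  of type A up to normalisation. Inverting it inverts \<open>u\<close> and \<open>s\<close> and reverses the order.
\<close>

definition hecke_R :: "complex \<Rightarrow> complex \<Rightarrow> ('n \<Rightarrow> int) \<Rightarrow> complex^('n::finite \<times> 'n)^('n \<times> 'n)" where
  "hecke_R u s f = (\<chi> I J.
     (if fst I \<noteq> snd I \<and> J = (snd I, fst I) then u * s else 0)
     + (if J = I then if fst I = snd I then u else if f (snd I) < f (fst I) then u * (1 - s * s) else 0
        else 0))"

text \<open>
  Given a matrix \<open>K\<close> on \<open>V \<otimes> V\<close>, the map \<open>V \<otimes> V\<^sup>* \<rightarrow> V\<^sup>* \<otimes> V\<close> obtained by bending one input and one
  output of \<open>K\<close> around with the pairing \<open>E'\<close>. By naturality of the braiding with respect to \<open>E'\<close>, the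
  braiding of \<open>V\<close> with \<open>V\<^sup>*\<close> arises in this way from the inverse of the braiding of \<open>V\<close> with itself.
\<close>

definition mixed_R ::
  "('n \<Rightarrow> complex) \<Rightarrow> complex^('n \<times> 'n)^('n \<times> 'n) \<Rightarrow> complex^('n::finite \<times> 'n)^('n \<times> 'n)" where
  "mixed_R d K = (\<chi> I J. d (snd J) / d (fst I) * K $ (snd I, snd J) $ (fst I, fst J))"

lemma hecke_R_entry:
  "hecke_R u s f $ (i, j) $ (k, l) =
    (if i = j then if k = i \<and> l = i then u else 0
     else if k = j \<and> l = i then u * s
     else if k = i \<and> l = j \<and> f j < f i then u * (1 - s * s) else 0)"
  unfolding hecke_R_def by auto

lemma hecke_R_inverse:
  fixes f :: "'a::finite \<Rightarrow> int"
  assumes "inj f" "u \<noteq> 0" "s \<noteq> 0"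
  shows "hecke_R u s f ** hecke_R (1 / u) (1 / s) (\<lambda>i. - f i) = mat 1"
proof -
  have "(hecke_R u s f ** hecke_R (1 / u) (1 / s) (\<lambda>i. - f i)) $ I $ J = mat 1 $ I $ J" for I J
  proof -
    have sum: "(\<Sum>K\<in>UNIV. ((if fst I \<noteq> snd I \<and> K = (snd I, fst I) then a else 0)
        + (if K = I then b else 0)) * h K)
        = (if fst I \<noteq> snd I then a * h (snd I, fst I) else 0) + b * h I" for a b and h :: "_ \<Rightarrow> complex"
      by (simp add: distrib_right sum.distrib if_distrib [of "\<lambda>x. x * _"] cong: if_cong)
    let ?b = "if fst I = snd I then u else if f (snd I) < f (fst I) then u * (1 - s * s) else 0"
    let ?h = "\<lambda>K. hecke_R (1 / u) (1 / s) (\<lambda>i. - f i) $ K $ J"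
    have "(hecke_R u s f ** hecke_R (1 / u) (1 / s) (\<lambda>i. - f i)) $ I $ J
        = (\<Sum>K\<in>UNIV. ((if fst I \<noteq> snd I \<and> K = (snd I, fst I) then u * s else 0)
            + (if K = I then ?b else 0)) * ?h K)"
      unfolding matrix_matrix_mult_def by (subst (1) hecke_R_def) simp
    also have "\<dots> = (if fst I \<noteq> snd I then u * s * ?h (snd I, fst I) else 0) + ?b * ?h I"
      by (rule sum)
    also have "\<dots> = mat 1 $ I $ J"
    proof (cases I; cases J)
      fix i j k l assume IJ: "I = (i, j)" "J = (k, l)"
      show ?thesis
      proof (cases "i = j")
        case True
        then show ?thesis using IJ assms(2) by (auto simp: mat_def hecke_R_entry)
      next
        case False
        then have ff: "f i < f j \<and> \<not> f j < f i \<or> f j < f i \<and> \<not> f i < f j"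
          using inj_eq[OF assms(1), of i j] by auto
        let ?R' = "hecke_R (1 / u) (1 / s) (\<lambda>i. - f i)"
        have unf: "(if fst I \<noteq> snd I then u * s * ?h (snd I, fst I) else 0) + ?b * ?h I
          = u * s * ?R' $ (j, i) $ (k, l) + (if f j < f i then u * (1 - s * s) else 0) * ?R' $ (i, j) $ (k, l)"
          using False IJ by simp
        consider "k = j" "l = i" | "k = i" "l = j" | "(k, l) \<noteq> (i, j)" "(k, l) \<noteq> (j, i)"
          by auto
        then show ?thesis
        proof cases
          case 1
          have "?R' $ (j, i) $ (k, l) = (if f j < f i then 1 / u * (1 - 1 / s * (1 / s)) else 0)"
            "?R' $ (i, j) $ (k, l) = 1 / u * (1 / s)" "(mat 1 :: complex^('a \<times> 'a)^('a \<times> 'a)) $ I $ J = 0"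
            using 1 False IJ by (simp_all add: hecke_R_entry mat_def)
          then show ?thesis
            unfolding unf using assms(2,3) by (simp add: field_simps)
        next
          case 2
          have "?R' $ (j, i) $ (k, l) = 1 / u * (1 / s)"
            "?R' $ (i, j) $ (k, l) = (if f i < f j then 1 / u * (1 - 1 / s * (1 / s)) else 0)"
            "(mat 1 :: complex^('a \<times> 'a)^('a \<times> 'a)) $ I $ J = 1"
            using 2 False IJ by (simp_all add: hecke_R_entry mat_def)
          then show ?thesis
            unfolding unf using assms(2,3) ff by auto
        next
          case 3
          have "?R' $ (j, i) $ (k, l) = 0" "?R' $ (i, j) $ (k, l) = 0"
            "(mat 1 :: complex^('a \<times> 'a)^('a \<times> 'a)) $ I $ J = 0"
            using 3 False IJ by (auto simp: hecke_R_entry mat_def)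
          then show ?thesis
            unfolding unf by simp
        qed
      qed
    qed
    finally show ?thesis .
  qed
  then show ?thesis by (simp add: vec_eq_iff)
qed

context leg_space
begin

lemma op_hecke_R:
  "op k (hecke_R u s f) x \<nu> =
    (if \<nu> k = \<nu> (Suc k) then sc u (x \<nu>)
     else sc (u * s) (x (\<nu>(k := \<nu> (Suc k), Suc k := \<nu> k)))
       + (if f (\<nu> (Suc k)) < f (\<nu> k) then sc (u * (1 - s * s)) (x \<nu>) else 0))"
proof -
  let ?a = "\<nu> k" and ?b = "\<nu> (Suc k)"
  define y where "y J = x (\<nu>(k := fst J, Suc k := snd J))" for J
  have "op k (hecke_R u s f) x \<nu> = (\<Sum>J\<in>UNIV.
      (if ?a \<noteq> ?b \<and> J = (?b, ?a) then sc (u * s) (y J) else 0)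
     + (if J = (?a, ?b) then
          if ?a = ?b then sc u (y J) else if f ?b < f ?a then sc (u * (1 - s * s)) (y J) else 0
        else 0))"
    unfolding leg_op_def hecke_R_def y_def[symmetric]
    by (intro sum.cong refl) (auto simp: scale_left_distrib)
  also have "\<dots> = (if ?a = ?b then sc u (y (?a, ?b)) else sc (u * s) (y (?b, ?a))
       + (if f ?b < f ?a then sc (u * (1 - s * s)) (y (?a, ?b)) else 0))"
    by (simp add: sum.distrib)
  finally show ?thesis
    unfolding y_def fst_conv snd_conv fun_upd_triv .
qed

text \<open>
  On the span of \<open>v\<^sub>i \<otimes> v\<^sub>j\<close> and \<open>v\<^sub>j \<otimes> v\<^sub>i\<close> the matrix has trace \<open>u (1 - s\<^sup>2)\<close> and determinant
  \<open>- u\<^sup>2 s\<^sup>2\<close>. Its eigenvalues there are \<open>u\<close> and \<open>- u s\<^sup>2\<close>, and on \<open>v\<^sub>i \<otimes> v\<^sub>i\<close> it is \<open>u\<close>.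
\<close>

lemma op_hecke_R_quadratic:
  assumes "inj f" "u \<noteq> 0" "s \<noteq> 0"
  shows "op k (hecke_R u s f) x \<nu> = sc (u * u * s * s) (op k (hecke_R (1 / u) (1 / s) (\<lambda>i. - f i)) x \<nu>)
      + sc (u * (1 - s * s)) (x \<nu>)"
proof -
  let ?y = "x (\<nu>(k := \<nu> (Suc k), Suc k := \<nu> k))" and ?z = "x \<nu>"
  have c: "u * u * s * s * (1 / u) = u - u * (1 - s * s)"
      "u * u * s * s * (1 / u * (1 / s)) = u * s"
      "u * u * s * s * (1 / u * (1 - 1 / s * (1 / s))) = - (u * (1 - s * s))"
    using assms(2,3) by (simp_all add: field_simps)
  show ?thesis
  proof (cases rule: linorder_cases[of "f (\<nu> k)" "f (\<nu> (Suc k))"])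
    case less
    then have ne: "\<nu> k \<noteq> \<nu> (Suc k)" by auto
    show ?thesis
      unfolding op_hecke_R using less ne
      by (simp add: scale_right_distrib c del: times_divide_eq_right times_divide_eq_left mult_1)
  next
    case equal
    then have "\<nu> k = \<nu> (Suc k)" using inj_eq[OF assms(1)] by auto
    then show ?thesis
      unfolding op_hecke_R by (simp add: c scale_left_diff_distrib del: times_divide_eq_right)
  next
    case greater
    then have ne: "\<nu> k \<noteq> \<nu> (Suc k)" by auto
    show ?thesis
      unfolding op_hecke_R using greater ne
      by (simp add: scale_right_distrib c del: times_divide_eq_right times_divide_eq_left mult_1)
  qed
qed

text \<open>
  Both sides only mix the permutations of one triple of indices. The identity is therefore polynomial
  in \<open>u\<close> and \<open>s\<close> for each of the relative orders of the three indices.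
\<close>

lemma op_hecke_R_braid:
  fixes f :: "'n::finite \<Rightarrow> int"
  assumes "inj f"
  shows "op k (hecke_R u s f) (op (Suc k) (hecke_R u s f) (op k (hecke_R u s f) x))
    = op (Suc k) (hecke_R u s f) (op k (hecke_R u s f) (op (Suc k) (hecke_R u s f) x))"
proof
  fix \<nu> :: "nat \<Rightarrow> 'n"
  define y where "y a b c = x (\<nu>(k := a, Suc k := b, Suc (Suc k) := c))" for a b c
  define X where "X a b c = \<nu>(k := a, Suc k := b, Suc (Suc k) := c)" for a b c
  have swap1: "(X a b c)(k := b', Suc k := a') = X b' a' c" for a b c a' b'
    unfolding X_def by (auto simp: fun_eq_iff)
  have swap2: "(X a b c)(Suc k := b', Suc (Suc k) := c') = X a b' c'" for a b c c' b'
    unfolding X_def by (auto simp: fun_eq_iff)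
  have at: "X a b c k = a" "X a b c (Suc k) = b" "X a b c (Suc (Suc k)) = c" for a b c
    unfolding X_def by auto
  have step1: "op k (hecke_R u s f) z (X a b c) = (if a = b then sc u (z (X a b c))
      else sc (u * s) (z (X b a c)) + (if f b < f a then sc (u * (1 - s * s)) (z (X a b c)) else 0))"
    for z a b c unfolding op_hecke_R at swap1 by simp
  have step2: "op (Suc k) (hecke_R u s f) z (X a b c) = (if b = c then sc u (z (X a b c))
      else sc (u * s) (z (X a c b)) + (if f c < f b then sc (u * (1 - s * s)) (z (X a b c)) else 0))"
    for z a b c unfolding op_hecke_R at swap2 by simp
  have order: "(a = b \<Longrightarrow> P) \<Longrightarrow> (f a < f b \<Longrightarrow> a \<noteq> b \<Longrightarrow> b \<noteq> a \<Longrightarrow> P)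
      \<Longrightarrow> (f b < f a \<Longrightarrow> a \<noteq> b \<Longrightarrow> b \<noteq> a \<Longrightarrow> P) \<Longrightarrow> P" for a b P
    using inj_eq[OF assms, of a b] by (cases "f a" "f b" rule: linorder_cases) auto
  \<comment> \<open>each relative order of \<open>a\<close>, \<open>b\<close>, \<open>c\<close> fixes all conditionals\<close>
  have "op k (hecke_R u s f) (op (Suc k) (hecke_R u s f) (op k (hecke_R u s f) x)) (X a b c)
    = op (Suc k) (hecke_R u s f) (op k (hecke_R u s f) (op (Suc k) (hecke_R u s f) x)) (X a b c)" for a b c
    unfolding step1 step2
    apply (rule order[of a b]; rule order[of b c]; rule order[of a c])
    apply (simp_all (no_asm_simp))
    apply (simp_all add: algebra_simps)
    done
  from this[of "\<nu> k" "\<nu> (Suc k)" "\<nu> (Suc (Suc k))"]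
  show "op k (hecke_R u s f) (op (Suc k) (hecke_R u s f) (op k (hecke_R u s f) x)) \<nu>
    = op (Suc k) (hecke_R u s f) (op k (hecke_R u s f) (op (Suc k) (hecke_R u s f) x)) \<nu>"
    by (simp add: X_def)
qed

end

section \<open>The mixed R-matrix\<close>

lemma sum_UNIV_pair: "(\<Sum>J\<in>UNIV. h J) = (\<Sum>a\<in>UNIV. \<Sum>b\<in>UNIV. h (a, b))"
  for h :: "'a::finite \<times> 'b::finite \<Rightarrow> 'x::comm_monoid_add"
  unfolding UNIV_Times_UNIV[symmetric] sum.cartesian_product by simp

context leg_space
begin

lemma op_eq_sum:
  "op k K x \<nu> = (\<Sum>a\<in>UNIV. \<Sum>b\<in>UNIV. sc (K $ (\<nu> k, \<nu> (Suc k)) $ (a, b)) (x (\<nu>(k := a, Suc k := b))))"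
  unfolding leg_op_def sum_UNIV_pair by simp

text \<open>
  Naturality with respect to \<open>E'\<close>: a copy of \<open>V\<close> is moved across a pair \<open>V \<otimes> V\<^sup>*\<close> that is about to be
  contracted. Moving it past \<open>V\<^sup>*\<close> is inverse to moving it past \<open>V\<close>.
\<close>

lemma con_op_mixed_R_below:
  fixes x :: "(nat \<Rightarrow> 'n::finite) \<Rightarrow> 'x"
  assumes "\<And>i. d i \<noteq> 0"
  shows "con k d (op (Suc k) (mixed_R d K) x) = con (Suc k) d (op k K x)"
proof
  fix \<nu> :: "nat \<Rightarrow> 'n"
  define X where "X a b c = (\<lambda>l. if l < k then \<nu> l else if l = k then a else if l = Suc k then b
    else if l = Suc (Suc k) then c else \<nu> (l - 2))" for a b c
  have at: "insert_pair k a \<nu> (Suc k) = a" "insert_pair k a \<nu> (Suc (Suc k)) = \<nu> k"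
      "insert_pair (Suc k) a \<nu> (Suc k) = a" "insert_pair (Suc k) a \<nu> k = \<nu> k" for a
    by (auto simp: insert_pair_def)
  have upd: "(insert_pair k a \<nu>)(Suc k := b, Suc (Suc k) := c) = X a b c"
      "(insert_pair (Suc k) c \<nu>)(k := a, Suc k := b) = X a b c" for a b c
    by (auto simp: fun_eq_iff insert_pair_def X_def)
  have "con k d (op (Suc k) (mixed_R d K) x) \<nu>
      = (\<Sum>a\<in>UNIV. \<Sum>b\<in>UNIV. \<Sum>c\<in>UNIV. sc (d c * K $ (\<nu> k, c) $ (a, b)) (x (X a b c)))"
    unfolding contract_def op_eq_sum mixed_R_def using assms by (simp add: at upd scale_sum_right)
  also have "\<dots> = (\<Sum>a\<in>UNIV. \<Sum>c\<in>UNIV. \<Sum>b\<in>UNIV. sc (d c * K $ (\<nu> k, c) $ (a, b)) (x (X a b c)))"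
    by (intro sum.cong refl sum.swap)
  also have "\<dots> = (\<Sum>c\<in>UNIV. \<Sum>a\<in>UNIV. \<Sum>b\<in>UNIV. sc (d c * K $ (\<nu> k, c) $ (a, b)) (x (X a b c)))"
    by (rule sum.swap)
  also have "\<dots> = con (Suc k) d (op k K x) \<nu>"
    unfolding contract_def op_eq_sum by (simp add: at upd scale_sum_right)
  finally show "con k d (op (Suc k) (mixed_R d K) x) \<nu> = con (Suc k) d (op k K x) \<nu>" .
qed

text \<open>
  Naturality again, now with a copy of \<open>V\<^sup>*\<close> moved across the pair. The hypothesis \<open>H\<close> says that \<open>H\<close> is \<open>K\<close>
  transposed with respect to the pairing.
\<close>

lemma con_op_mixed_R_above:
  fixes x :: "(nat \<Rightarrow> 'n::finite) \<Rightarrow> 'x"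
  assumes "\<And>i. d i \<noteq> 0"
    and H: "\<And>z u i y. d u * d y * K $ (u, y) $ (z, i) = d z * d i * H $ (i, z) $ (y, u)"
  shows "con (Suc k) d (op k (mixed_R d K) x) = con k d (op (Suc k) H x)"
proof
  fix \<nu> :: "nat \<Rightarrow> 'n"
  define X where "X a b c = (\<lambda>l. if l < k then \<nu> l else if l = k then a else if l = Suc k then b
    else if l = Suc (Suc k) then c else \<nu> (l - 2))" for a b c
  have at: "insert_pair k a \<nu> (Suc k) = a" "insert_pair k a \<nu> (Suc (Suc k)) = \<nu> k"
      "insert_pair (Suc k) a \<nu> (Suc k) = a" "insert_pair (Suc k) a \<nu> k = \<nu> k" for a
    by (auto simp: insert_pair_def)
  have upd: "(insert_pair k a \<nu>)(Suc k := b, Suc (Suc k) := c) = X a b c"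
      "(insert_pair (Suc k) c \<nu>)(k := a, Suc k := b) = X a b c" for a b c
    by (auto simp: fun_eq_iff insert_pair_def X_def)
  have coeff: "d u * (d y * K $ (u, y) $ (\<nu> k, i)) / d (\<nu> k) = d i * H $ (i, \<nu> k) $ (y, u)" for u y i
    using H[of u y "\<nu> k" i] assms(1)[of "\<nu> k"] by (simp add: field_simps)
  have "con k d (op (Suc k) H x) \<nu>
      = (\<Sum>a\<in>UNIV. \<Sum>b\<in>UNIV. \<Sum>c\<in>UNIV. sc (d a * H $ (a, \<nu> k) $ (b, c)) (x (X a b c)))"
    unfolding contract_def op_eq_sum by (simp add: at upd scale_sum_right)
  also have "\<dots> = (\<Sum>a\<in>UNIV. \<Sum>c\<in>UNIV. \<Sum>b\<in>UNIV. sc (d a * H $ (a, \<nu> k) $ (b, c)) (x (X a b c)))"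
    by (intro sum.cong refl sum.swap)
  also have "\<dots> = (\<Sum>c\<in>UNIV. \<Sum>a\<in>UNIV. \<Sum>b\<in>UNIV. sc (d a * H $ (a, \<nu> k) $ (b, c)) (x (X a b c)))"
    by (rule sum.swap)
  also have "\<dots> = con (Suc k) d (op k (mixed_R d K) x) \<nu>"
    unfolding contract_def op_eq_sum mixed_R_def by (simp add: at upd scale_sum_right coeff)
  finally show "con (Suc k) d (op k (mixed_R d K) x) \<nu> = con k d (op (Suc k) H x) \<nu>" by simp
qed

end

lemma hecke_R_transpose:
  "d u * d y * hecke_R v t (\<lambda>i. - f i) $ (u, y) $ (z, i) = d z * d i * hecke_R v t f $ (i, z) $ (y, u)"
proof -
  consider "z = u" "i = y" | "z = y" "i = u" "y \<noteq> u" | "(z, i) \<noteq> (u, y)" "(z, i) \<noteq> (y, u)"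
    by blast
  then show ?thesis
  proof cases
    case 1
    show ?thesis unfolding 1 hecke_R_entry by simp
  next
    case 2
    show ?thesis unfolding 2(1,2) hecke_R_entry using 2(3) by simp
  next
    case 3
    then have "hecke_R v t (\<lambda>i. - f i) $ (u, y) $ (z, i) = 0" "hecke_R v t f $ (i, z) $ (y, u) = 0"
      unfolding hecke_R_entry by (simp_all only: prod.inject split: if_split) blast+
    then show ?thesis by simp
  qed
qed

text \<open>
  The composition of the evaluation \<open>E\<close> with the braiding is an invariant pairing on \<open>V \<otimes> V\<^sup>*\<close>, hence a
  multiple of \<open>E'\<close>. The factor comes from a telescoping geometric sum over the indices that precede \<open>c\<close>.
\<close>

lemma mixed_R_evaluation:
  fixes d :: "'n::finite \<Rightarrow> complex" and pos :: "'n \<Rightarrow> nat"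
  assumes pos: "bij_betw pos UNIV {1..N}" and d: "\<And>i. d i = D * s ^ (2 * pos i)"
    and nz: "D \<noteq> 0" "s \<noteq> 0" "u \<noteq> 0"
  shows "(\<Sum>i\<in>UNIV. mixed_R d (hecke_R (1 / u) (1 / s) (\<lambda>i. - int (pos i))) $ (i, i) $ (b, c))
      = (if b = c then d b / (u * D * s\<^sup>2) else 0)"
proof (cases "b = c")
  case False
  then have "mixed_R d (hecke_R (1 / u) (1 / s) (\<lambda>i. - int (pos i))) $ (i, i) $ (b, c) = 0" for i
    by (auto simp: mixed_R_def hecke_R_entry)
  then show ?thesis using False by simp
next
  case [simp]: True
  have inj: "pos i = pos j \<longleftrightarrow> i = j" for i j
    using pos by (auto simp: bij_betw_def inj_on_def)
  let ?B = "pos c"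
  have B: "?B \<ge> 1" "?B \<le> N" using pos by (auto simp: bij_betw_def)
  have dd: "d c / d i = s ^ (2 * (?B - pos i))" if "pos i \<le> ?B" for i
    using that nz by (simp add: d power_diff right_diff_distrib')
  have "(\<Sum>i\<in>UNIV. mixed_R d (hecke_R (1 / u) (1 / s) (\<lambda>i. - int (pos i))) $ (i, i) $ (b, c))
      = (\<Sum>i\<in>UNIV. (if i = c then 1 / u else 0)
          + (if pos i < ?B then s ^ (2 * (?B - pos i)) * (1 / u * (1 - 1 / s * (1 / s))) else 0))"
  proof (intro sum.cong refl)
    fix i
    let ?M = "mixed_R d (hecke_R (1 / u) (1 / s) (\<lambda>i. - int (pos i))) $ (i, i) $ (b, c)"
    have M: "?M = d c / d i * hecke_R (1 / u) (1 / s) (\<lambda>i. - int (pos i)) $ (i, c) $ (i, c)"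
      by (simp add: mixed_R_def)
    show "?M = (if i = c then 1 / u else 0)
          + (if pos i < ?B then s ^ (2 * (?B - pos i)) * (1 / u * (1 - 1 / s * (1 / s))) else 0)"
    proof (cases "i = c")
      case True
      moreover have "d c \<noteq> 0" using nz by (simp add: d)
      ultimately show ?thesis unfolding M by (simp add: hecke_R_entry)
    next
      case False
      show ?thesis
      proof (cases "pos i < ?B")
        case True
        then show ?thesis unfolding M dd[OF less_imp_le[OF True]] using \<open>i \<noteq> c\<close> by (simp add: hecke_R_entry)
      next
        case False
        then show ?thesis unfolding M using \<open>i \<noteq> c\<close> by (simp add: hecke_R_entry)
      qed
    qed
  qed
  also have "\<dots> = 1 / u + (\<Sum>i\<in>UNIV. if pos i < ?B then s ^ (2 * (?B - pos i)) * (1 / u * (1 - 1 / s * (1 / s))) else 0)"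
    by (simp add: sum.distrib)
  also have "(\<Sum>i\<in>UNIV. if pos i < ?B then s ^ (2 * (?B - pos i)) * (1 / u * (1 - 1 / s * (1 / s))) else 0)
      = (\<Sum>n\<in>{1..N}. if n < ?B then s ^ (2 * (?B - n)) * (1 / u * (1 - 1 / s * (1 / s))) else 0)"
    by (rule sum.reindex_bij_betw[OF pos])
  also have "\<dots> = (\<Sum>n\<in>{1..<?B}. s ^ (2 * (?B - n)) * (1 / u * (1 - 1 / s * (1 / s))))"
    using B by (intro sum.mono_neutral_cong_right) auto
  also have "\<dots> = (\<Sum>n\<in>{1..<?B}. s ^ (2 * n) * (1 / u * (1 - 1 / s * (1 / s))))"
    by (rule sum.reindex_bij_witness[where i = "\<lambda>n. ?B - n" and j = "\<lambda>n. ?B - n"]) auto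
  also have "\<dots> = 1 / u * (s ^ (2 * (?B - 1)) - 1)"
  proof -
    \<comment> \<open>the summands telescope\<close>
    have step: "s ^ (2 * Suc k) * (1 / u * (1 - 1 / s * (1 / s))) = 1 / u * (s ^ (2 * Suc k) - s ^ (2 * k))" for k
      using nz by (simp add: field_simps)
    have "(\<Sum>n\<in>{1..<Suc k}. s ^ (2 * n) * (1 / u * (1 - 1 / s * (1 / s)))) = 1 / u * (s ^ (2 * k) - 1)" for k
    proof (induction k)
      case (Suc k)
      have "(\<Sum>n\<in>{1..<Suc (Suc k)}. s ^ (2 * n) * (1 / u * (1 - 1 / s * (1 / s))))
          = 1 / u * (s ^ (2 * k) - 1) + 1 / u * (s ^ (2 * Suc k) - s ^ (2 * k))"
        using Suc step[of k] by (simp only: sum.atLeastLessThan_Suc Suc_le_eq zero_less_Suc if_True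
            le_add1 One_nat_def)
      then show ?case by (simp add: right_diff_distrib)
    qed simp
    from this[of "?B - 1"] show ?thesis using B by simp
  qed
  also have "1 / u + 1 / u * (s ^ (2 * (?B - 1)) - 1) = d c / (u * D * s\<^sup>2)"
  proof -
    have "s ^ (2 * ?B) = s ^ (2 * (?B - 1)) * s\<^sup>2"
      using B by (cases ?B) (simp_all add: power2_eq_square)
    then show ?thesis using nz by (simp add: d right_diff_distrib)
  qed
  finally show ?thesis by simp
qed

context leg_space
begin

lemma con_op_of_evaluation:
  fixes x :: "(nat \<Rightarrow> 'n::finite) \<Rightarrow> 'x"
  assumes "\<And>b c. (\<Sum>i\<in>UNIV. A $ (i, i) $ (b, c)) = (if b = c then e b else 0)"
  shows "con k (\<lambda>i. 1) (op k A x) = con k e x"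
proof
  fix \<nu> :: "nat \<Rightarrow> 'n"
  define X where "X a b = (\<lambda>l. if l < k then \<nu> l else if l = k then a else if l = Suc k then b
    else \<nu> (l - 2))" for a b
  have at: "insert_pair k a \<nu> k = a" "insert_pair k a \<nu> (Suc k) = a" for a
    by (auto simp: insert_pair_def)
  have upd: "(insert_pair k i \<nu>)(k := a, Suc k := b) = X a b" "insert_pair k i \<nu> = X i i" for a b i
    by (auto simp: fun_eq_iff insert_pair_def X_def)
  have "con k (\<lambda>i. 1) (op k A x) \<nu>
      = (\<Sum>i\<in>UNIV. \<Sum>a\<in>UNIV. \<Sum>b\<in>UNIV. sc (A $ (i, i) $ (a, b)) (x (X a b)))"
    unfolding contract_def op_eq_sum by (simp add: at upd(1))
  also have "\<dots> = (\<Sum>a\<in>UNIV. \<Sum>i\<in>UNIV. \<Sum>b\<in>UNIV. sc (A $ (i, i) $ (a, b)) (x (X a b)))"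
    by (rule sum.swap)
  also have "\<dots> = (\<Sum>a\<in>UNIV. \<Sum>b\<in>UNIV. \<Sum>i\<in>UNIV. sc (A $ (i, i) $ (a, b)) (x (X a b)))"
    by (intro sum.cong refl sum.swap)
  also have "\<dots> = (\<Sum>a\<in>UNIV. \<Sum>b\<in>UNIV. sc (if a = b then e a else 0) (x (X a b)))"
    by (simp add: assms flip: scale_sum_left)
  also have "\<dots> = (\<Sum>a\<in>UNIV. \<Sum>b\<in>UNIV. if a = b then sc (e a) (x (X a b)) else 0)"
    by (intro sum.cong refl) auto
  also have "\<dots> = con k e x \<nu>"
    unfolding contract_def by (simp add: upd(2))
  finally show "con k (\<lambda>i. 1) (op k A x) \<nu> = con k e x \<nu>" .
qed

end

text \<open>
  The matrix permutes the \<open>v\<^sub>a \<otimes> f\<^sup>l\<close> with \<open>a \<noteq> l\<close> up to nonzero factors, and is triangular on the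
  \<open>v\<^sub>a \<otimes> f\<^sup>a\<close>. So the components of a kernel vector vanish, the diagonal ones by descending induction on
  \<open>f a\<close>.
\<close>

lemma mixed_R_injective:
  fixes d :: "'n::finite \<Rightarrow> complex" and f :: "'n \<Rightarrow> int"
  assumes d: "\<And>i. d i \<noteq> 0" and v: "v \<noteq> 0" "t \<noteq> 0" and f: "inj f"
    and 0: "mixed_R d (hecke_R v t (\<lambda>i. - f i)) *v x = 0"
  shows "x = 0"
proof -
  have eq: "(\<Sum>J\<in>UNIV. mixed_R d (hecke_R v t (\<lambda>i. - f i)) $ (a, l) $ J * x $ J) = 0" for a l
    using arg_cong[OF 0, of "\<lambda>y. y $ (a, l)"] unfolding matrix_vector_mult_def by simp
  have off: "x $ (l, a) = 0" if "a \<noteq> l" for a l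
  proof -
    have "mixed_R d (hecke_R v t (\<lambda>i. - f i)) $ (a, l) $ J * x $ J
        = (if J = (l, a) then v * t * x $ (l, a) else 0)" for J
      using d that by (cases J) (simp add: mixed_R_def hecke_R_entry)
    then show ?thesis using eq[of a l] v by simp
  qed
  have diag: "x $ (a, a) = 0" for a
  proof (induction a rule: measure_induct_rule[where f = "\<lambda>a. nat (Max (range f) - f a)"])
    case (less a)
    have upper: "x $ (b, b) = 0" if "f a < f b" for b
    proof (rule less)
      have "f b \<le> Max (range f)" by simp
      then show "nat (Max (range f) - f b) < nat (Max (range f) - f a)" using that by linarith
    qed
    have "mixed_R d (hecke_R v t (\<lambda>i. - f i)) $ (a, a) $ J * x $ J
        = (if J = (a, a) then v * x $ (a, a) else 0)" for J
    proof (cases J)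
      case (Pair b c)
      show ?thesis
      proof (cases "b = c")
        case True
        then show ?thesis unfolding Pair using d[of a] upper[of c]
          by (auto simp: mixed_R_def hecke_R_entry)
      next
        case False
        then show ?thesis unfolding Pair using off[of c b] by auto
      qed
    qed
    then show ?case using eq[of a a] v by simp
  qed
  show ?thesis
    unfolding vec_eq_iff using off diag by (metis surj_pair zero_index)
qed

lemma mixed_R_inverse:
  fixes d :: "'n::finite \<Rightarrow> complex" and f :: "'n \<Rightarrow> int"
  assumes d: "\<And>i. d i \<noteq> 0" and v: "v \<noteq> 0" "t \<noteq> 0" and f: "inj f"
  defines "A \<equiv> mixed_R d (hecke_R v t (\<lambda>i. - f i))"
  shows "A ** matrix_inv A = mat 1" "matrix_inv A ** A = mat 1"
proof -
  have "\<exists>B. B ** A = mat 1"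
    unfolding matrix_left_invertible_ker A_def
    by (intro allI impI, rule mixed_R_injective[where d = d and v = v and t = t and f = f, OF d v f])
  then obtain B where B: "B ** A = mat 1" ..
  moreover from B have "A ** B = mat 1"
    by (simp only: matrix_left_right_inverse)
  ultimately have "\<exists>B. A ** B = mat 1 \<and> B ** A = mat 1"
    by (intro exI conjI)
  from someI_ex[OF this] have inv: "A ** matrix_inv A = mat 1 \<and> matrix_inv A ** A = mat 1"
    unfolding matrix_inv_def .
  from inv show "A ** matrix_inv A = mat 1" by (rule conjunct1)
  from inv show "matrix_inv A ** A = mat 1" by (rule conjunct2)
qed

section \<open>The operators S and T and their contractions\<close>

definition insert_leg :: "nat \<Rightarrow> 'n \<Rightarrow> (nat \<Rightarrow> 'n) \<Rightarrow> nat \<Rightarrow> 'n" where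
  "insert_leg k a \<nu> l = (if l < k then \<nu> l else if l = k then a else \<nu> (l - 1))"

text \<open>
  The tensor product with the basis vector \<open>a\<close> as the new leg \<open>k\<close>. Contracting this leg with a
  neighbour recovers the component \<open>a\<close> of the neighbour. Thus a family is determined by these
  contractions, and an identity between operators on one side of a nondegenerate pairing can be proved
  on the other side.
\<close>

definition attach_leg :: "nat \<Rightarrow> 'n \<Rightarrow> ((nat \<Rightarrow> 'n) \<Rightarrow> 'x::zero) \<Rightarrow> (nat \<Rightarrow> 'n) \<Rightarrow> 'x" where
  "attach_leg k a x \<nu> = (if \<nu> k = a then x (\<lambda>l. if l < k then \<nu> l else \<nu> (Suc l)) else 0)"

context leg_space
begin

lemma op_attach_leg_before:
  fixes x :: "(nat \<Rightarrow> 'n::finite) \<Rightarrow> 'x"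
  assumes "k \<le> l"
  shows "op (Suc l) K (attach_leg k a x) = attach_leg k a (op l K x)"
proof
  fix \<nu> :: "nat \<Rightarrow> 'n"
  have "(\<lambda>j. if j < k then (\<nu>(Suc l := b, Suc (Suc l) := c)) j else (\<nu>(Suc l := b, Suc (Suc l) := c)) (Suc j))
      = (\<lambda>j. if j < k then \<nu> j else \<nu> (Suc j))(l := b, Suc l := c)" for b c
    using assms by (auto simp: fun_eq_iff)
  moreover have "(\<nu>(Suc l := b, Suc (Suc l) := c)) k = \<nu> k" for b c using assms by auto
  ultimately show "op (Suc l) K (attach_leg k a x) \<nu> = attach_leg k a (op l K x) \<nu>"
    using assms unfolding leg_op_def attach_leg_def by auto
qed

lemma op_attach_leg_after:
  fixes x :: "(nat \<Rightarrow> 'n::finite) \<Rightarrow> 'x"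
  assumes "l + 2 \<le> k"
  shows "op l K (attach_leg k a x) = attach_leg k a (op l K x)"
proof
  fix \<nu> :: "nat \<Rightarrow> 'n"
  have "(\<lambda>j. if j < k then (\<nu>(l := b, Suc l := c)) j else (\<nu>(l := b, Suc l := c)) (Suc j))
      = (\<lambda>j. if j < k then \<nu> j else \<nu> (Suc j))(l := b, Suc l := c)" for b c
    using assms by (auto simp: fun_eq_iff)
  moreover have "(\<nu>(l := b, Suc l := c)) k = \<nu> k" for b c using assms by auto
  ultimately show "op l K (attach_leg k a x) \<nu> = attach_leg k a (op l K x) \<nu>"
    using assms unfolding leg_op_def attach_leg_def by auto
qed

lemma con_attach_leg:
  assumes "m = k \<or> m = Suc k"
  shows "con k d (attach_leg m a x) \<nu> = sc (d a) (x (insert_leg k a \<nu>))"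
proof -
  have "(\<lambda>l. if l < m then insert_pair k a \<nu> l else insert_pair k a \<nu> (Suc l)) = insert_leg k a \<nu>"
    using assms by (auto simp: fun_eq_iff insert_pair_def insert_leg_def)
  moreover have "insert_pair k i \<nu> m = i" for i using assms by (auto simp: insert_pair_def)
  ultimately have "sc (d i) (attach_leg m a x (insert_pair k i \<nu>))
      = (if i = a then sc (d a) (x (insert_leg k a \<nu>)) else 0)" for i
    unfolding attach_leg_def by auto
  then show ?thesis unfolding contract_def by simp
qed

lemma con_attach_leg_cancel:
  fixes x y :: "(nat \<Rightarrow> 'n::finite) \<Rightarrow> 'x"
  assumes "m = k \<or> m = Suc k" "\<And>i. d i \<noteq> 0"
    and eq: "\<And>a. con k d (attach_leg m a x) = con k d (attach_leg m a y)"
  shows "x = y"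
proof
  fix \<nu> :: "nat \<Rightarrow> 'n"
  have \<nu>: "insert_leg k (\<nu> k) (\<lambda>l. if l < k then \<nu> l else \<nu> (Suc l)) = \<nu>"
    by (auto simp: fun_eq_iff insert_leg_def)
  have "sc (d (\<nu> k)) (x \<nu>) = sc (d (\<nu> k)) (y \<nu>)"
    using fun_cong[OF eq[of "\<nu> k"], of "\<lambda>l. if l < k then \<nu> l else \<nu> (Suc l)"]
    unfolding con_attach_leg[OF assms(1)] \<nu> .
  then have "sc (1 / d (\<nu> k)) (sc (d (\<nu> k)) (x \<nu>)) = sc (1 / d (\<nu> k)) (sc (d (\<nu> k)) (y \<nu>))"
    by (rule arg_cong)
  then show "x \<nu> = y \<nu>" using assms(2)[of "\<nu> k"] by simp
qed

end

text \<open>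
  The R-matrices in terms of the position \<open>pos i\<close> of a basis vector in the chain. \<open>G\<close>, \<open>H\<close>, \<open>A\<close> are
  the braidings of \<open>V \<otimes> V\<close>, \<open>V\<^sup>* \<otimes> V\<^sup>*\<close>, \<open>V \<otimes> V\<^sup>*\<close>, the suffix \<open>i\<close> marks the inverse, \<open>d\<close> are the
  weights of \<open>E'\<close>, and \<open>c\<close> is the factor between \<open>E\<close> after \<open>A\<close> and \<open>E'\<close>. The calculus has
  \<open>u = q\<^bsup>w\<^esup>\<close>, \<open>z = q\<^sup>-\<^sup>1\<close> and \<open>D = q\<^bsup>r + 2\<^esup>\<close>.
\<close>

locale hecke_data =
  fixes pos :: "'n::finite \<Rightarrow> nat" and N :: nat and u z D :: complex
  assumes pos: "bij_betw pos UNIV {1..N}"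
    and nz: "u \<noteq> 0" "z \<noteq> 0" "D \<noteq> 0"
begin

definition "G = hecke_R u z (\<lambda>i. int (pos i))"
definition "Gi = hecke_R (1 / u) (1 / z) (\<lambda>i. - int (pos i))"
definition "H = hecke_R u z (\<lambda>i. - int (pos i))"
definition "Hi = hecke_R (1 / u) (1 / z) (\<lambda>i. int (pos i))"
definition "d i = D * z ^ (2 * pos i)"
definition "A = mixed_R d Gi"
definition "Ai = matrix_inv A"
definition "c = u * D * z\<^sup>2"

lemma d_nz: "d i \<noteq> 0" using nz by (simp add: d_def)
lemma c_nz: "c \<noteq> 0" using nz by (simp add: c_def)
lemma inj_pos: "inj (\<lambda>i. int (pos i))" "inj (\<lambda>i. - int (pos i))"
  using pos by (auto simp: bij_betw_def inj_on_def)

lemma inverses: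
  "G ** Gi = mat 1" "Gi ** G = mat 1" "H ** Hi = mat 1" "Hi ** H = mat 1" "A ** Ai = mat 1" "Ai ** A = mat 1"
  using hecke_R_inverse[OF inj_pos(1) nz(1,2)] hecke_R_inverse[OF inj_pos(2) nz(1,2)]
    mixed_R_inverse[of d "1 / u" "1 / z" "\<lambda>i. int (pos i)", OF d_nz _ _ inj_pos(1)] nz
  unfolding G_def Gi_def H_def Hi_def A_def Ai_def
  by (simp_all add: matrix_left_right_inverse)

end

locale braided_legs = hecke_data pos N u z D + leg_space sc
  for pos :: "'n::finite \<Rightarrow> nat" and N u z D and sc :: "complex \<Rightarrow> 'x \<Rightarrow> 'x::ab_group_add"
begin

lemma op_inverse [simp]:
  "op k G (op k Gi x) = x" "op k Gi (op k G x) = x" "op k H (op k Hi x) = x" "op k Hi (op k H x) = x"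
  "op k A (op k Ai x) = x" "op k Ai (op k A x) = x"
  unfolding op_matrix_product inverses op_mat_1 by (rule refl)+

lemma G_braid: "op k G (op (Suc k) G (op k G x)) = op (Suc k) G (op k G (op (Suc k) G x))"
  unfolding G_def by (rule op_hecke_R_braid[OF inj_pos(1)])

lemma Gi_braid: "op k Gi (op (Suc k) Gi (op k Gi x)) = op (Suc k) Gi (op k Gi (op (Suc k) Gi x))"
  unfolding Gi_def by (rule op_hecke_R_braid[OF inj_pos(2)])

lemma Hi_braid: "op k Hi (op (Suc k) Hi (op k Hi x)) = op (Suc k) Hi (op k Hi (op (Suc k) Hi x))"
  unfolding Hi_def by (rule op_hecke_R_braid[OF inj_pos(1)])

lemma con_A_below: "con k d (op (Suc k) A x) = con (Suc k) d (op k Gi x)"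
  unfolding A_def by (rule con_op_mixed_R_below[OF d_nz])

lemma con_A_above: "con (Suc k) d (op k A x) = con k d (op (Suc k) Hi x)"
  unfolding A_def
  by (rule con_op_mixed_R_above[OF d_nz], unfold Gi_def Hi_def, rule hecke_R_transpose)

lemma con_A: "con k (\<lambda>i. 1) (op k A x) = smul (1 / c) (con k d x)"
proof -
  have "con k (\<lambda>i. 1) (op k A x) = con k (\<lambda>i. d i / c) x"
    unfolding A_def Gi_def c_def
    by (rule con_op_of_evaluation) (rule mixed_R_evaluation[OF pos d_def nz(3,2,1)])
  then show ?thesis by (auto simp: contract_def scale_sum_right)
qed

lemma con_Ai: "con k d (op k Ai x) = smul c (con k (\<lambda>i. 1) x)"
  using con_A[of k "op k Ai x"] c_nz by (simp add: fun_eq_iff)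

text \<open>
  The braid relation for \<open>V \<otimes> V \<otimes> V\<^sup>*\<close>. Pairing the dual leg with an attached copy of \<open>V\<close> turns each
  \<open>A\<close> into \<open>Gi\<close> (\<open>con_A_below\<close>) and the claim into the braid relation of \<open>Gi\<close> on \<open>V \<otimes> V \<otimes> V\<close>.
\<close>

lemma A_A_G: "op k A (op (Suc k) A (op k G x)) = op (Suc k) G (op k A (op (Suc k) A x))"
proof -
  have "op (Suc k) Gi (op k A (op (Suc k) A y)) = op k A (op (Suc k) A (op k Gi y))" for y
  proof (rule con_attach_leg_cancel[of k k, OF _ d_nz])
    fix a
    let ?y = "attach_leg k a y"
    let ?k1 = "Suc k" and ?k2 = "Suc (Suc k)"
    have com: "op k Gi (op ?k2 L x) = op ?k2 L (op k Gi x)" for L x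
      by (rule op_commute) simp
    have out: "con k d (op ?k2 Gi x) = op k Gi (con k d x)" for x
      using con_op_after[of k k d Gi x] by simp
    have out1: "con ?k2 d (op k Gi x) = op k Gi (con ?k2 d x)" for x
      by (rule con_op_before) simp
    have "con k d (op ?k2 Gi (op ?k1 A (op ?k2 A ?y))) = op k Gi (con ?k2 d (op ?k1 Gi (op k Gi ?y)))"
      unfolding out con_A_below com by (simp add: con_A_below)
    also have "\<dots> = con ?k2 d (op k Gi (op ?k1 Gi (op k Gi ?y)))"
      by (simp add: out1)
    also have "\<dots> = con ?k2 d (op ?k1 Gi (op k Gi (op ?k1 Gi ?y)))"
      by (simp add: Gi_braid)
    also have "\<dots> = con k d (op ?k1 A (op ?k2 A (op ?k1 Gi ?y)))"
      unfolding con_A_below com by (simp add: con_A_below)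
    finally show "con k d (attach_leg k a (op ?k1 Gi (op k A (op ?k1 A y))))
        = con k d (attach_leg k a (op k A (op ?k1 A (op k Gi y))))"
      by (simp add: op_attach_leg_before[symmetric])
  qed simp
  from this[of "op k G x"] have "op (Suc k) G (op (Suc k) Gi (op k A (op (Suc k) A (op k G x))))
      = op (Suc k) G (op k A (op (Suc k) A x))" by simp
  then show ?thesis by simp
qed

text \<open>
  The braid relation for \<open>V \<otimes> V\<^sup>* \<otimes> V\<^sup>*\<close>, by the same argument: the copy of \<open>V\<close> is paired with an attached
  copy of \<open>V\<^sup>*\<close>, which turns \<open>A\<close> into \<open>Hi\<close>.
\<close>

lemma Hi_A_A: "op (Suc k) A (op k A (op (Suc k) Hi x)) = op k Hi (op (Suc k) A (op k A x))"
proof (rule con_attach_leg_cancel[of "k + 3" "k + 2", OF _ d_nz])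
  fix a
  let ?y = "attach_leg (k + 3) a x"
  let ?k1 = "Suc k" and ?k2 = "Suc (Suc k)"
  have com: "op ?k2 Hi (op k L x) = op k L (op ?k2 Hi x)" for L x
    by (rule op_commute[symmetric]) simp
  have out: "con ?k2 d (op k Hi x) = op k Hi (con ?k2 d x)" for x
    by (rule con_op_before) simp
  have out1: "con k d (op ?k2 Hi x) = op k Hi (con k d x)" for x
    using con_op_after[of k k d Hi x] by simp
  have "con ?k2 d (op k Hi (op ?k1 A (op k A ?y))) = op k Hi (con k d (op ?k1 Hi (op ?k2 Hi ?y)))"
    unfolding out con_A_above com by (simp add: con_A_above)
  also have "\<dots> = con k d (op ?k2 Hi (op ?k1 Hi (op ?k2 Hi ?y)))"
    by (simp add: out1)
  also have "\<dots> = con k d (op ?k1 Hi (op ?k2 Hi (op ?k1 Hi ?y)))"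
    by (simp add: Hi_braid)
  also have "\<dots> = con ?k2 d (op ?k1 A (op k A (op ?k1 Hi ?y)))"
    unfolding con_A_above com by (simp add: con_A_above)
  finally show "con (k + 2) d (attach_leg (k + 3) a (op ?k1 A (op k A (op ?k1 Hi x))))
      = con (k + 2) d (attach_leg (k + 3) a (op k Hi (op ?k1 A (op k A x))))"
    by (simp add: op_attach_leg_after[symmetric])
qed simp

lemma H_A_A: "op (Suc k) A (op k A (op (Suc k) H x)) = op k H (op (Suc k) A (op k A x))"
  using Hi_A_A[of k "op (Suc k) H x"] by simp

lemma H_braid: "op k H (op (Suc k) H (op k H x)) = op (Suc k) H (op k H (op (Suc k) H x))"
  unfolding H_def by (rule op_hecke_R_braid[OF inj_pos(2)])

text \<open>
  With \<open>K = G\<close> this is the map \<open>S\<^sub>1\<^sub>2\<^sub>3\<close> of the calculus, at the legs from \<open>k\<close> on, and \<open>T\<close> below with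
  \<open>K = Hi\<close> is \<open>S~\<^sub>2\<^sub>3\<^sub>4\<close>. Keeping \<open>K\<close> as a parameter covers the inverses as well: \<open>S Gi\<close> and \<open>T H\<close>.
\<close>

definition S :: "complex^('n \<times> 'n)^('n \<times> 'n) \<Rightarrow> nat \<Rightarrow> ((nat \<Rightarrow> 'n) \<Rightarrow> 'x) \<Rightarrow> (nat \<Rightarrow> 'n) \<Rightarrow> 'x" where
  "S K k x = op (Suc k) A (op k K (op (Suc k) Ai x))"

definition T :: "complex^('n \<times> 'n)^('n \<times> 'n) \<Rightarrow> nat \<Rightarrow> ((nat \<Rightarrow> 'n) \<Rightarrow> 'x) \<Rightarrow> (nat \<Rightarrow> 'n) \<Rightarrow> 'x" where
  "T K k x = op k A (op (Suc k) K (op k Ai x))"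

lemma S_inverse [simp]: "S G k (S Gi k x) = x" "S Gi k (S G k x) = x"
  by (simp_all add: S_def)

lemma T_inverse [simp]: "T H k (T Hi k x) = x" "T Hi k (T H k x) = x"
  by (simp_all add: T_def)

lemma S_smul: "S K k (smul b x) = smul b (S K k x)"
  unfolding S_def op_smul ..

lemma T_smul: "T K k (smul b x) = smul b (T K k x)"
  unfolding T_def op_smul ..

lemma S_add: "S K k (\<lambda>\<nu>. x \<nu> + y \<nu>) = (\<lambda>\<nu>. S K k x \<nu> + S K k y \<nu>)"
  unfolding S_def op_add ..

lemma T_add: "T K k (\<lambda>\<nu>. x \<nu> + y \<nu>) = (\<lambda>\<nu>. T K k x \<nu> + T K k y \<nu>)"
  unfolding T_def op_add ..

text \<open>
  The conjugating braidings act on the same two legs \<open>k + 1\<close>, \<open>k + 2\<close> and cancel in both products, which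
  leaves operators at the disjoint pairs \<open>k\<close>, \<open>k + 1\<close> and \<open>k + 2\<close>, \<open>k + 3\<close>.
\<close>

lemma S_T_commute: "S K k (T L (Suc k) x) = T L (Suc k) (S K k x)"
  unfolding S_def T_def by (simp add: op_commute[of k "Suc (Suc k)"])

lemma S_quadratic: "S G k x = (\<lambda>\<nu>. smul (u * u * z * z) (S Gi k x) \<nu> + smul (u * (1 - z * z)) x \<nu>)"
proof -
  have "op k G y = (\<lambda>\<nu>. smul (u * u * z * z) (op k Gi y) \<nu> + smul (u * (1 - z * z)) y \<nu>)" for y
    unfolding G_def Gi_def using op_hecke_R_quadratic[OF inj_pos(1) nz(1,2)] by auto
  then show ?thesis unfolding S_def by (simp add: op_add op_smul)
qed

lemma T_quadratic: "T Hi k x = (\<lambda>\<nu>. smul (1 / (u * u * z * z)) (T H k x) \<nu>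
    + smul (1 / u * (1 - 1 / (z * z))) x \<nu>)"
proof -
  have "op k Hi y = (\<lambda>\<nu>. smul (1 / (u * u * z * z)) (op k H y) \<nu>
      + smul (1 / u * (1 - 1 / (z * z))) y \<nu>)" for k y
    unfolding H_def Hi_def
    using op_hecke_R_quadratic[OF inj_pos(1), of "1 / u" "1 / z"] nz by (auto simp: mult.assoc)
  then show ?thesis unfolding T_def by (simp add: op_add op_smul)
qed

text \<open>
  Moving the middle dual legs out of the way by the three \<open>A\<close> in \<open>U\<close> makes the two copies of \<open>V\<close>
  that each \<open>S\<close> acts on adjacent, so this is conjugate to the braid relation of \<open>G\<close> on
  \<open>V \<otimes> V \<otimes> V\<close>.
\<close>

lemma S_braid: "S G k (S G (k + 2) (S G k x)) = S G (k + 2) (S G k (S G (k + 2) x))"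
proof -
  let ?k1 = "Suc k" and ?k2 = "Suc (Suc k)" and ?k3 = "Suc (Suc (Suc k))"
  define U where "U y = op ?k1 A (op ?k3 A (op ?k2 A y))" for y
  have com: "op k L (op ?k2 K y) = op ?k2 K (op k L y)" "op k L (op ?k3 K y) = op ?k3 K (op k L y)"
    "op ?k1 L (op ?k3 K y) = op ?k3 K (op ?k1 L y)" for K L y
    by (rule op_commute, simp)+
  have SU: "S G k (U y) = U (op k G y)" for y
    unfolding S_def U_def by (simp add: com)
  have "S G ?k2 (U y) = U (op ?k1 G y)" for y
  proof -
    have "S G ?k2 (U y) = op ?k3 A (op ?k2 G (op ?k1 A (op ?k2 A y)))"
      unfolding S_def U_def by (simp add: com)
    also have "\<dots> = U (op ?k1 G y)"
      unfolding U_def com by (simp add: A_A_G)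
    finally show ?thesis .
  qed
  then have "S G k (S G ?k2 (S G k (U y))) = S G ?k2 (S G k (S G ?k2 (U y)))" for y
    by (simp add: SU G_braid)
  moreover have "U (op ?k2 Ai (op ?k3 Ai (op ?k1 Ai x))) = x"
    unfolding U_def by simp
  ultimately show ?thesis by (metis add_2_eq_Suc')
qed

lemma T_braid: "T H k (T H (k + 2) (T H k x)) = T H (k + 2) (T H k (T H (k + 2) x))"
proof -
  let ?k1 = "Suc k" and ?k2 = "Suc (Suc k)" and ?k3 = "Suc (Suc (Suc k))"
  define U where "U y = op k A (op ?k2 A (op ?k1 A y))" for y
  have com: "op k L (op ?k2 K y) = op ?k2 K (op k L y)" "op k L (op ?k3 K y) = op ?k3 K (op k L y)"
    "op ?k1 L (op ?k3 K y) = op ?k3 K (op ?k1 L y)" for K L y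
    by (rule op_commute, simp)+
  have "T H k (U y) = op k A (op ?k1 H (op ?k2 A (op ?k1 A y)))" for y
    unfolding T_def U_def by simp
  then have TU: "T H k (U y) = U (op ?k2 H y)" for y
    unfolding U_def by (simp add: H_A_A)
  have "T H ?k2 (U y) = op ?k2 A (op ?k3 H (op k A (op ?k1 A y)))" for y
    unfolding T_def U_def by (simp add: com)
  then have "T H ?k2 (U y) = U (op ?k3 H y)" for y
    unfolding U_def by (simp add: com)
  then have "T H k (T H ?k2 (T H k (U y))) = T H ?k2 (T H k (T H ?k2 (U y)))" for y
    by (simp add: TU H_braid)
  moreover have "U (op ?k1 Ai (op ?k2 Ai (op k Ai x))) = x"
    unfolding U_def by simp
  ultimately show ?thesis by (metis add_2_eq_Suc')
qed

text \<open>
  After \<open>con_A_below\<close> moves the contraction past \<open>A\<close>, the braidings \<open>G\<close> and \<open>Gi\<close> cancel, and \<open>E'\<close> is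
  left with \<open>Ai\<close> only.
\<close>

lemma con_d_S: "con k d (S G k x) = smul c (con (Suc k) (\<lambda>i. 1) x)"
  unfolding S_def con_A_below by (simp add: con_Ai)

lemma con_1_T: "con k (\<lambda>i. 1) (T Hi k x) = smul (1 / c) (con (Suc k) d x)"
  unfolding T_def con_A by (simp add: con_A_above[symmetric])

lemma con_1_S: "con (Suc k) (\<lambda>i. 1) (S Gi k x) = smul (1 / c) (con k d x)"
  using con_d_S[of k "S Gi k x"] c_nz by (simp add: fun_eq_iff)

lemma con_d_T: "con (Suc k) d (T H k x) = smul c (con k (\<lambda>i. 1) x)"
  using con_1_T[of k "T H k x"] c_nz by (simp add: fun_eq_iff)

lemma con_d_S_T: "con k d (S G k (T Hi (Suc k) x)) = con (k + 2) d x"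
  unfolding con_d_S con_1_T using c_nz by simp

lemma con_S_before: "l + 3 \<le> k \<Longrightarrow> con k e (S K l x) = S K l (con k e x)"
  unfolding S_def by (simp add: con_op_before)

lemma con_S_after: "k \<le> l \<Longrightarrow> con k e (S K (l + 2) x) = S K l (con k e x)"
  unfolding S_def using con_op_after[of k l e] con_op_after[of k "Suc l" e] by simp

lemma con_T_before: "l + 3 \<le> k \<Longrightarrow> con k e (T K l x) = T K l (con k e x)"
  unfolding T_def by (simp add: con_op_before)

lemma con_T_after: "k \<le> l \<Longrightarrow> con k e (T K (l + 2) x) = T K l (con k e x)"
  unfolding T_def using con_op_after[of k l e] con_op_after[of k "Suc l" e] by simp

end

section \<open>The braiding of a chain module with itself\<close>

declare tensor_rep.simps [simp del]

text \<open>
  The eigenvalue of \<open>K\<close> at the node of the step from position \<open>k\<close> to \<open>k + 1\<close> on the vector at position \<open>n\<close>.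
\<close>

definition kx :: "real \<Rightarrow> nat \<Rightarrow> nat \<Rightarrow> complex" where
  "kx q k n = (if n = k then of_real q else if n = Suc k then 1 / of_real q else 1)"

text \<open>
  The vectors at positions \<open>1, \<dots>, r + 1\<close> form a chain: \<open>F\<close> at node \<open>\<tau> k\<close> leads from position \<open>k\<close> to
  \<open>k + 1\<close> and \<open>E\<close> leads back. The factors \<open>e\<close>, \<open>f\<close> remain free, since a weight basis is determined only
  up to scaling. The map \<open>\<tau>\<close> covers both orientations of the Dynkin diagram, \<open>V(\<omega>\<^sub>1)\<close> and \<open>V(\<omega>\<^sub>r)\<close>.
  The condition is on matrix entries, which makes it pass directly to the dual.
\<close>

definition chain_rep ::
  "nat \<Rightarrow> real \<Rightarrow> (nat \<Rightarrow> nat) \<Rightarrow> ('n::finite \<Rightarrow> nat) \<Rightarrow> (uq_gen \<Rightarrow> complex^'n^'n)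
    \<Rightarrow> (nat \<Rightarrow> complex) \<Rightarrow> (nat \<Rightarrow> complex) \<Rightarrow> bool" where
  "chain_rep r q \<tau> pos \<rho> e f \<longleftrightarrow>
    bij_betw pos UNIV {1..r + 1} \<and> bij_betw \<tau> {1..r} {1..r} \<and>
    (\<forall>k\<in>{1..r}. e k \<noteq> 0 \<and> f k \<noteq> 0 \<and>
      (\<forall>j i. \<rho> (Kgen (\<tau> k)) $ j $ i = (if j = i then kx q k (pos i) else 0) \<and>
        \<rho> (Kinv (\<tau> k)) $ j $ i = (if j = i then 1 / kx q k (pos i) else 0) \<and>
        \<rho> (Egen (\<tau> k)) $ j $ i = (if pos i = Suc k \<and> pos j = k then e k else 0) \<and>
        \<rho> (Fgen (\<tau> k)) $ j $ i = (if pos i = k \<and> pos j = Suc k then f k else 0)))"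

lemma kron_mult_tensor_vec: "kron A B *v tensor_vec x y = tensor_vec (A *v x) (B *v y)"
  unfolding kron_def tensor_vec_def matrix_vector_mult_def vec_eq_iff
  by (simp add: sum_UNIV_pair sum_product mult.assoc mult.left_commute)

lemma tensor_vec_0 [simp]: "tensor_vec 0 y = 0" "tensor_vec x 0 = 0"
  by (simp_all add: tensor_vec_def vec_eq_iff)

lemma tensor_vec_scale [simp]: "tensor_vec (a *s x) y = a *s tensor_vec x y" "tensor_vec x (a *s y) = a *s tensor_vec x y"
  by (simp_all add: tensor_vec_def vec_eq_iff)

lemma tensor_vec_axis: "tensor_vec (axis i 1) (axis j 1) = axis (i, j) 1"
  by (auto simp: tensor_vec_def vec_eq_iff axis_def)

lemma mult_axis: "(M *v axis i (1::complex)) $ j = M $ j $ i"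
  unfolding matrix_vector_mult_def axis_def by (simp add: if_distrib cong: if_cong)

lemma matrix_eq_axisI:
  fixes M L :: "complex^'n^'m"
  assumes "\<And>i. M *v axis i 1 = L *v axis i 1"
  shows "M = L"
  using assms by (metis mult_axis vec_eq_iff)

lemma hecke_R_column:
  "hecke_R u s f $ K $ (i, j) =
    (if i = j then if K = (i, j) then u else 0
     else (if K = (j, i) then u * s else 0)
       + (if K = (i, j) then if f j < f i then u * (1 - s * s) else 0 else 0))"
proof -
  consider "K = (i, j)" | "K = (j, i)" "i \<noteq> j" | "K \<noteq> (i, j)" "K \<noteq> (j, i)" by blast
  then show ?thesis
  proof cases
    case 1
    show ?thesis unfolding 1 hecke_R_entry by simp
  next
    case 2
    show ?thesis unfolding 2(1) hecke_R_entry using 2(2) by simp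
  next
    case 3
    obtain k l where K: "K = (k, l)" by (cases K)
    have "hecke_R u s f $ K $ (i, j) = 0"
      using 3 unfolding K hecke_R_entry by (simp only: prod.inject split: if_split) blast
    then show ?thesis using 3 by auto
  qed
qed

lemma chain_rep_action:
  assumes "chain_rep r q \<tau> pos \<rho> e f" "k \<in> {1..r}"
  defines "b \<equiv> \<lambda>n. axis (inv pos n) (1::complex)"
  assumes n: "n \<in> {1..r + 1}"
  shows "\<rho> (Kgen (\<tau> k)) *v b n = kx q k n *s b n"
    "\<rho> (Kinv (\<tau> k)) *v b n = (1 / kx q k n) *s b n"
    "\<rho> (Egen (\<tau> k)) *v b n = (if n = Suc k then e k *s b k else 0)"
    "\<rho> (Fgen (\<tau> k)) *v b n = (if n = k then f k *s b (Suc k) else 0)"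
proof -
  have bij: "bij_betw pos UNIV {1..r + 1}" using assms(1) by (simp add: chain_rep_def)
  have inv: "pos (inv pos n) = n" if "n \<in> {1..r + 1}" for n
    using bij that by (metis bij_betw_def f_inv_into_f)
  have inv': "pos j = n \<longleftrightarrow> j = inv pos n" if "n \<in> {1..r + 1}" for n j
    using bij that inv[OF that] by (metis bij_betw_def inv_f_f)
  have k: "k \<in> {1..r + 1}" "Suc k \<in> {1..r + 1}" using assms(2) by auto
  show "\<rho> (Kgen (\<tau> k)) *v b n = kx q k n *s b n"
    "\<rho> (Kinv (\<tau> k)) *v b n = (1 / kx q k n) *s b n"
    "\<rho> (Egen (\<tau> k)) *v b n = (if n = Suc k then e k *s b k else 0)"
    "\<rho> (Fgen (\<tau> k)) *v b n = (if n = k then f k *s b (Suc k) else 0)"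
    using assms(1,2) inv[OF n] inv'[OF k(1)] inv'[OF k(2)]
    unfolding chain_rep_def b_def vec_eq_iff mult_axis by (simp_all add: axis_def)
qed

text \<open>
  The intertwining property determines \<open>R\<close> from its value on the first vector tensored with the last:
  applying \<open>E\<close> moves the second factor down to every position, and applying \<open>F\<close> then moves the first
  factor up.
\<close>

lemma chain_braiding_same:
  fixes \<rho> :: "uq_gen \<Rightarrow> complex^'n^'n"
  assumes ch: "chain_rep r q \<tau> pos \<rho> e f" and q: "0 < q" and r: "1 \<le> r"
    and R: "\<And>g. g \<in> uq_gens r \<Longrightarrow> R ** tensor_rep \<rho> \<rho> g = tensor_rep \<rho> \<rho> g ** R"
    and top: "R *v axis (inv pos 1, inv pos (r + 1)) 1 = x *s axis (inv pos (r + 1), inv pos 1) 1"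
  shows "R = hecke_R (x * of_real q) (1 / of_real q) (\<lambda>i. int (pos i))"
proof -
  define v where "v m n = axis (inv pos m, inv pos n) (1::complex)" for m n
  let ?q = "of_real q :: complex"
  have q0: "?q \<noteq> 0" using q by simp
  have tau: "\<tau> k \<in> {1..r}" if "k \<in> {1..r}" for k
    using ch that unfolding chain_rep_def bij_betw_def by auto
  have ef: "e k \<noteq> 0" "f k \<noteq> 0" if "k \<in> {1..r}" for k
    using ch that unfolding chain_rep_def by auto
  have E: "tensor_rep \<rho> \<rho> (Egen (\<tau> k)) *v v m n
      = (if m = Suc k then (e k * kx q k n) *s v k n else 0) + (if n = Suc k then e k *s v m k else 0)"
    if "k \<in> {1..r}" "m \<in> {1..r + 1}" "n \<in> {1..r + 1}" for k m n
    unfolding v_def tensor_vec_axis[symmetric]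
    by (simp add: tensor_rep.simps matrix_vector_mult_add_rdistrib kron_mult_tensor_vec
        chain_rep_action[OF ch that(1,2)] chain_rep_action[OF ch that(1,3)] vector_smult_assoc mult.commute)
  have F: "tensor_rep \<rho> \<rho> (Fgen (\<tau> k)) *v v m n
      = (if m = k then f k *s v (Suc k) n else 0) + (if n = k then (f k / kx q k m) *s v m (Suc k) else 0)"
    if "k \<in> {1..r}" "m \<in> {1..r + 1}" "n \<in> {1..r + 1}" for k m n
    unfolding v_def tensor_vec_axis[symmetric]
    by (simp add: tensor_rep.simps matrix_vector_mult_add_rdistrib kron_mult_tensor_vec
        chain_rep_action[OF ch that(1,2)] chain_rep_action[OF ch that(1,3)] vector_smult_assoc mult.commute)
  have RE: "R *v (tensor_rep \<rho> \<rho> (Egen (\<tau> k)) *v y) = tensor_rep \<rho> \<rho> (Egen (\<tau> k)) *v (R *v y)"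
    "R *v (tensor_rep \<rho> \<rho> (Fgen (\<tau> k)) *v y) = tensor_rep \<rho> \<rho> (Fgen (\<tau> k)) *v (R *v y)"
    if "k \<in> {1..r}" for k y
    using R[of "Egen (\<tau> k)"] R[of "Fgen (\<tau> k)"] tau[OF that]
    by (simp_all add: matrix_vector_mul_assoc uq_gens_def)
  have scale: "M *v (a *s y) = a *s (M *v y)" for M :: "complex^('n \<times> 'n)^('n \<times> 'n)" and a y
    by (rule vector_scalar_commute)
  have cancel: "y = a' *s y'" if "a *s y = (a * a') *s y'" "a \<noteq> 0" for a a' :: complex and y y' :: "complex^('n \<times> 'n)"
    using that by (simp add: vec_eq_iff)
  \<comment> \<open>the first factor stays on top, while \<open>E\<close> moves the second one from the last position down\<close>
  have base: "R *v v 1 n = (if n = 1 then (x * ?q) *s v 1 1 else x *s v n 1)" if "n \<in> {1..r + 1}" for n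
    using that
  proof (induction "r + 1 - n" arbitrary: n)
    case 0
    then have "n = r + 1" by auto
    then show ?case using top r by (simp add: v_def)
  next
    case (Suc l)
    then have n: "n \<in> {1..r}" "Suc n \<in> {1..r + 1}" "n \<in> {1..r + 1}" "1 \<in> {1..r + 1}" by auto
    have IH: "R *v v 1 (Suc n) = x *s v (Suc n) 1" using Suc(1)[of "Suc n"] Suc(2,3) n by auto
    have "e n *s (R *v v 1 n) = R *v (tensor_rep \<rho> \<rho> (Egen (\<tau> n)) *v v 1 (Suc n))"
      unfolding E[OF n(1) n(4) n(2)] using n(1) by (simp add: scale)
    also have "\<dots> = x *s (tensor_rep \<rho> \<rho> (Egen (\<tau> n)) *v v (Suc n) 1)"
      unfolding RE(1)[OF n(1)] IH scale ..
    also have "\<dots> = (e n * (x * kx q n 1)) *s v n 1"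
      unfolding E[OF n(1) n(2) n(4)] using n(1) by (simp add: vec_eq_iff)
    finally have "R *v v 1 n = (x * kx q n 1) *s v n 1" by (rule cancel) (rule ef(1)[OF n(1)])
    then show ?case using n by (auto simp: kx_def)
  qed
  \<comment> \<open>\<open>F\<close> moves the first factor from \<open>k\<close> to \<open>k + 1\<close>; for \<open>n = k\<close> it moves the second one as well,
    which is where the column of \<open>v k (k + 1)\<close> enters\<close>
  have main: "R *v v m n = (if m < n then x *s v n m else if m = n then (x * ?q) *s v m m
      else x *s v n m + (x * (?q - 1 / ?q)) *s v m n)"
    if "m \<in> {1..r + 1}" "n \<in> {1..r + 1}" for m n
    using that
  proof (induction m arbitrary: n)
    case 0 then show ?case by simp
  next
    case (Suc k)
    show ?case
    proof (cases "k = 0")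
      case True
      then show ?thesis using base[OF Suc(3)] Suc(3) by auto
    next
      case False
      then have k: "k \<in> {1..r}" "k \<in> {1..r + 1}" "Suc k \<in> {1..r + 1}" using Suc(2) by auto
      have IH: "R *v v k n = (if k < n then x *s v n k else if k = n then (x * ?q) *s v k k
        else x *s v n k + (x * (?q - 1 / ?q)) *s v k n)" if "n \<in> {1..r + 1}" for n
        using Suc(1)[OF k(2) that] .
      have "f k *s (R *v v (Suc k) n) + (if n = k then (f k / ?q) *s (R *v v k (Suc k)) else 0)
          = R *v (tensor_rep \<rho> \<rho> (Fgen (\<tau> k)) *v v k n)"
        using k Suc(3) by (simp add: F scale matrix_vector_right_distrib kx_def)
      also have "\<dots> = tensor_rep \<rho> \<rho> (Fgen (\<tau> k)) *v (R *v v k n)" by (rule RE(2)[OF k(1)])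
      finally have eq: "f k *s (R *v v (Suc k) n) = tensor_rep \<rho> \<rho> (Fgen (\<tau> k)) *v (R *v v k n)
          - (if n = k then (f k / ?q) *s (R *v v k (Suc k)) else 0)"
        by (simp add: eq_diff_eq)
      have "f k *s (R *v v (Suc k) n) = f k *s (if Suc k < n then x *s v n (Suc k)
          else if Suc k = n then (x * ?q) *s v (Suc k) (Suc k)
          else x *s v n (Suc k) + (x * (?q - 1 / ?q)) *s v (Suc k) n)"
        unfolding eq IH[OF Suc(3)] using k Suc(3) q0
        by (auto simp: F scale matrix_vector_right_distrib kx_def IH vec_eq_iff field_simps)
      then show ?thesis using ef[OF k(1)] by simp
    qed
  qed
  have bij: "bij_betw pos UNIV {1..r + 1}" using ch by (simp add: chain_rep_def)
  have "R *v axis (i, j) 1 = hecke_R (x * ?q) (1 / ?q) (\<lambda>i. int (pos i)) *v axis (i, j) 1" for i j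
  proof -
    have p: "pos i \<in> {1..r + 1}" "pos j \<in> {1..r + 1}" using bij by (auto simp: bij_betw_def)
    have inv: "inv pos (pos i) = i" for i using bij by (simp add: bij_betw_def)
    have inj: "pos i = pos j \<longleftrightarrow> i = j" for i j using bij by (auto simp: bij_betw_def inj_on_def)
    have x: "x * (?q - 1 / ?q) = x * ?q * (1 - 1 / ?q * (1 / ?q))" "x * ?q * (1 / ?q) = x"
      using q0 by (simp_all add: field_simps)
    have "(R *v axis (i, j) 1) $ K = hecke_R (x * ?q) (1 / ?q) (\<lambda>i. int (pos i)) $ K $ (i, j)" for K
      unfolding hecke_R_column x(2) x(1)[symmetric] using main[OF p] inj[of i j]
      unfolding v_def inv by (cases "pos i" "pos j" rule: linorder_cases) (simp_all add: axis_def)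
    then show ?thesis unfolding vec_eq_iff mult_axis by blast
  qed
  then show ?thesis by (intro matrix_eq_axisI) auto
qed

section \<open>The braiding of a chain module with its dual\<close>
text \<open>
  Transposition reverses the arrows, so the dual is a chain in the opposite order. The antipode
  contributes the signs and the powers of \<open>q\<close> in the new factors.
\<close>

lemma chain_rep_dual:
  assumes ch: "chain_rep r q \<tau> pos \<rho> e f" and q: "0 < q"
  shows "chain_rep r q (\<lambda>k. \<tau> (r + 1 - k)) (\<lambda>i. r + 2 - pos i) (dual_rep \<rho>)
    (\<lambda>k. - of_real q * e (r + 1 - k)) (\<lambda>k. - (f (r + 1 - k) / of_real q))"
proof -
  have bij: "bij_betw pos UNIV {1..r + 1}" and tau: "bij_betw \<tau> {1..r} {1..r}"
    using ch by (simp_all add: chain_rep_def)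
  have p: "pos i \<in> {1..r + 1}" for i using bij by (auto simp: bij_betw_def)
  have "bij_betw (\<lambda>n. r + 2 - n) {1..r + 1} {1..r + 1}"
    by (rule bij_betw_byWitness[where f' = "\<lambda>n. r + 2 - n"]) auto
  then have bij': "bij_betw (\<lambda>i. r + 2 - pos i) UNIV {1..r + 1}"
    using bij_betw_trans[OF bij, of "\<lambda>n. r + 2 - n"] by (simp add: comp_def)
  have "bij_betw (\<lambda>k. r + 1 - k) {1..r} {1..r}"
    by (rule bij_betw_byWitness[where f' = "\<lambda>n. r + 1 - n"]) auto
  then have tau': "bij_betw (\<lambda>k. \<tau> (r + 1 - k)) {1..r} {1..r}"
    using bij_betw_trans[OF _ tau, of "\<lambda>k. r + 1 - k"] by (simp add: comp_def)
  have q0: "(of_real q :: complex) \<noteq> 0" using q by simp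
  have entries: "dual_rep \<rho> (Kgen (\<tau> k)) $ j $ i = (if j = i then 1 / kx q k (pos i) else 0)"
    "dual_rep \<rho> (Kinv (\<tau> k)) $ j $ i = (if j = i then kx q k (pos i) else 0)"
    "dual_rep \<rho> (Egen (\<tau> k)) $ j $ i = (if pos i = k \<and> pos j = Suc k then - of_real q * e k else 0)"
    "dual_rep \<rho> (Fgen (\<tau> k)) $ j $ i = (if pos i = Suc k \<and> pos j = k then - (f k / of_real q) else 0)"
    if "k \<in> {1..r}" for k i j
  proof -
    have *: "\<rho> (Kgen (\<tau> k)) $ j $ i = (if j = i then kx q k (pos i) else 0)"
        "\<rho> (Kinv (\<tau> k)) $ j $ i = (if j = i then 1 / kx q k (pos i) else 0)"
        "\<rho> (Egen (\<tau> k)) $ j $ i = (if pos i = Suc k \<and> pos j = k then e k else 0)"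
        "\<rho> (Fgen (\<tau> k)) $ j $ i = (if pos i = k \<and> pos j = Suc k then f k else 0)" for i j
      using ch that unfolding chain_rep_def by blast+
    show "dual_rep \<rho> (Kgen (\<tau> k)) $ j $ i = (if j = i then 1 / kx q k (pos i) else 0)"
      "dual_rep \<rho> (Kinv (\<tau> k)) $ j $ i = (if j = i then kx q k (pos i) else 0)"
      by (auto simp: transpose_def *)
    have "(\<rho> (Egen (\<tau> k)) ** \<rho> (Kinv (\<tau> k))) $ i $ j = \<rho> (Egen (\<tau> k)) $ i $ j * (1 / kx q k (pos j))"
      unfolding matrix_matrix_mult_def by (simp add: *(2) if_distrib cong: if_cong)
    then show "dual_rep \<rho> (Egen (\<tau> k)) $ j $ i = (if pos i = k \<and> pos j = Suc k then - of_real q * e k else 0)"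
      by (auto simp: transpose_def * kx_def)
    have "(\<rho> (Kgen (\<tau> k)) ** \<rho> (Fgen (\<tau> k))) $ i $ j = kx q k (pos i) * \<rho> (Fgen (\<tau> k)) $ i $ j"
      unfolding matrix_matrix_mult_def by (simp add: *(1) if_distrib [of "\<lambda>x. x * _"] cong: if_cong)
    then show "dual_rep \<rho> (Fgen (\<tau> k)) $ j $ i = (if pos i = Suc k \<and> pos j = k then - (f k / of_real q) else 0)"
      by (auto simp: transpose_def * kx_def)
  qed
  have pk: "r + 2 - pos i = k \<longleftrightarrow> pos i = Suc (r + 1 - k)" "r + 2 - pos i = Suc k \<longleftrightarrow> pos i = r + 1 - k"
    if "k \<in> {1..r}" for i k using p[of i] that by auto
  have kx: "kx q k (r + 2 - pos i) = 1 / kx q (r + 1 - k) (pos i)" if "k \<in> {1..r}" for i k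
    unfolding kx_def pk[OF that] using q0 by auto
  have ef: "e k \<noteq> 0" "f k \<noteq> 0" if "k \<in> {1..r}" for k
    using ch that unfolding chain_rep_def by auto
  show ?thesis
    unfolding chain_rep_def
  proof (intro conjI ballI allI bij' tau')
    fix k i j assume k: "k \<in> {1..r}"
    then have k': "r + 1 - k \<in> {1..r}" by auto
    show "- of_real q * e (r + 1 - k) \<noteq> 0" "- (f (r + 1 - k) / of_real q) \<noteq> 0"
      using ef[OF k'] q0 by simp_all
    show "dual_rep \<rho> (Kgen (\<tau> (r + 1 - k))) $ j $ i = (if j = i then kx q k (r + 2 - pos i) else 0)"
      "dual_rep \<rho> (Kinv (\<tau> (r + 1 - k))) $ j $ i = (if j = i then 1 / kx q k (r + 2 - pos i) else 0)"
      "dual_rep \<rho> (Egen (\<tau> (r + 1 - k))) $ j $ i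
        = (if r + 2 - pos i = Suc k \<and> r + 2 - pos j = k then - of_real q * e (r + 1 - k) else 0)"
      "dual_rep \<rho> (Fgen (\<tau> (r + 1 - k))) $ j $ i
        = (if r + 2 - pos i = k \<and> r + 2 - pos j = Suc k then - (f (r + 1 - k) / of_real q) else 0)"
      unfolding entries[OF k'] kx[OF k] pk[OF k] by simp_all
  qed
qed

lemma chain_dual_action:
  assumes ch: "chain_rep r q \<tau> pos \<rho> e f" and k: "k \<in> {1..r}" and q: "0 < q"
  defines "b \<equiv> \<lambda>n. axis (inv pos n) (1::complex)"
  assumes n: "n \<in> {1..r + 1}"
  shows "dual_rep \<rho> (Kgen (\<tau> k)) *v b n = (1 / kx q k n) *s b n"
    "dual_rep \<rho> (Kinv (\<tau> k)) *v b n = kx q k n *s b n"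
    "dual_rep \<rho> (Egen (\<tau> k)) *v b n = (if n = k then (- of_real q * e k) *s b (Suc k) else 0)"
    "dual_rep \<rho> (Fgen (\<tau> k)) *v b n = (if n = Suc k then (- (f k / of_real q)) *s b k else 0)"
proof -
  let ?k = "r + 1 - k" and ?n = "r + 2 - n" and ?p = "\<lambda>i. r + 2 - pos i"
  have bij: "bij_betw pos UNIV {1..r + 1}" using ch by (simp add: chain_rep_def)
  have inv: "inv ?p m = inv pos (r + 2 - m)" if "m \<in> {1..r + 1}" for m
  proof (rule inv_f_eq)
    show "inj ?p" using chain_rep_dual[OF ch q] by (simp add: chain_rep_def bij_betw_def)
    have "pos (inv pos (r + 2 - m)) = r + 2 - m"
      using bij that by (intro f_inv_into_f) (auto simp: bij_betw_def)
    then show "r + 2 - pos (inv pos (r + 2 - m)) = m" using that by auto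
  qed
  have k': "?k \<in> {1..r}" "r + 1 - ?k = k" and n': "?n \<in> {1..r + 1}" "r + 2 - ?n = n" using k n by auto
  have kx: "kx q ?k ?n = 1 / kx q k n" using q k n by (auto simp: kx_def)
  have b: "axis (inv ?p m) 1 = b (r + 2 - m)" if "m \<in> {1..r + 1}" for m unfolding b_def inv[OF that] ..
  have s: "r + 2 - ?k = Suc k" "r + 2 - Suc ?k = k" "?n = Suc ?k \<longleftrightarrow> n = k" "?n = ?k \<longleftrightarrow> n = Suc k"
    "?k \<in> {1..r + 1}" "Suc ?k \<in> {1..r + 1}"
    using k n by auto
  note act = chain_rep_action[OF chain_rep_dual[OF ch q] k'(1) n'(1)]
  show "dual_rep \<rho> (Kgen (\<tau> k)) *v b n = (1 / kx q k n) *s b n"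
    "dual_rep \<rho> (Kinv (\<tau> k)) *v b n = kx q k n *s b n"
    "dual_rep \<rho> (Egen (\<tau> k)) *v b n = (if n = k then (- of_real q * e k) *s b (Suc k) else 0)"
    "dual_rep \<rho> (Fgen (\<tau> k)) *v b n = (if n = Suc k then (- (f k / of_real q)) *s b k else 0)"
    using act unfolding b[OF n'(1)] b[OF s(5)] b[OF s(6)] k'(2) n'(2) kx s(1-4)
    by (simp_all del: dual_rep.simps)
qed

lemma tensor_vec_minus [simp]: "tensor_vec (- x) y = - tensor_vec x y" "tensor_vec x (- y) = - tensor_vec x y"
  by (simp_all add: tensor_vec_def vec_eq_iff)

lemma matrix_vector_mult_sum:
  "(M :: complex^'n^'m) *v (\<Sum>l\<in>L. x l) = (\<Sum>l\<in>L. M *v x l)"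
  by (induction L rule: infinite_finite_induct) (simp_all add: matrix_vector_right_distrib)

text \<open>
  As for two equal modules, the columns follow from one value by applying \<open>E\<close> and \<open>F\<close>. Position \<open>n\<close>
  of the dual basis is the one dual to position \<open>n\<close>, so the given column is the highest weight vector
  tensored with its dual vector, which is a lowest one. The column of \<open>v\<^sub>m \<otimes> f\<^sup>m\<close> involves all
  \<open>f\<^sup>l \<otimes> v\<^sub>l\<close> with \<open>l \<le> m\<close>. It is \<open>Dv m\<close> below, and
  \<open>Dv_Suc\<close> is the recursion that the action of \<open>F\<close> requires.
\<close>

lemma chain_braiding_mixed:
  fixes \<rho> :: "uq_gen \<Rightarrow> complex^'n^'n"
  assumes ch: "chain_rep r q \<tau> pos \<rho> e f" and q: "0 < q" and r: "1 \<le> r"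
    and R: "\<And>g. g \<in> uq_gens r \<Longrightarrow> R ** tensor_rep \<rho> (dual_rep \<rho>) g = tensor_rep (dual_rep \<rho>) \<rho> g ** R"
    and top: "R *v axis (inv pos 1, inv pos 1) 1 = y *s axis (inv pos 1, inv pos 1) 1"
    and d: "\<And>i. d i = D * (1 / of_real q) ^ (2 * pos i)" "D \<noteq> 0"
  shows "R = mixed_R d (hecke_R y (of_real q) (\<lambda>i. - int (pos i)))"
proof -
  define v where "v m n = axis (inv pos m, inv pos n) (1::complex)" for m n
  let ?q = "of_real q :: complex"
  have q0: "?q \<noteq> 0" using q by simp
  have tau: "\<tau> k \<in> {1..r}" if "k \<in> {1..r}" for k
    using ch that unfolding chain_rep_def bij_betw_def by auto
  have ef: "e k \<noteq> 0" "f k \<noteq> 0" if "k \<in> {1..r}" for k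
    using ch that unfolding chain_rep_def by auto
  note act = chain_rep_action[OF ch] and dact = chain_dual_action[OF ch _ q]
  have E: "tensor_rep \<rho> (dual_rep \<rho>) (Egen (\<tau> k)) *v v m n
      = (if m = Suc k then (e k / kx q k n) *s v k n else 0) + (if n = k then (- ?q * e k) *s v m (Suc k) else 0)"
    if "k \<in> {1..r}" "m \<in> {1..r + 1}" "n \<in> {1..r + 1}" for k m n
    unfolding v_def tensor_vec_axis[symmetric]
    by (simp add: tensor_rep.simps matrix_vector_mult_add_rdistrib kron_mult_tensor_vec
        act[OF that(1,2)] dact[OF that(1,3)] vector_smult_assoc mult.commute del: dual_rep.simps)
  have F: "tensor_rep \<rho> (dual_rep \<rho>) (Fgen (\<tau> k)) *v v m n
      = (if m = k then f k *s v (Suc k) n else 0)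
        + (if n = Suc k then (- (f k / ?q / kx q k m)) *s v m k else 0)"
    if "k \<in> {1..r}" "m \<in> {1..r + 1}" "n \<in> {1..r + 1}" for k m n
    unfolding v_def tensor_vec_axis[symmetric]
    by (simp add: tensor_rep.simps matrix_vector_mult_add_rdistrib kron_mult_tensor_vec
        act[OF that(1,2)] dact[OF that(1,3)] vector_smult_assoc mult.commute del: dual_rep.simps)
  have E': "tensor_rep (dual_rep \<rho>) \<rho> (Egen (\<tau> k)) *v v n m
      = (if n = k then (- ?q * e k * kx q k m) *s v (Suc k) m else 0) + (if m = Suc k then e k *s v n k else 0)"
    if "k \<in> {1..r}" "m \<in> {1..r + 1}" "n \<in> {1..r + 1}" for k m n
    unfolding v_def tensor_vec_axis[symmetric]
    by (simp add: tensor_rep.simps matrix_vector_mult_add_rdistrib kron_mult_tensor_vec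
        act[OF that(1,2)] dact[OF that(1,3)] vector_smult_assoc mult.commute del: dual_rep.simps)
  have F': "tensor_rep (dual_rep \<rho>) \<rho> (Fgen (\<tau> k)) *v v n m
      = (if n = Suc k then (- (f k / ?q)) *s v k m else 0) + (if m = k then (kx q k n * f k) *s v n (Suc k) else 0)"
    if "k \<in> {1..r}" "m \<in> {1..r + 1}" "n \<in> {1..r + 1}" for k m n
    unfolding v_def tensor_vec_axis[symmetric]
    by (simp add: tensor_rep.simps matrix_vector_mult_add_rdistrib kron_mult_tensor_vec
        act[OF that(1,2)] dact[OF that(1,3)] vector_smult_assoc mult.commute del: dual_rep.simps)
  have RE: "R *v (tensor_rep \<rho> (dual_rep \<rho>) (Egen (\<tau> k)) *v x) = tensor_rep (dual_rep \<rho>) \<rho> (Egen (\<tau> k)) *v (R *v x)"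
    "R *v (tensor_rep \<rho> (dual_rep \<rho>) (Fgen (\<tau> k)) *v x) = tensor_rep (dual_rep \<rho>) \<rho> (Fgen (\<tau> k)) *v (R *v x)"
    if "k \<in> {1..r}" for k x
    using R[of "Egen (\<tau> k)"] R[of "Fgen (\<tau> k)"] tau[OF that]
    by (simp_all add: matrix_vector_mul_assoc uq_gens_def)
  have scale: "M *v (a *s x) = a *s (M *v x)" "M *v (- x) = - (M *v x)"
    for M :: "complex^('n \<times> 'n)^('n \<times> 'n)" and a x
    by (rule vector_scalar_commute) (simp add: matrix_vector_mult_def vec_eq_iff sum_negf)
  have cancel: "x = a' *s x'" if "a *s x = (a * a') *s x'" "a \<noteq> 0" for a a' :: complex and x x' :: "complex^('n \<times> 'n)"
    using that by (simp add: vec_eq_iff)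
  \<comment> \<open>on the dual, \<open>E\<close> moves from position \<open>n\<close> to \<open>n + 1\<close>\<close>
  have base: "R *v v 1 (Suc n) = (if n = 0 then y *s v 1 1 else (y * ?q) *s v (Suc n) 1)" if "Suc n \<in> {1..r + 1}" for n
    using that
  proof (induction n)
    case 0
    then show ?case using top by (simp add: v_def)
  next
    case (Suc k)
    then have n: "Suc k \<in> {1..r}" "Suc k \<in> {1..r + 1}" "1 \<in> {1..r + 1}" by auto
    let ?k = "Suc k"
    have IH: "R *v v 1 ?k = (if k = 0 then y else y * ?q) *s v ?k 1"
      using Suc(1)[OF n(2)] by simp
    have "(- ?q * e ?k) *s (R *v v 1 (Suc ?k)) = R *v (tensor_rep \<rho> (dual_rep \<rho>) (Egen (\<tau> ?k)) *v v 1 ?k)"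
      unfolding E[OF n(1) n(3) n(2)] by (simp add: scale)
    also have "\<dots> = (if k = 0 then y else y * ?q) *s (tensor_rep (dual_rep \<rho>) \<rho> (Egen (\<tau> ?k)) *v v ?k 1)"
      unfolding RE(1)[OF n(1)] IH scale ..
    also have "\<dots> = ((- ?q * e ?k) * (y * ?q)) *s v (Suc ?k) 1"
      unfolding E'[OF n(1) n(3) n(2)] by (simp add: vec_eq_iff kx_def)
    finally have "R *v v 1 (Suc ?k) = (y * ?q) *s v (Suc ?k) 1"
      by (rule cancel) (use ef(1)[OF n(1)] q0 in simp)
    then show ?case by simp
  qed
  \<comment> \<open>the coefficient of \<open>f\<^sup>l \<otimes> v\<^sub>l\<close> in the image of \<open>v\<^sub>m \<otimes> f\<^sup>m\<close>\<close>
  define c where "c l m = (if l = m then y else y * (1 - ?q * ?q) * (1 / ?q) ^ (2 * (m - l)))" for l m :: nat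
  define Dv where "Dv m = (\<Sum>l\<in>{1..m}. c l m *s v l l)" for m
  have Dv_Suc: "Dv (Suc k) = y *s v (Suc k) (Suc k) - y *s v k k + (1 / (?q * ?q)) *s Dv k" if "k \<ge> 1" for k
  proof -
    from that obtain k' where k': "k = Suc k'" by (cases k) auto
    define X where "X = (\<Sum>l\<in>{1..k'}. c l k *s v l l)"
    have X: "(\<Sum>l\<in>{1..k'}. c l (Suc k) *s v l l) = (1 / (?q * ?q)) *s X"
      unfolding X_def vec.scale_sum_right vector_smult_assoc
      by (intro sum.cong refl) (auto simp: c_def k' Suc_diff_le power2_eq_square)
    have c: "c k (Suc k) = - y + 1 / (?q * ?q) * y" "c (Suc k) (Suc k) = y" "c k k = y"
      using q0 by (simp_all add: c_def field_simps power2_eq_square)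
    have "Dv (Suc k) = (1 / (?q * ?q)) *s X + c k (Suc k) *s v k k + c (Suc k) (Suc k) *s v (Suc k) (Suc k)"
      unfolding Dv_def X[symmetric] by (simp add: k')
    moreover have "Dv k = X + c k k *s v k k"
      unfolding Dv_def X_def by (simp add: k')
    ultimately show ?thesis
      unfolding c by (simp add: vec_eq_iff algebra_simps add_divide_distrib)
  qed
  have main: "R *v v m n = (if m = n then Dv m else (y * ?q) *s v n m)"
    if "m \<in> {1..r + 1}" "n \<in> {1..r + 1}" for m n
    using that
  proof (induction m arbitrary: n)
    case 0 then show ?case by simp
  next
    case (Suc k)
    show ?case
    proof (cases "k = 0")
      case True
      from Suc(3) obtain n' where n': "n = Suc n'" by (cases n) auto
      show ?thesis using base[of n'] Suc(3) True unfolding n' by (simp add: Dv_def c_def)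
    next
      case False
      then have k: "k \<in> {1..r}" "k \<in> {1..r + 1}" "Suc k \<in> {1..r + 1}" "k \<ge> 1" using Suc(2) by auto
      note IH = Suc(1)[OF k(2)]
      have "f k *s (R *v v (Suc k) n) + (if n = Suc k then (- (f k / (?q * ?q))) *s (R *v v k k) else 0)
          = R *v (tensor_rep \<rho> (dual_rep \<rho>) (Fgen (\<tau> k)) *v v k n)"
        unfolding F[OF k(1,2) Suc(3)] by (simp add: scale matrix_vector_right_distrib kx_def)
      also have "\<dots> = tensor_rep (dual_rep \<rho>) \<rho> (Fgen (\<tau> k)) *v (R *v v k n)" by (rule RE(2)[OF k(1)])
      finally have eq: "f k *s (R *v v (Suc k) n) = tensor_rep (dual_rep \<rho>) \<rho> (Fgen (\<tau> k)) *v (R *v v k n)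
          + (if n = Suc k then (f k / (?q * ?q)) *s Dv k else 0)"
        using IH[OF k(2)] by (simp add: vec_eq_iff algebra_simps split: if_splits)
      have FD: "tensor_rep (dual_rep \<rho>) \<rho> (Fgen (\<tau> k)) *v Dv k = (y * ?q * f k) *s v k (Suc k)"
      proof -
        have "tensor_rep (dual_rep \<rho>) \<rho> (Fgen (\<tau> k)) *v Dv k
            = (\<Sum>l\<in>{1..k}. c l k *s (tensor_rep (dual_rep \<rho>) \<rho> (Fgen (\<tau> k)) *v v l l))"
          unfolding Dv_def matrix_vector_mult_sum scale ..
        also have "\<dots> = (\<Sum>l\<in>{1..k}. if l = k then (y * ?q * f k) *s v k (Suc k) else 0)"
        proof (intro sum.cong refl)
          fix l assume l: "l \<in> {1..k}"
          then have l': "l \<in> {1..r + 1}" using k by auto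
          show "c l k *s (tensor_rep (dual_rep \<rho>) \<rho> (Fgen (\<tau> k)) *v v l l)
              = (if l = k then (y * ?q * f k) *s v k (Suc k) else 0)"
            unfolding F'[OF k(1) l' l'] using l by (auto simp: c_def kx_def vec_eq_iff)
        qed
        finally show ?thesis using k by simp
      qed
      consider "n = k" | "n = Suc k" | "n \<noteq> k" "n \<noteq> Suc k" by blast
      then have "f k *s (R *v v (Suc k) n) = f k *s (if Suc k = n then Dv (Suc k) else (y * ?q) *s v n (Suc k))"
      proof cases
        case 1
        then have R: "R *v v k n = Dv k" using IH[OF Suc(3)] by simp
        show ?thesis unfolding eq R FD using 1 by (simp add: vec_eq_iff mult_ac)
      next
        case 2
        then have "R *v v k n = (y * ?q) *s v (Suc k) k" using IH[OF Suc(3)] by simp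
        then show ?thesis unfolding eq using 2 q0
          by (simp add: scale F'[OF k(1,2,3)] Dv_Suc[OF k(4)]) (simp add: vec_eq_iff kx_def field_simps)
      next
        case 3
        then have "R *v v k n = (y * ?q) *s v n k" using IH[OF Suc(3)] by simp
        then show ?thesis unfolding eq using 3
          by (simp add: scale F'[OF k(1,2) Suc(3)]) (simp add: vec_eq_iff kx_def)
      qed
      then show ?thesis using ef[OF k(1)] by simp
    qed
  qed
  have bij: "bij_betw pos UNIV {1..r + 1}" using ch by (simp add: chain_rep_def)
  have inv: "inv pos (pos i) = i" for i using bij by (simp add: bij_betw_def)
  have inj: "pos i = pos j \<longleftrightarrow> i = j" for i j using bij by (auto simp: bij_betw_def inj_on_def)
  have p: "pos i \<in> {1..r + 1}" for i using bij by (auto simp: bij_betw_def)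
  have d0: "d i \<noteq> 0" for i using q0 by (simp add: d)
  let ?M = "mixed_R d (hecke_R y ?q (\<lambda>i. - int (pos i)))"
  have "R $ (a, l) $ (i, j) = ?M $ (a, l) $ (i, j)" for a l i j
  proof -
    have R: "R $ (a, l) $ (i, j) = (if i = j then Dv (pos i) $ (a, l)
        else if (a, l) = (j, i) then y * ?q else 0)"
      using main[OF p[of i] p[of j]] unfolding v_def inv inj by (simp add: mult_axis[symmetric] axis_def)
    have M: "?M $ (a, l) $ (i, j) = d j / d a * hecke_R y ?q (\<lambda>i. - int (pos i)) $ (l, j) $ (a, i)"
      by (simp add: mixed_R_def)
    show ?thesis
    proof (cases "i = j")
      case False
      have "hecke_R y ?q (\<lambda>i. - int (pos i)) $ (l, j) $ (a, i) = (if l = i \<and> a = j then y * ?q else 0)"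
        unfolding hecke_R_column using False by (auto split: if_splits)
      then show ?thesis unfolding R M using False d0 by simp
    next
      case True
      have "Dv (pos i) $ (a, l) = (\<Sum>k\<in>{1..pos i}. if k = pos a then if l = a then c (pos a) (pos i) else 0 else 0)"
        unfolding Dv_def v_def sum_component
      proof (intro sum.cong refl)
        fix k assume k: "k \<in> {1..pos i}"
        then have "k \<in> {1..r + 1}" using p[of i] by auto
        then have "pos (inv pos k) = k" using bij by (intro f_inv_into_f) (auto simp: bij_betw_def)
        then have "inv pos k = a \<longleftrightarrow> k = pos a" for a using inv by metis
        then show "(c k (pos i) *s axis (inv pos k, inv pos k) 1) $ (a, l)
            = (if k = pos a then if l = a then c (pos a) (pos i) else 0 else 0)"
          by (auto simp: axis_def inj inv)
      qed
      also have "\<dots> = (if pos a \<le> pos i \<and> l = a then c (pos a) (pos i) else 0)"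
        using p[of a] by auto
      finally have Dv: "Dv (pos i) $ (a, l) = (if pos a \<le> pos i \<and> l = a then c (pos a) (pos i) else 0)" .
      have ratio: "d i / d a = (1 / ?q) ^ (2 * (pos i - pos a))" if "pos a \<le> pos i"
        using that d(2) q0 by (simp add: d(1) power_diff[symmetric] right_diff_distrib' del: power_divide power_one_over)
      show ?thesis
      proof (cases "l = a")
        case True
        then show ?thesis
          unfolding R M Dv using \<open>i = j\<close> d0 ratio inj[of a i] hecke_R_entry[of y ?q _ a i a i]
          by (cases "pos a" "pos i" rule: linorder_cases) (auto simp: c_def)
      next
        case False
        then have "hecke_R y ?q (\<lambda>i. - int (pos i)) $ (l, i) $ (a, i) = 0"
          unfolding hecke_R_column by auto
        then show ?thesis unfolding R M Dv using \<open>i = j\<close> False by simp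
      qed
    qed
  qed
  then show ?thesis by (auto simp: vec_eq_iff)
qed

section \<open>The braidings of the vector representation\<close>

text \<open>
  Applying \<open>F\<close> at the nodes \<open>\<tau> 1, \<tau> 2, \<dots>\<close> in turn to the highest weight vector gives \<open>r + 1\<close> nonzero
  vectors, because \<open>E\<close> leads back from each to the previous one. Their weights separate the positions,
  and the given basis consists of weight vectors, so each basis vector occurs in exactly one of these
  vectors. Since there are \<open>r + 1\<close> basis vectors, the chain vectors are multiples of them. All other
  entries of \<open>E\<close> and \<open>F\<close> vanish, as no other weights differ by the right simple root.
\<close>

lemma chain_exists:
  fixes \<pi> :: "uq_gen \<Rightarrow> complex^'n^'n"
  assumes U: "uq_module r q \<pi>" and q: "0 < q" "q < 1" and card: "CARD('n) = r + 1"
    and hw: "highest_weight_vector r q \<pi> \<mu> v0"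
    and diag: "\<And>i. weight_vector r q \<pi> (wt i) (axis i 1)"
    and tau: "bij_betw \<tau> {1..r} {1..r}"
    and cartan: "\<And>j k. j \<in> {1..r} \<Longrightarrow> k \<in> {1..r} \<Longrightarrow> ip r (simple_root (\<tau> j)) (simple_root (\<tau> k))
      = (if j = k then 2 else if j = Suc k \<or> k = Suc j then - 1 else 0)"
    and mu: "\<And>k. k \<in> {1..r} \<Longrightarrow> ip r (simple_root (\<tau> k)) \<mu> = (if k = 1 then 1 else 0)"
  obtains pos e f where "chain_rep r q \<tau> pos \<pi> e f"
proof -
  let ?q = "of_real q :: complex"
  have q0: "?q \<noteq> 0" using q by simp
  have q2: "?q * ?q \<noteq> 1" "?q \<noteq> 1"
  proof -
    have "q * q < 1" using q mult_strict_mono[of q 1 q 1] by simp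
    then have "complex_of_real (q * q) \<noteq> 1" by (simp only: of_real_eq_1_iff)
    then show "?q * ?q \<noteq> 1" by simp
    show "?q \<noteq> 1" using q by simp
  qed
  have q3: "?q * ?q * ?q \<noteq> 1" 
  proof -
    have "q * q * q < 1" using q mult_strict_mono[of q 1 q 1] mult_strict_mono[of "q * q" 1 q 1] by simp
    then have "complex_of_real (q * q * q) \<noteq> 1" by (simp only: of_real_eq_1_iff)
    then show ?thesis by simp
  qed
  have q4: "?q * (?q * (?q * ?q)) \<noteq> 1"
  proof -
    have "q * q < 1" using q mult_strict_mono[of q 1 q 1] by simp
    then have "(q * q) * (q * q) < 1" using q mult_strict_mono[of "q * q" 1 "q * q" 1] by simp
    then have "complex_of_real ((q * q) * (q * q)) \<noteq> 1" by (simp only: of_real_eq_1_iff)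
    then show ?thesis by (simp add: mult.assoc)
  qed
  have t: "\<tau> k \<in> {1..r}" if "k \<in> {1..r}" for k using tau that by (auto simp: bij_betw_def)
  define kap where "kap j i = complex_of_real (q powr ip r (simple_root (\<tau> j)) (wt i))" for j i
  have K: "\<pi> (Kgen (\<tau> j)) $ a $ b = (if a = b then kap j b else 0)" if "j \<in> {1..r}" for j a b
  proof -
    have "\<pi> (Kgen (\<tau> j)) *v axis b 1 = (q powr ip r (simple_root (\<tau> j)) (wt b)) *\<^sub>R axis b 1"
      using diag[of b] t[OF that] unfolding weight_vector_def by blast
    then have "(\<pi> (Kgen (\<tau> j)) *v axis b 1) $ a = (if a = b then kap j b else 0)"
      by (simp add: kap_def axis_def of_real_def)
    then show ?thesis by (simp only: mult_axis)
  qed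
  have Kv: "(\<pi> (Kgen (\<tau> j)) *v x) $ a = kap j a * x $ a" if "j \<in> {1..r}" for j a x
    unfolding matrix_vector_mult_def by (simp add: K[OF that] if_distrib[of "\<lambda>x. x * _"] cong: if_cong)
  have KK: "\<pi> (Kgen (\<tau> j)) ** \<pi> (Kinv (\<tau> j)) = mat 1" "\<pi> (Kinv (\<tau> j)) ** \<pi> (Kgen (\<tau> j)) = mat 1"
    if "j \<in> {1..r}" for j
    using U t[OF that] unfolding uq_module_def by blast+
  have kap0: "kap j i \<noteq> 0" for i j using q by (simp add: kap_def)
  have Kinv: "\<pi> (Kinv (\<tau> j)) $ a $ b = (if a = b then 1 / kap j b else 0)" if "j \<in> {1..r}" for j a b
  proof -
    have "(\<pi> (Kinv (\<tau> j)) ** \<pi> (Kgen (\<tau> j))) $ a $ b = \<pi> (Kinv (\<tau> j)) $ a $ b * kap j b"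
      unfolding matrix_matrix_mult_def by (simp add: K[OF that] if_distrib cong: if_cong)
    then have "\<pi> (Kinv (\<tau> j)) $ a $ b * kap j b = (if a = b then 1 else 0)"
      unfolding KK[OF that] by (simp add: mat_def)
    then show ?thesis using kap0[of j b] by (auto simp: field_simps split: if_splits)
  qed
  define ca :: "nat \<Rightarrow> nat \<Rightarrow> complex" where
    "ca j k = (if j = k then ?q * ?q else if j = Suc k \<or> k = Suc j then 1 / ?q else 1)" for j k
  have ca: "complex_of_real (q powr ip r (simple_root (\<tau> j)) (simple_root (\<tau> k))) = ca j k"
      "complex_of_real (q powr (- ip r (simple_root (\<tau> j)) (simple_root (\<tau> k)))) = 1 / ca j k"
    if "j \<in> {1..r}" "k \<in> {1..r}" for j k
    unfolding cartan[OF that] ca_def using q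
    by (auto simp: powr_minus powr_realpow[of q 2, simplified] power2_eq_square field_simps)
  have conj: "kap j a * M $ a $ b = c * (M $ a $ b * kap j b)"
    if "j \<in> {1..r}" "\<pi> (Kgen (\<tau> j)) ** M ** \<pi> (Kinv (\<tau> j)) = x *\<^sub>R M" "of_real x = c" for j M x c a b
  proof -
    have "(\<pi> (Kgen (\<tau> j)) ** M) $ a $ b = kap j a * M $ a $ b" for a b
      unfolding matrix_matrix_mult_def by (simp add: K[OF that(1)] if_distrib[of "\<lambda>x. x * _"] cong: if_cong)
    then have "(\<pi> (Kgen (\<tau> j)) ** M ** \<pi> (Kinv (\<tau> j))) $ a $ b = kap j a * M $ a $ b * (1 / kap j b)"
      unfolding matrix_matrix_mult_def[of "_ ** _"] by (simp add: Kinv[OF that(1)] if_distrib cong: if_cong)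
    then have "kap j a * M $ a $ b * (1 / kap j b) = c * M $ a $ b"
      unfolding that(2) that(3)[symmetric] by (simp only: vector_scaleR_component) (simp only: scaleR_conv_of_real)
    then show ?thesis using kap0[of j b] by (simp add: field_simps)
  qed
  have shift: "kap j a * (M *v x) $ a = c * b * (M *v x) $ a"
    if "\<And>a b. kap j a * M $ a $ b = c * (M $ a $ b * kap j b)" "\<And>a. kap j a * x $ a = b * x $ a" for j M x a b c
  proof -
    have "kap j a * (M *v x) $ a = (\<Sum>b\<in>UNIV. kap j a * M $ a $ b * x $ b)"
      unfolding matrix_vector_mult_def by (simp add: sum_distrib_left mult.assoc)
    also have "\<dots> = (\<Sum>b'\<in>UNIV. c * b * (M $ a $ b' * x $ b'))"
      unfolding that(1)
    proof (intro sum.cong refl)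
      fix b'
      have "c * (M $ a $ b' * kap j b') * x $ b' = c * M $ a $ b' * (kap j b' * x $ b')" by simp
      also have "\<dots> = c * b * (M $ a $ b' * x $ b')" unfolding that(2) by simp
      finally show "c * (M $ a $ b' * kap j b') * x $ b' = c * b * (M $ a $ b' * x $ b')" .
    qed
    also have "\<dots> = c * b * (M *v x) $ a"
      unfolding matrix_vector_mult_def by (simp add: sum_distrib_left)
    finally show ?thesis .
  qed
  have rel: "\<pi> (Kgen (\<tau> j)) ** \<pi> (Egen (\<tau> k)) ** \<pi> (Kinv (\<tau> j))
        = (q powr ip r (simple_root (\<tau> j)) (simple_root (\<tau> k))) *\<^sub>R \<pi> (Egen (\<tau> k))"
      "\<pi> (Kgen (\<tau> j)) ** \<pi> (Fgen (\<tau> k)) ** \<pi> (Kinv (\<tau> j))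
        = (q powr (- ip r (simple_root (\<tau> j)) (simple_root (\<tau> k)))) *\<^sub>R \<pi> (Fgen (\<tau> k))"
      "\<pi> (Egen (\<tau> j)) ** \<pi> (Fgen (\<tau> k)) - \<pi> (Fgen (\<tau> k)) ** \<pi> (Egen (\<tau> j))
        = (if \<tau> j = \<tau> k then (1 / (q - 1 / q)) *\<^sub>R (\<pi> (Kgen (\<tau> j)) - \<pi> (Kinv (\<tau> j))) else 0)"
    if "j \<in> {1..r}" "k \<in> {1..r}" for j k
    using U t[OF that(1)] t[OF that(2)] unfolding uq_module_def by blast+
  have E: "kap j a * \<pi> (Egen (\<tau> k)) $ a $ b = ca j k * (\<pi> (Egen (\<tau> k)) $ a $ b * kap j b)"
    and F: "kap j a * \<pi> (Fgen (\<tau> k)) $ a $ b = (1 / ca j k) * (\<pi> (Fgen (\<tau> k)) $ a $ b * kap j b)"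
    if "j \<in> {1..r}" "k \<in> {1..r}" for j k a b
    by (rule conj[OF that(1) rel(1)[OF that] ca(1)[OF that]],
        rule conj[OF that(1) rel(2)[OF that] ca(2)[OF that]])
  have tau_inj: "\<tau> j = \<tau> k \<longleftrightarrow> j = k" if "j \<in> {1..r}" "k \<in> {1..r}" for j k
    using inj_on_eq_iff[OF bij_betw_imp_inj_on[OF tau] that] .

  \<comment> \<open>the chain generated by the highest weight vector\<close>
  define w where "w = rec_nat v0 (\<lambda>n x. \<pi> (Fgen (\<tau> (Suc n))) *v x)"
  have w: "w 0 = v0" "w (Suc n) = \<pi> (Fgen (\<tau> (Suc n))) *v w n" for n by (simp_all add: w_def)
  have chain: "w n \<noteq> 0 \<and> (\<forall>j\<in>{1..r}. \<forall>a. kap j a * w n $ a = kx q j (Suc n) * w n $ a)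
      \<and> (\<forall>j\<in>{1..r}. n < j \<longrightarrow> \<pi> (Egen (\<tau> j)) *v w n = 0)
      \<and> (n \<noteq> 0 \<longrightarrow> \<pi> (Egen (\<tau> n)) *v w n = w (n - 1))" if "n \<le> r" for n
    using that
  proof (induction n)
    case 0
    have "kap j a * v0 $ a = kx q j (Suc 0) * v0 $ a" if "j \<in> {1..r}" for j a
    proof -
      have "\<pi> (Kgen (\<tau> j)) *v v0 = (q powr ip r (simple_root (\<tau> j)) \<mu>) *\<^sub>R v0"
        using hw t[OF that] unfolding highest_weight_vector_def weight_vector_def by blast
      then have "kap j a * v0 $ a = of_real (q powr ip r (simple_root (\<tau> j)) \<mu>) * v0 $ a"
        using Kv[OF that, of v0 a] by (auto simp: vector_scaleR_component scaleR_conv_of_real[of _ "_ $ _"])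
      then show ?thesis unfolding mu[OF that] using that q by (auto simp: kx_def)
    qed
    then show ?case
      using hw t unfolding w highest_weight_vector_def by auto
  next
    case (Suc n)
    let ?k = "Suc n"
    have k: "?k \<in> {1..r}" using Suc(2) by auto
    have IH: "w n \<noteq> 0" "\<And>j a. j \<in> {1..r} \<Longrightarrow> kap j a * w n $ a = kx q j (Suc n) * w n $ a"
      "\<And>j. j \<in> {1..r} \<Longrightarrow> n < j \<Longrightarrow> \<pi> (Egen (\<tau> j)) *v w n = 0"
      using Suc by auto
    have EF: "\<pi> (Egen (\<tau> j)) *v w ?k = (if j = ?k then w n else 0)" if j: "j \<in> {1..r}" "n < j" for j
    proof -
      have "\<pi> (Egen (\<tau> j)) *v w ?k = (\<pi> (Egen (\<tau> j)) ** \<pi> (Fgen (\<tau> ?k)) - \<pi> (Fgen (\<tau> ?k)) ** \<pi> (Egen (\<tau> j))) *v w n"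
        unfolding w(2) matrix_vector_mult_diff_rdistrib matrix_vector_mul_assoc[symmetric] IH(3)[OF j]
        by simp
      also have "\<dots> = (if j = ?k then w n else 0)"
      proof (cases "j = ?k")
        case True
        have "((1 / (q - 1 / q)) *\<^sub>R (\<pi> (Kgen (\<tau> ?k)) - \<pi> (Kinv (\<tau> ?k))) *v w n) $ a = w n $ a" for a
        proof -
          have "kap ?k a * w n $ a = ?q * w n $ a" using IH(2)[OF k] by (simp add: kx_def)
          moreover have "(\<pi> (Kinv (\<tau> ?k)) *v w n) $ a = 1 / kap ?k a * w n $ a"
            unfolding matrix_vector_mult_def
            by (simp add: Kinv[OF k] if_distrib[of "\<lambda>x. x * _"] cong: if_cong)
          moreover have "1 / kap ?k a * w n $ a = 1 / ?q * w n $ a"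
            using calculation(1) kap0[of ?k a] q0 by (cases "w n $ a = 0") (simp_all add: field_simps)
          moreover have "?q - 1 / ?q \<noteq> 0" using q2 q0 by (simp add: field_simps)
          ultimately have "of_real (1 / (q - 1 / q)) * ((\<pi> (Kgen (\<tau> ?k)) *v w n) $ a - (\<pi> (Kinv (\<tau> ?k)) *v w n) $ a) = w n $ a"
            unfolding Kv[OF k] by (cases "w n $ a = 0") (simp_all add: field_simps)
          moreover have "(y *\<^sub>R M *v x) $ a = of_real y * (M *v x) $ a" for y M and x :: "complex^'n"
            unfolding matrix_vector_mult_def vector_scaleR_component vec_lambda_beta
            by (simp add: scaleR_conv_of_real[of _ "_ :: complex"] sum_distrib_left mult.assoc)
          ultimately show ?thesis by (simp add: matrix_vector_mult_diff_rdistrib)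
        qed
        then show ?thesis unfolding rel(3)[OF j(1) k] using True by (simp add: vec_eq_iff)
      next
        case False
        then show ?thesis unfolding rel(3)[OF j(1) k] tau_inj[OF j(1) k] by simp
      qed
      finally show ?thesis .
    qed
    have "w ?k \<noteq> 0" using EF[OF k] IH(1) by auto
    moreover have "kap j a * w ?k $ a = kx q j (Suc ?k) * w ?k $ a" if j: "j \<in> {1..r}" for j a
    proof -
      have "kap j a * w ?k $ a = 1 / ca j ?k * kx q j (Suc n) * w ?k $ a"
        unfolding w(2) by (rule shift[OF F[OF j k] IH(2)[OF j]])
      also have "1 / ca j ?k * kx q j (Suc n) = kx q j (Suc ?k)"
        using q0 by (auto simp: ca_def kx_def)
      finally show ?thesis .
    qed
    ultimately show ?case using EF EF[OF k] by auto
  qed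

  \<comment> \<open>supports of the chain vectors are disjoint, hence singletons\<close>
  have kxe: "kx q j n = kx q j m \<Longrightarrow> j = n \<Longrightarrow> n < m \<Longrightarrow> False" for j n m
    using q0 q2 by (auto simp: kx_def field_simps split: if_splits)
  have sep: "n = m" if "n \<le> r" "m \<le> r" "w n $ a \<noteq> 0" "w m $ a \<noteq> 0" for n m a
  proof (rule ccontr)
    assume "n \<noteq> m"
    have eq: "kx q j (Suc n) = kx q j (Suc m)" if "j \<in> {1..r}" for j
      using chain[OF \<open>n \<le> r\<close>] chain[OF \<open>m \<le> r\<close>] \<open>w n $ a \<noteq> 0\<close> \<open>w m $ a \<noteq> 0\<close> that
      by (metis mult_right_cancel)
    show False
    proof (cases "n < m")
      case True
      then show False using kxe[OF eq[of "Suc n"]] \<open>m \<le> r\<close> by auto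
    next
      case False
      then show False using kxe[OF eq[of "Suc m", symmetric]] \<open>n \<le> r\<close> \<open>n \<noteq> m\<close> by auto
    qed
  qed
  have "\<exists>a. w n $ a \<noteq> 0" if "n \<le> r" for n
    using chain[OF that] by (auto simp: vec_eq_iff)
  then obtain g where g: "\<And>n. n \<le> r \<Longrightarrow> w n $ g n \<noteq> 0" by metis
  have g_inj: "inj_on g {..r}" using sep g by (auto simp: inj_on_def) metis
  then have g_bij: "bij_betw g {..r} UNIV"
    using card by (simp add: bij_betw_def card_image card_subset_eq)
  define pos where "pos i = Suc (inv_into {..r} g i)" for i
  have "bij_betw (\<lambda>i. inv_into {..r} g i) UNIV {..r}" by (rule bij_betw_inv_into[OF g_bij])
  moreover have "bij_betw Suc {..r} {1..r + 1}"
    by (simp add: bij_betw_def image_Suc_atMost)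
  ultimately have pos: "bij_betw pos UNIV {1..r + 1}"
    using bij_betw_trans unfolding pos_def comp_def by blast
  have pos_r: "pos i - 1 \<le> r" "pos i \<ge> 1" for i
  proof -
    have "pos i \<in> {1..r + 1}" using pos unfolding bij_betw_def by blast
    then show "pos i - 1 \<le> r" "pos i \<ge> 1" by auto
  qed
  have g_pos: "g (pos i - 1) = i" for i
    using g_bij by (simp add: pos_def bij_betw_def f_inv_into_f)
  have kap: "kap j i = kx q j (pos i)" if "j \<in> {1..r}" for i j
    using chain[OF pos_r(1)[of i]] g[OF pos_r(1)[of i]] that pos_r(2)[of i] unfolding g_pos
    by (metis Suc_diff_1 less_le_trans less_numeral_extra(1) mult_right_cancel)
  have supp: "a = i" if "w (pos i - 1) $ a \<noteq> 0" for a i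
    using sep[OF pos_r(1) pos_r(1), of i a a] g[OF pos_r(1)[of a]] that unfolding g_pos
    by (metis g_pos)
  \<comment> \<open>\<open>E\<close> and \<open>F\<close> shift the eigenvalue of each \<open>K\<close> by a fixed factor; the powers of \<open>q\<close> excluded by
    \<open>q2\<close>, \<open>q3\<close>, \<open>q4\<close> would be needed for any other entry\<close>
  have E_supp: "pos b = Suc k \<and> pos a = k" if "\<pi> (Egen (\<tau> k)) $ a $ b \<noteq> 0" "k \<in> {1..r}" for a b k
    using E[OF that(2,2), of a b] that(1) q0 q2 q3 q4 unfolding kap[OF that(2)]
    by (auto simp: ca_def kx_def field_simps split: if_splits)
  have F_supp: "pos b = k \<and> pos a = Suc k" if "\<pi> (Fgen (\<tau> k)) $ a $ b \<noteq> 0" "k \<in> {1..r}" for a b k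
    using F[OF that(2,2), of a b] that(1) q0 q2 q3 q4 unfolding kap[OF that(2)]
    by (auto simp: ca_def kx_def field_simps split: if_splits)
  have single: "(M *v w (pos i - 1)) $ a = M $ a $ i * w (pos i - 1) $ i" for M a i
  proof -
    have "(M *v w (pos i - 1)) $ a = (\<Sum>b\<in>UNIV. if b = i then M $ a $ i * w (pos i - 1) $ i else 0)"
      unfolding matrix_vector_mult_def vec_lambda_beta
    proof (intro sum.cong refl)
      show "M $ a $ b * w (pos i - 1) $ b = (if b = i then M $ a $ i * w (pos i - 1) $ i else 0)" for b
        using supp[of i b] by (cases "b = i") auto
    qed
    then show ?thesis by simp
  qed
  define e where "e k = \<pi> (Egen (\<tau> k)) $ (inv pos k) $ (inv pos (Suc k))" for k
  define f where "f k = \<pi> (Fgen (\<tau> k)) $ (inv pos (Suc k)) $ (inv pos k)" for k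
  have inv: "inv pos (pos i) = i" for i using pos by (simp add: bij_betw_def)
  have pos_inv: "pos (inv pos k) = k" if "k \<in> {1..r + 1}" for k
    using pos that by (intro f_inv_into_f) (auto simp: bij_betw_def)
  have nz: "e k \<noteq> 0 \<and> f k \<noteq> 0" if k: "k \<in> {1..r}" for k
  proof -
    define i i' where "i = inv pos k" and "i' = inv pos (Suc k)"
    have p: "pos i = k" "pos i' = Suc k" using k by (auto simp: i_def i'_def pos_inv)
    obtain k' where k': "k = Suc k'" using k by (cases k) auto
    have wf: "w k = \<pi> (Fgen (\<tau> k)) *v w (k - 1)" unfolding k' w(2) by simp
    have we: "\<pi> (Egen (\<tau> k)) *v w k = w (k - 1)" using chain[of k] k by auto
    have "w k $ i' \<noteq> 0" "w (k - 1) $ i \<noteq> 0"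
    proof -
      have "k - 1 \<le> r" "k \<le> r" using k by auto
      from g[OF this(1)] g[OF this(2)] show "w k $ i' \<noteq> 0" "w (k - 1) $ i \<noteq> 0"
        using g_pos[of i] g_pos[of i'] unfolding p by simp_all
    qed
    moreover have "w k $ i' = f k * w (k - 1) $ i"
      using single[of "\<pi> (Fgen (\<tau> k))" i i'] wf unfolding p f_def i_def[symmetric] i'_def[symmetric] by simp
    moreover have "w (k - 1) $ i = e k * w k $ i'"
      using single[of "\<pi> (Egen (\<tau> k))" i' i] we unfolding p e_def i_def[symmetric] i'_def[symmetric] by simp
    ultimately show ?thesis by auto
  qed
  have "chain_rep r q \<tau> pos \<pi> e f"
    unfolding chain_rep_def
  proof (intro conjI ballI allI pos tau)
    fix k i j assume k: "k \<in> {1..r}"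
    show "e k \<noteq> 0" "f k \<noteq> 0" using nz[OF k] by auto
    show "\<pi> (Kgen (\<tau> k)) $ j $ i = (if j = i then kx q k (pos i) else 0)"
      "\<pi> (Kinv (\<tau> k)) $ j $ i = (if j = i then 1 / kx q k (pos i) else 0)"
      unfolding K[OF k] Kinv[OF k] kap[OF k] by auto
    show "\<pi> (Egen (\<tau> k)) $ j $ i = (if pos i = Suc k \<and> pos j = k then e k else 0)"
      using E_supp[OF _ k, of j i] inv[of i] inv[of j] unfolding e_def by (cases "\<pi> (Egen (\<tau> k)) $ j $ i = 0") auto
    show "\<pi> (Fgen (\<tau> k)) $ j $ i = (if pos i = k \<and> pos j = Suc k then f k else 0)"
      using F_supp[OF _ k, of j i] inv[of i] inv[of j] unfolding f_def by (cases "\<pi> (Fgen (\<tau> k)) $ j $ i = 0") auto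
  qed
  then show thesis by (rule that)
qed

lemma ip_simple_root: "i \<in> {1..r} \<Longrightarrow> ip r (simple_root i) \<mu> = \<mu> i - \<mu> (i + 1)"
proof -
  assume i: "i \<in> {1..r}"
  have "ip r (simple_root i) \<mu> = (\<Sum>k\<in>{1..r + 1}. (if k = i then \<mu> i else 0) - (if k = i + 1 then \<mu> (i + 1) else 0))"
    unfolding ip_def simple_root_def by (intro sum.cong) auto
  also have "\<dots> = \<mu> i - \<mu> (i + 1)" using i by (simp add: sum_subtractf)
  finally show ?thesis .
qed

lemma fund_weight_step: "fund_weight r s i - fund_weight r s (i + 1) = (if i = s then 1 else 0)"
  by (auto simp: fund_weight_def)

lemma w0_fund_weight_step:
  "i \<in> {1..r} \<Longrightarrow> w0 r (fund_weight r s) i - w0 r (fund_weight r s) (i + 1) = (if r + 1 - i = s then - 1 else 0)"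
  by (auto simp: fund_weight_def w0_def)

lemma two_rho_eq:
  assumes "k \<in> {1..r + 1}"
  shows "two_rho r k = real r + 2 - 2 * real k"
proof -
  have "(\<Sum>i = 1..r. if k \<le> i then 1 else (0::real)) = (\<Sum>i\<in>{k..r}. 1)"
    using assms by (intro sum.mono_neutral_cong_right) auto
  then have 1: "(\<Sum>i = 1..r. if k \<le> i then 1 else (0::real)) = real r + 1 - real k"
    using assms by (simp add: of_nat_diff)
  have "(\<Sum>i = 1..r. real i) = real r * real (r + 1) / 2"
    by (induction r) (auto simp: field_simps)
  then have 2: "(\<Sum>i = 1..r. real i) / real (r + 1) = real r / 2"
    by simp
  have "(\<Sum>i = 1..r. fund_weight r i k)
      = (\<Sum>i = 1..r. if k \<le> i then 1 else (0::real)) - (\<Sum>i = 1..r. real i) / real (r + 1)"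
    unfolding fund_weight_def sum_subtractf sum_divide_distrib ..
  then show ?thesis unfolding two_rho_def 1 2 by simp
qed

text \<open>
  Summation by parts: \<open>2\<rho>\<close> is the sum of the \<open>k (r + 1 - k) \<alpha>\<^sub>k\<close>. The right-hand side depends only on the
  pairings of \<open>\<mu>\<close> with the simple roots, and these are what the chain determines.
\<close>

lemma ip_two_rho:
  "ip r \<mu> (two_rho r) = (\<Sum>k = 1..r. real k * (real r + 1 - real k) * (\<mu> k - \<mu> (k + 1)))"
proof -
  have "(\<Sum>k = 1..n. real k * (R - real k) * (\<mu> k - \<mu> (k + 1)))
      = (\<Sum>k = 1..n. (R + 1 - 2 * real k) * \<mu> k) - real n * (R - real n) * \<mu> (n + 1)" for n R
    by (induction n) (auto simp: algebra_simps)
  from this[of "real r + 1" r] have "(\<Sum>k = 1..r. real k * (real r + 1 - real k) * (\<mu> k - \<mu> (k + 1)))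
      = (\<Sum>k = 1..r + 1. (real r + 2 - 2 * real k) * \<mu> k)" by (simp add: algebra_simps)
  also have "\<dots> = ip r \<mu> (two_rho r)"
    unfolding ip_def by (intro sum.cong refl) (simp add: two_rho_eq)
  finally show ?thesis by simp
qed

context projective_space_data
begin

text \<open>
  The Dynkin diagram read from the node \<open>s\<close>, at which the chain of \<open>V(\<omega>\<^sub>s)\<close> starts.
\<close>

definition node :: "nat \<Rightarrow> nat" where
  "node k = (if s = 1 then k else r + 1 - k)"

lemma node_range: "k \<in> {1..r} \<Longrightarrow> node k \<in> {1..r}"
  by (auto simp: node_def)

lemma node_bij: "bij_betw node {1..r} {1..r}"
  by (rule bij_betw_byWitness[where f' = node]) (auto simp: node_def)

lemma node_eq: "k \<in> {1..r} \<Longrightarrow> node k = s \<longleftrightarrow> k = 1" "k \<in> {1..r} \<Longrightarrow> r + 1 - node k = s \<longleftrightarrow> k = r"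
  using r s by (auto simp: node_def)

lemma cartan:
  assumes "j \<in> {1..r}" "k \<in> {1..r}"
  shows "ip r (simple_root (node j)) (simple_root (node k))
    = (if j = k then 2 else if j = Suc k \<or> k = Suc j then - 1 else 0)"
  unfolding ip_simple_root[OF node_range[OF assms(1)]] using assms by (auto simp: simple_root_def node_def)

lemma a_eq: "a = 2"
proof -
  have "s = node 1" using r s by (auto simp: node_def)
  then show ?thesis unfolding a_def using cartan[of 1 1] r by simp
qed

lemma m_eq: "m = real r"
proof -
  have "m = (\<Sum>k = 1..r. if k = s then real k * (real r + 1 - real k) else 0)"
    unfolding m_def ip_two_rho fund_weight_step by (intro sum.cong) auto
  also have "\<dots> = real r" using r s by auto
  finally show ?thesis .
qed

lemma ip_fund_weight:
  "ip r (fund_weight r s) \<mu> = (\<Sum>k = 1..s. \<mu> k) - real s / real (r + 1) * (\<Sum>k = 1..r + 1. \<mu> k)"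
proof -
  have sr: "s \<le> r" using r s by auto
  have "ip r (fund_weight r s) \<mu> = (\<Sum>k = 1..r + 1. (if k \<le> s then \<mu> k else 0) - real s / real (r + 1) * \<mu> k)"
    unfolding ip_def fund_weight_def by (intro sum.cong) (auto simp: left_diff_distrib)
  also have "(\<Sum>k = 1..r + 1. if k \<le> s then \<mu> k else 0) = (\<Sum>k = 1..s. \<mu> k)"
    using sr by (intro sum.mono_neutral_cong_right) auto
  then have "(\<Sum>k = 1..r + 1. (if k \<le> s then \<mu> k else 0) - real s / real (r + 1) * \<mu> k)
      = (\<Sum>k = 1..s. \<mu> k) - real s / real (r + 1) * (\<Sum>k = 1..r + 1. \<mu> k)"
    unfolding sum_subtractf sum_distrib_left by simp
  finally show ?thesis .
qed

lemma sum_fund_weight: "(\<Sum>k = 1..r + 1. fund_weight r s k) = 0"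
proof -
  have "s \<le> r" using r s by auto
  then have "(\<Sum>k = 1..r + 1. if k \<le> s then 1 else (0::real)) = (\<Sum>k = 1..s. 1)"
    by (intro sum.mono_neutral_cong_right) auto
  then show ?thesis by (simp add: fund_weight_def sum_subtractf)
qed

lemma sum_w0: "(\<Sum>k = 1..r + 1. w0 r \<mu> k) = (\<Sum>k = 1..r + 1. \<mu> k)"
  unfolding w0_def by (rule sum.reindex_bij_witness[where i = "\<lambda>k. r + 2 - k" and j = "\<lambda>k. r + 2 - k"]) auto

lemma w_eq: "w = real r / (real r + 1)"
proof -
  have "w = (\<Sum>k = 1..s. fund_weight r s k)"
    unfolding w_def ip_fund_weight sum_fund_weight by simp
  also have "\<dots> = (\<Sum>k = 1..s. 1 - real s / real (r + 1))"
    by (intro sum.cong) (auto simp: fund_weight_def)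
  also have "\<dots> = real r / (real r + 1)" using r s by (auto simp: field_simps)
  finally show ?thesis .
qed

lemma ip_fund_weight_w0: "ip r (fund_weight r s) (w0 r (fund_weight r s)) = w - 1"
proof -
  have "ip r (fund_weight r s) (w0 r (fund_weight r s)) = (\<Sum>k = 1..s. w0 r (fund_weight r s) k)"
    unfolding ip_fund_weight sum_w0 sum_fund_weight by simp
  also have "\<dots> = (\<Sum>k = 1..s. (if r + 2 - k \<le> s then 1 else 0) - real s / real (r + 1))"
    by (simp add: w0_def fund_weight_def)
  also have "\<dots> = w - 1"
  proof (cases "s = 1")
    case True
    then show ?thesis using r unfolding w_eq by (simp add: field_simps)
  next
    case False
    then have sr: "s = r" using s by auto
    then have "(\<Sum>k = 1..s. if r + 2 - k \<le> s then 1 else (0::real)) = (\<Sum>k = 2..r. 1)"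
      by (intro sum.mono_neutral_cong_right) auto
    then have count: "(\<Sum>k = 1..s. if r + 2 - k \<le> s then 1 else (0::real)) = real r - 1"
      using r by (simp add: of_nat_diff)
    show ?thesis unfolding sum_subtractf w_eq count using r sr by (simp add: field_simps)
  qed
  finally show ?thesis .
qed

end

lemma scaleR_vec: "(x::real) *\<^sub>R (y :: complex^'n) = of_real x *s y"
  unfolding vec_eq_iff vector_scaleR_component vector_smult_component by (simp add: scaleR_conv_of_real)

lemma chain_highest_weight_vector:
  assumes ch: "chain_rep r q \<tau> pos \<rho> e f" and q: "0 < q"
    and mu: "\<And>k. k \<in> {1..r} \<Longrightarrow> ip r (simple_root (\<tau> k)) \<mu> = (if k = 1 then 1 else 0)"
  shows "highest_weight_vector r q \<rho> \<mu> (axis (inv pos 1) 1)"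
proof -
  have "bij_betw \<tau> {1..r} {1..r}" using ch by (simp add: chain_rep_def)
  then have "\<exists>k\<in>{1..r}. i = \<tau> k" if "i \<in> {1..r}" for i
    using that unfolding bij_betw_def by blast
  moreover have "\<rho> (Kgen (\<tau> k)) *v axis (inv pos 1) 1
      = (q powr ip r (simple_root (\<tau> k)) \<mu>) *\<^sub>R axis (inv pos 1) 1" if "k \<in> {1..r}" for k
    unfolding mu[OF that] scaleR_vec using chain_rep_action(1)[OF ch that, of 1] that q
    by (auto simp: kx_def)
  moreover have "\<rho> (Egen (\<tau> k)) *v axis (inv pos 1) 1 = 0" if "k \<in> {1..r}" for k
    using chain_rep_action(3)[OF ch that, of 1] that by auto
  ultimately show ?thesis
    unfolding highest_weight_vector_def weight_vector_def by (metis axis_eq_0_iff zero_neq_one)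
qed

lemma chain_lowest_weight_vector:
  assumes ch: "chain_rep r q \<tau> pos \<rho> e f" and q: "0 < q"
    and mu: "\<And>k. k \<in> {1..r} \<Longrightarrow> ip r (simple_root (\<tau> k)) \<mu> = (if k = r then - 1 else 0)"
  shows "lowest_weight_vector r q \<rho> \<mu> (axis (inv pos (r + 1)) 1)"
proof -
  have "bij_betw \<tau> {1..r} {1..r}" using ch by (simp add: chain_rep_def)
  then have "\<exists>k\<in>{1..r}. i = \<tau> k" if "i \<in> {1..r}" for i
    using that unfolding bij_betw_def by blast
  moreover have "\<rho> (Kgen (\<tau> k)) *v axis (inv pos (r + 1)) 1
      = (q powr ip r (simple_root (\<tau> k)) \<mu>) *\<^sub>R axis (inv pos (r + 1)) 1" if "k \<in> {1..r}" for k
    unfolding mu[OF that] scaleR_vec using chain_rep_action(1)[OF ch that, of "r + 1"] that q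
    by (auto simp: kx_def powr_minus_divide)
  moreover have "\<rho> (Fgen (\<tau> k)) *v axis (inv pos (r + 1)) 1 = 0" if "k \<in> {1..r}" for k
    using chain_rep_action(4)[OF ch that, of "r + 1"] that by auto
  ultimately show ?thesis
    unfolding lowest_weight_vector_def weight_vector_def by (metis axis_eq_0_iff zero_neq_one)
qed

context projective_space_data
begin

lemma qc_add: "qc (x + y) = qc x * qc y" using q by (simp add: qc_def powr_add)
lemma qc_nz: "qc x \<noteq> 0" using q by (simp add: qc_def)
lemma qc_minus: "qc (- x) = 1 / qc x" using q by (simp add: qc_def powr_minus_divide)
lemma qc_1: "qc 1 = of_real q" using q by (simp add: qc_def)
lemma qc_nat: "qc (real n) = of_real q ^ n" using q by (simp add: qc_def powr_realpow)
lemma qc_0: "qc 0 = 1" using q by (simp add: qc_def)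

lemma qc_mult: "qc x * qc y = qc (x + y)" "qc x * (qc y * v) = qc (x + y) * v" "1 / qc x = qc (- x)"
  by (simp_all add: qc_add qc_minus mult.assoc)

lemma qc_diff: "qc (x - y) = qc x / qc y"
  using qc_add[of "x - y" y] qc_nz[of y] by (simp add: field_simps)

lemma qc_double: "qc (2 * x) = qc x * qc x" "qc (x * 2) = qc x * qc x"
  using qc_add[of x x] by (simp_all only: mult_2 mult_2_right)

text \<open>
  The chain of \<open>V\<close> and the reversed chain of its dual meet the hypotheses of the two column
  computations. The weights pair with the simple roots as their positions prescribe, which also gives the
  weights of \<open>E'\<close>.
\<close>

lemma braidings_explicit:
  obtains pos where "bij_betw pos UNIV {1..r + 1}"
    "RVV = hecke_R (qc w) (1 / of_real q) (\<lambda>i. int (pos i))"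
    "RDD = hecke_R (qc w) (1 / of_real q) (\<lambda>i. - int (pos i))"
    "RVD = mixed_R (\<lambda>i. qc (ip r (wt i) (two_rho r))) (hecke_R (qc (- w)) (of_real q) (\<lambda>i. - int (pos i)))"
    "\<And>i. qc (ip r (wt i) (two_rho r)) = of_real q ^ (r + 2) * (1 / of_real q) ^ (2 * pos i)"
proof -
  let ?om = "fund_weight r s" and ?om' = "\<lambda>k. - w0 r (fund_weight r s) k"
  have U: "uq_module r q \<pi>" and "\<exists>v. highest_weight_vector r q \<pi> ?om v"
    using V unfolding simple_module_def by auto
  then obtain v0 where v0: "highest_weight_vector r q \<pi> ?om v0" by blast
  have wt1: "ip r (simple_root (node k)) ?om = (if k = 1 then 1 else 0)" if "k \<in> {1..r}" for k
    unfolding ip_simple_root[OF node_range[OF that]] fund_weight_step node_eq[OF that] ..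
  have wt2: "ip r (simple_root (node k)) (w0 r ?om) = (if k = r then - 1 else 0)" if "k \<in> {1..r}" for k
    unfolding ip_simple_root[OF node_range[OF that]] w0_fund_weight_step[OF node_range[OF that]] node_eq[OF that] ..
  have neg: "ip r (simple_root (node k)) ?om' = - ip r (simple_root (node k)) (w0 r ?om)"
    if "k \<in> {1..r}" for k
    unfolding ip_simple_root[OF node_range[OF that]] by simp
  have w0w0: "ip r \<mu> (w0 r ?om') = - ip r \<mu> ?om" for \<mu>
  proof -
    have "ip r \<mu> (w0 r ?om') = (\<Sum>k = 1..r + 1. - (\<mu> k * ?om k))"
      unfolding ip_def by (intro sum.cong refl) (auto simp: w0_def)
    then show ?thesis by (simp add: ip_def sum_negf)
  qed
  have card: "CARD('n) = r + 1" by (rule dim)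
  obtain pos e f where ch: "chain_rep r q node pos \<pi> e f"
    using chain_exists[OF U q card v0 _ node_bij cartan wt1] weight_basis by blast
  have bij: "bij_betw pos UNIV {1..r + 1}" using ch by (simp add: chain_rep_def)
  have p: "pos i \<in> {1..r + 1}" for i using bij by (auto simp: bij_betw_def)
  have pos_inv: "pos (inv pos k) = k" if "k \<in> {1..r + 1}" for k
    using bij that by (intro f_inv_into_f) (auto simp: bij_betw_def)

  \<comment> \<open>the dual chain runs backwards and starts at the last vector of the chain of \<open>V\<close>\<close>
  define pos' where "pos' i = r + 2 - pos i" for i
  define node' where "node' k = node (r + 1 - k)" for k
  have ch': "chain_rep r q node' pos' (dual_rep \<pi>) (\<lambda>k. - of_real q * e (r + 1 - k)) (\<lambda>k. - (f (r + 1 - k) / of_real q))"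
    unfolding pos'_def node'_def by (rule chain_rep_dual[OF ch q(1)])
  have inj': "inj pos'" using ch' by (simp add: chain_rep_def bij_betw_def)
  have inv': "inv pos' 1 = inv pos (r + 1)" "inv pos' (r + 1) = inv pos 1"
    by (rule inv_f_eq[OF inj'], simp add: pos'_def pos_inv)+
  have wt1': "ip r (simple_root (node' k)) ?om' = (if k = 1 then 1 else 0)" if "k \<in> {1..r}" for k
  proof -
    have k: "r + 1 - k \<in> {1..r}" using that by auto
    show ?thesis unfolding node'_def neg[OF k] wt2[OF k] using that by auto
  qed
  have wt2': "ip r (simple_root (node' k)) (w0 r ?om') = (if k = r then - 1 else 0)" if "k \<in> {1..r}" for k
  proof -
    have k: "r + 1 - k \<in> {1..r}" using that by auto
    show ?thesis unfolding node'_def w0w0 wt1[OF k] using that by auto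
  qed
  note hw = chain_highest_weight_vector[OF ch q(1) wt1]
  note lw = chain_lowest_weight_vector[OF ch q(1) wt2]
  note hw' = chain_highest_weight_vector[OF ch' q(1) wt1', unfolded inv']
  note lw' = chain_lowest_weight_vector[OF ch' q(1) wt2', unfolded inv']
  note sc = scaleR_vec

  have "RVV *v axis (inv pos 1, inv pos (r + 1)) 1 = qc (w - 1) *s axis (inv pos (r + 1), inv pos 1) 1"
    using RVV hw lw unfolding is_braiding_def sc tensor_vec_axis[symmetric] qc_def ip_fund_weight_w0[symmetric] by blast
  then have "RVV = hecke_R (qc (w - 1) * of_real q) (1 / of_real q) (\<lambda>i. int (pos i))"
    using RVV unfolding is_braiding_def by (intro chain_braiding_same[OF ch q(1) r]) blast+
  moreover have "qc (w - 1) * of_real q = qc w"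
    unfolding qc_1[symmetric] qc_add[symmetric] by simp
  ultimately have 1: "RVV = hecke_R (qc w) (1 / of_real q) (\<lambda>i. int (pos i))" by simp

  have "ip r ?om' (w0 r ?om') = w - 1"
    unfolding w0w0 ip_fund_weight_w0[symmetric] by (simp add: ip_def mult.commute sum_negf)
  then have "RDD *v axis (inv pos' 1, inv pos' (r + 1)) 1 = qc (w - 1) *s axis (inv pos' (r + 1), inv pos' 1) 1"
    using RDD hw' lw' unfolding is_braiding_def sc tensor_vec_axis[symmetric] qc_def inv' by metis
  then have "RDD = hecke_R (qc (w - 1) * of_real q) (1 / of_real q) (\<lambda>i. int (pos' i))"
    using RDD unfolding is_braiding_def by (intro chain_braiding_same[OF ch' q(1) r]) blast+
  also have "\<dots> = hecke_R (qc w) (1 / of_real q) (\<lambda>i. - int (pos i))"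
  proof -
    have ord: "int (pos' i) < int (pos' j) \<longleftrightarrow> - int (pos i) < - int (pos j)" for i j
      using p[of i] p[of j] by (auto simp: pos'_def)
    show ?thesis unfolding hecke_R_def ord \<open>qc (w - 1) * of_real q = qc w\<close> ..
  qed
  finally have 2: "RDD = hecke_R (qc w) (1 / of_real q) (\<lambda>i. - int (pos i))" .

  have d: "qc (ip r (wt i) (two_rho r)) = of_real q ^ (r + 2) * (1 / of_real q) ^ (2 * pos i)" for i
  proof -
    have step: "wt i (node k) - wt i (node k + 1) = (if pos i = k then 1 else 0) - (if pos i = Suc k then 1 else 0)"
      if k: "k \<in> {1..r}" for k
    proof -
      have "\<pi> (Kgen (node k)) *v axis i 1 = (q powr ip r (simple_root (node k)) (wt i)) *\<^sub>R axis i 1"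
        using weight_basis[of i] node_range[OF k] unfolding weight_vector_def by blast
      then have "\<pi> (Kgen (node k)) $ i $ i = of_real (q powr ip r (simple_root (node k)) (wt i))"
        unfolding mult_axis[symmetric] by (simp add: of_real_def)
      moreover have "\<pi> (Kgen (node k)) $ i $ i = kx q k (pos i)"
        using ch k unfolding chain_rep_def by simp
      moreover have "kx q k (pos i) = of_real (q powr ((if pos i = k then 1 else 0) - (if pos i = Suc k then 1 else 0)))"
        using q by (simp add: kx_def powr_minus_divide)
      ultimately have "q powr ip r (simple_root (node k)) (wt i)
          = q powr ((if pos i = k then 1 else 0) - (if pos i = Suc k then 1 else 0))"
        by (simp only: of_real_eq_iff)
      then show ?thesis using q unfolding ip_simple_root[OF node_range[OF k]] by (simp add: powr_inj)
    qed
    have "ip r (wt i) (two_rho r) = (\<Sum>k = 1..r. real (node k) * (real r + 1 - real (node k)) * (wt i (node k) - wt i (node k + 1)))"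
      unfolding ip_two_rho by (rule sum.reindex_bij_betw[OF node_bij, symmetric])
    also have "\<dots> = (\<Sum>k = 1..r. (if k = pos i then real k * (real r + 1 - real k) else 0)
        - (if k = pos i - 1 then real k * (real r + 1 - real k) else 0))"
    proof (intro sum.cong refl)
      fix k assume k: "k \<in> {1..r}"
      have "real (node k) * (real r + 1 - real (node k)) = real k * (real r + 1 - real k)"
        using k by (auto simp: node_def of_nat_diff)
      moreover have "pos i = Suc k \<longleftrightarrow> k = pos i - 1" using p[of i] k by auto
      ultimately show "real (node k) * (real r + 1 - real (node k)) * (wt i (node k) - wt i (node k + 1))
        = (if k = pos i then real k * (real r + 1 - real k) else 0)
        - (if k = pos i - 1 then real k * (real r + 1 - real k) else 0)"
        unfolding step[OF k] by auto
    qed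
    also have "\<dots> = real (pos i) * (real r + 1 - real (pos i)) - real (pos i - 1) * (real r + 1 - real (pos i - 1))"
      unfolding sum_subtractf using p[of i] r by (cases "pos i = r + 1") (auto simp: sum.delta')
    also have "\<dots> = real (r + 2) - real (2 * pos i)"
      using p[of i] by (simp add: of_nat_diff algebra_simps)
    finally have "qc (ip r (wt i) (two_rho r)) = qc (real (r + 2)) * qc (- real (2 * pos i))"
      unfolding qc_add[symmetric] by simp
    then show ?thesis unfolding qc_minus qc_nat by (simp add: power_one_over)
  qed

  \<comment> \<open>\<open>f\<^sup>1\<close>, at the last position of the dual chain, is its lowest weight vector\<close>
  have "RVD *v axis (inv pos 1, inv pos 1) 1 = qc (- w) *s axis (inv pos 1, inv pos 1) 1"
  proof -
    have "ip r ?om (w0 r ?om') = - w" unfolding w0w0 w_def ..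
    then show ?thesis
      using RVD hw lw' unfolding is_braiding_def sc tensor_vec_axis[symmetric] qc_def by metis
  qed
  then have 3: "RVD = mixed_R (\<lambda>i. qc (ip r (wt i) (two_rho r))) (hecke_R (qc (- w)) (of_real q) (\<lambda>i. - int (pos i)))"
    using RVD q unfolding is_braiding_def
    by (intro chain_braiding_mixed[OF ch q(1) r _ _ d]) auto
  show thesis by (rule that[OF bij 1 2 3 d])
qed

end

section \<open>Products of families\<close>

definition shift2 :: "(nat \<Rightarrow> 'n) \<Rightarrow> nat \<Rightarrow> 'n" where
  "shift2 \<nu> = (\<lambda>i. \<nu> (i + 2))"

text \<open>
  Multiplication by the members of a family from one side is such a \<open>\<phi>\<close>. By the transport lemmas
  below, an identity at some legs of one factor holds at the corresponding legs of a product: at the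
  same ones after multiplication from the right (\<open>after\<close>), at those shifted by two after
  multiplication from the left (\<open>before\<close>).
\<close>

definition linear_family ::
  "(complex \<Rightarrow> 'x::ab_group_add \<Rightarrow> 'x) \<Rightarrow> (complex \<Rightarrow> 'y::ab_group_add \<Rightarrow> 'y) \<Rightarrow> ('a \<Rightarrow> 'x \<Rightarrow> 'y) \<Rightarrow> bool" where
  "linear_family sc sc' \<phi> \<longleftrightarrow>
    (\<forall>a x y. \<phi> a (x + y) = \<phi> a x + \<phi> a y) \<and> (\<forall>a b x. \<phi> a (sc b x) = sc' b (\<phi> a x))"

lemma linear_family_sum:
  assumes "linear_family sc sc' \<phi>"
  shows "\<phi> a (\<Sum>i\<in>I. x i) = (\<Sum>i\<in>I. \<phi> a (x i))"
proof -
  have add: "\<phi> a (x + y) = \<phi> a x + \<phi> a y" for x y using assms by (simp add: linear_family_def)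
  have "\<phi> a 0 = 0" using add[of 0 0] by simp
  then show ?thesis by (induction I rule: infinite_finite_induct) (simp_all add: add)
qed

definition before :: "('n \<times> 'n \<Rightarrow> 'x \<Rightarrow> 'y) \<Rightarrow> ((nat \<Rightarrow> 'n) \<Rightarrow> 'x) \<Rightarrow> (nat \<Rightarrow> 'n) \<Rightarrow> 'y" where
  "before \<phi> x \<nu> = \<phi> (\<nu> 0, \<nu> 1) (x (shift2 \<nu>))"

definition after :: "nat \<Rightarrow> ('n \<times> 'n \<Rightarrow> 'x \<Rightarrow> 'y) \<Rightarrow> ((nat \<Rightarrow> 'n) \<Rightarrow> 'x) \<Rightarrow> (nat \<Rightarrow> 'n) \<Rightarrow> 'y" where
  "after n \<phi> x \<nu> = \<phi> (\<nu> n, \<nu> (Suc n)) (x \<nu>)"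

lemma op_before:
  fixes \<phi> :: "'n::finite \<times> 'n \<Rightarrow> 'x::ab_group_add \<Rightarrow> 'y::ab_group_add"
  assumes "linear_family sc sc' \<phi>"
  shows "leg_op sc' (k + 2) K (before \<phi> x) = before \<phi> (leg_op sc k K x)"
proof
  fix \<nu> :: "nat \<Rightarrow> 'n"
  have "shift2 (\<nu>(Suc (Suc k) := a, Suc (Suc (Suc k)) := b)) = (shift2 \<nu>)(k := a, Suc k := b)" for a b
    by (auto simp: shift2_def fun_eq_iff)
  then show "leg_op sc' (k + 2) K (before \<phi> x) \<nu> = before \<phi> (leg_op sc k K x) \<nu>"
    using assms unfolding leg_op_def before_def linear_family_sum[OF assms]
    by (simp add: linear_family_def shift2_def[of \<nu>])
qed

lemma con_before:
  fixes \<phi> :: "'n::finite \<times> 'n \<Rightarrow> 'x::ab_group_add \<Rightarrow> 'y::ab_group_add"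
  assumes "linear_family sc sc' \<phi>"
  shows "contract sc' (k + 2) d (before \<phi> x) = before \<phi> (contract sc k d x)"
proof
  fix \<nu> :: "nat \<Rightarrow> 'n"
  have "shift2 (insert_pair (Suc (Suc k)) a \<nu>) = insert_pair k a (shift2 \<nu>)" for a
  proof
    fix l
    have "l - 2 + 2 = l" if "\<not> l < k + 2" using that by simp
    then show "shift2 (insert_pair (Suc (Suc k)) a \<nu>) l = insert_pair k a (shift2 \<nu>) l"
      by (simp add: shift2_def insert_pair_def)
  qed
  then show "contract sc' (k + 2) d (before \<phi> x) \<nu> = before \<phi> (contract sc k d x) \<nu>"
    using assms unfolding contract_def before_def linear_family_sum[OF assms]
    by (simp add: linear_family_def) (simp add: insert_pair_def)
qed

lemma op_after:
  assumes "linear_family sc sc' \<phi>" "k + 2 \<le> n"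
  shows "leg_op sc' k K (after n \<phi> x) = after n \<phi> (leg_op sc k K x)"
  using assms unfolding leg_op_def after_def linear_family_sum[OF assms(1)] fun_eq_iff
  by (simp add: linear_family_def)

lemma con_after:
  assumes "linear_family sc sc' \<phi>" "k \<le> n"
  shows "contract sc' k d (after (n + 2) \<phi> x) = after n \<phi> (contract sc k d x)"
  using assms unfolding contract_def after_def linear_family_sum[OF assms(1)] fun_eq_iff
  by (simp add: linear_family_def insert_pair_def)

definition fam2 :: "('n \<times> 'n \<Rightarrow> 'x) \<Rightarrow> (nat \<Rightarrow> 'n) \<Rightarrow> 'x" where
  "fam2 x \<nu> = x (\<nu> 0, \<nu> 1)"

definition fam4 :: "('n legs4 \<Rightarrow> 'x) \<Rightarrow> (nat \<Rightarrow> 'n) \<Rightarrow> 'x" where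
  "fam4 x \<nu> = x (\<nu> 0, \<nu> 1, \<nu> 2, \<nu> 3)"

lemma fam4_family_prod:
  "fam4 (family_prod m x y) = before (\<lambda>I. m (x I)) (fam2 y)"
  "fam4 (family_prod m x y) = after 2 (\<lambda>I b. m b (y I)) (fam2 x)"
  by (auto simp: fun_eq_iff fam4_def fam2_def before_def after_def shift2_def numeral_3_eq_3 numeral_2_eq_2)

lemma fam4_inject:
  fixes x y :: "'n legs4 \<Rightarrow> 'x"
  assumes "fam4 x = fam4 y"
  shows "x = y"
proof
  fix I :: "'n legs4"
  obtain i j k l where I: "I = (i, j, k, l)" by (cases I) auto
  from fun_cong[OF assms, of "\<lambda>n. if n = 0 then i else if n = 1 then j else if n = 2 then k else l"]
  show "x I = y I" by (simp add: I fam4_def)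
qed

context leg_space
begin

lemma leg_map_product: "leg_map sc (M ** L) x = leg_map sc M (leg_map sc L x)"
proof
  fix I
  have "leg_map sc (M ** L) x I = (\<Sum>J\<in>UNIV. \<Sum>K\<in>UNIV. sc (M $ I $ K * L $ K $ J) (x J))"
    unfolding leg_map_def matrix_matrix_mult_def by (simp add: scale_sum_left)
  also have "\<dots> = (\<Sum>K\<in>UNIV. \<Sum>J\<in>UNIV. sc (M $ I $ K * L $ K $ J) (x J))"
    by (rule sum.swap)
  also have "\<dots> = leg_map sc M (leg_map sc L x) I"
    unfolding leg_map_def by (simp add: scale_sum_right)
  finally show "leg_map sc (M ** L) x I = leg_map sc M (leg_map sc L x) I" .
qed

lemma fam4_leg12:
  fixes x :: "'n::finite legs4 \<Rightarrow> 'x"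
  shows "fam4 (leg_map sc (leg12 K) x) = op 0 K (fam4 x)"
proof
  fix \<nu> :: "nat \<Rightarrow> 'n"
  have "fam4 (leg_map sc (leg12 K) x) \<nu> = (\<Sum>a\<in>UNIV. \<Sum>b\<in>UNIV. \<Sum>c\<in>UNIV. \<Sum>d\<in>UNIV.
      if d = \<nu> 3 then if c = \<nu> 2 then sc (K $ (\<nu> 0, \<nu> 1) $ (a, b)) (x (a, b, c, d)) else 0 else 0)"
    unfolding fam4_def leg_map_def leg12_def sum_UNIV_pair by (intro sum.cong refl) auto
  also have "\<dots> = op 0 K (fam4 x) \<nu>"
    unfolding op_eq_sum by (simp add: fam4_def)
  finally show "fam4 (leg_map sc (leg12 K) x) \<nu> = op 0 K (fam4 x) \<nu>" .
qed

lemma fam4_leg23: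
  fixes x :: "'n::finite legs4 \<Rightarrow> 'x"
  shows "fam4 (leg_map sc (leg23 K) x) = op 1 K (fam4 x)"
proof
  fix \<nu> :: "nat \<Rightarrow> 'n"
  have "fam4 (leg_map sc (leg23 K) x) \<nu> = (\<Sum>a\<in>UNIV. \<Sum>b\<in>UNIV. \<Sum>c\<in>UNIV. \<Sum>d\<in>UNIV.
      if d = \<nu> 3 then if a = \<nu> 0 then sc (K $ (\<nu> 1, \<nu> 2) $ (b, c)) (x (a, b, c, d)) else 0 else 0)"
    unfolding fam4_def leg_map_def leg23_def sum_UNIV_pair by (intro sum.cong refl) auto
  also have "\<dots> = (\<Sum>a\<in>UNIV. if a = \<nu> 0 then \<Sum>b\<in>UNIV. \<Sum>c\<in>UNIV. sc (K $ (\<nu> 1, \<nu> 2) $ (b, c)) (x (a, b, c, \<nu> 3)) else 0)"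
    by (intro sum.cong refl) auto
  also have "\<dots> = op 1 K (fam4 x) \<nu>"
    unfolding op_eq_sum by (simp add: fam4_def numeral_2_eq_2 numeral_3_eq_3)
  finally show "fam4 (leg_map sc (leg23 K) x) \<nu> = op 1 K (fam4 x) \<nu>" .
qed

lemma fam4_leg34:
  fixes x :: "'n::finite legs4 \<Rightarrow> 'x"
  shows "fam4 (leg_map sc (leg34 K) x) = op 2 K (fam4 x)"
proof
  fix \<nu> :: "nat \<Rightarrow> 'n"
  have push: "(\<Sum>c\<in>UNIV. \<Sum>d\<in>UNIV. if P then f c d else 0)
      = (if P then \<Sum>c\<in>UNIV. \<Sum>d\<in>UNIV. f c d else 0)" for P and f :: "'n \<Rightarrow> 'n \<Rightarrow> 'x"
    by simp
  have "fam4 (leg_map sc (leg34 K) x) \<nu> = (\<Sum>a\<in>UNIV. \<Sum>b\<in>UNIV. \<Sum>c\<in>UNIV. \<Sum>d\<in>UNIV.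
      if a = \<nu> 0 then if b = \<nu> 1 then sc (K $ (\<nu> 2, \<nu> 3) $ (c, d)) (x (a, b, c, d)) else 0 else 0)"
    unfolding fam4_def leg_map_def leg34_def sum_UNIV_pair by (intro sum.cong refl) auto
  also have "\<dots> = (\<Sum>a\<in>UNIV. if a = \<nu> 0 then \<Sum>b\<in>UNIV. if b = \<nu> 1 then
      \<Sum>c\<in>UNIV. \<Sum>d\<in>UNIV. sc (K $ (\<nu> 2, \<nu> 3) $ (c, d)) (x (a, b, c, d)) else 0 else 0)"
    unfolding push by (intro sum.cong refl) auto
  also have "\<dots> = op 2 K (fam4 x) \<nu>"
    unfolding op_eq_sum by (simp add: fam4_def numeral_2_eq_2 numeral_3_eq_3)
  finally show "fam4 (leg_map sc (leg34 K) x) \<nu> = op 2 K (fam4 x) \<nu>" .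
qed

lemma E12'_eq_contract:
  assumes "\<And>i. complex_of_real (q powr ip r (wt i) (two_rho r)) = d i"
  shows "E12' r q wt sc y = con 0 d (fam2 y) \<nu>"
proof -
  have "E12' r q wt sc y = (\<Sum>i\<in>UNIV. \<Sum>j\<in>UNIV. if j = i then sc (d i) (y (i, j)) else 0)"
    unfolding E12'_def assms by (intro sum.cong refl) auto
  then show ?thesis by (simp add: contract_def fam2_def insert_pair_def)
qed

lemma E23_eq_contract:
  fixes x :: "'n::finite legs4 \<Rightarrow> 'x"
  shows "fam2 (E23 sc x) = con 1 (\<lambda>i. 1) (fam4 x)"
proof
  fix \<nu> :: "nat \<Rightarrow> 'n"
  have "fam2 (E23 sc x) \<nu> = (\<Sum>i\<in>UNIV. \<Sum>j\<in>UNIV. if j = i then x (\<nu> 0, i, j, \<nu> 1) else 0)"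
    unfolding fam2_def E23_def case_prod_conv by (intro sum.cong refl) auto
  then show "fam2 (E23 sc x) \<nu> = con 1 (\<lambda>i. 1) (fam4 x) \<nu>"
    by (simp add: contract_def fam4_def insert_pair_def)
qed

end

lemma matrix_inv_unique:
  fixes M :: "complex^'n^'n"
  assumes "M ** L = mat 1" "L ** M = mat 1"
  shows "matrix_inv M = L"
proof -
  have "\<exists>L. M ** L = mat 1 \<and> L ** M = mat 1" using assms by blast
  from someI_ex[OF this] have "M ** matrix_inv M = mat 1" unfolding matrix_inv_def by blast
  then have "L ** (M ** matrix_inv M) = L" by simp
  then show ?thesis by (simp add: matrix_mul_assoc assms(2))
qed

lemma leg_space_complex: "leg_space ((*) :: complex \<Rightarrow> complex \<Rightarrow> complex)"
  by unfold_locales (simp_all add: algebra_simps)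

lemma matrix_eq_of_leg_map:
  fixes M :: "complex^'j::finite^'i"
  assumes "leg_map (*) M = leg_map (*) L"
  shows "M = L"
proof -
  have "leg_map (*) M (\<lambda>K. if K = J then 1 else 0) I = M $ I $ J" for M :: "complex^'j^'i" and I J
    unfolding leg_map_def by (simp add: if_distrib cong: if_cong)
  then show ?thesis using assms by (metis vec_eq_iff)
qed

lemma (in braided_legs) fam4_S:
  "fam4 (leg_map sc (leg23 A ** leg12 K ** leg23 Ai) x) = S K 0 (fam4 x)"
  unfolding leg_map_product fam4_leg12 fam4_leg23 S_def by simp

lemma (in braided_legs) fam4_T:
  "fam4 (leg_map sc (leg23 A ** leg34 K ** leg23 Ai) x) = T K 1 (fam4 x)"
  unfolding leg_map_product fam4_leg34 fam4_leg23 T_def by (simp add: numeral_2_eq_2)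

context hecke_data
begin

text \<open>
  The matrices of the maps on four legs are invertible because the operators are, in the case of
  complex coefficients.
\<close>

lemma leg_inverse:
  "matrix_inv (leg23 A ** leg12 G ** leg23 Ai) = leg23 A ** leg12 Gi ** leg23 Ai"
  "matrix_inv (leg23 A ** leg34 Hi ** leg23 Ai) = leg23 A ** leg34 H ** leg23 Ai"
proof -
  interpret C: braided_legs pos N u z D "(*) :: complex \<Rightarrow> complex \<Rightarrow> complex"
    by (intro braided_legs.intro hecke_data_axioms leg_space_complex)
  have one: "leg_map (*) (mat 1 :: complex^('n legs4)^('n legs4)) x = x" for x
    unfolding leg_map_def mat_def by (simp add: fun_eq_iff if_distrib[of "\<lambda>y. y * _"] cong: if_cong)
  show "matrix_inv (leg23 A ** leg12 G ** leg23 Ai) = leg23 A ** leg12 Gi ** leg23 Ai"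
    by (rule matrix_inv_unique; rule matrix_eq_of_leg_map; rule ext; rule fam4_inject)
      (simp_all only: C.leg_map_product[of "_ ** _" "_ ** _"] C.fam4_S C.S_inverse one)
  show "matrix_inv (leg23 A ** leg34 Hi ** leg23 Ai) = leg23 A ** leg34 H ** leg23 Ai"
    by (rule matrix_inv_unique; rule matrix_eq_of_leg_map; rule ext; rule fam4_inject)
      (simp_all only: C.leg_map_product[of "_ ** _" "_ ** _"] C.fam4_T C.T_inverse one)
qed

end

section \<open>Evaluation in presented objects\<close>

lemma free_eval_superset:
  assumes "complex_algebra \<iota>" "finite U" "Poly_Mapping.keys f \<subseteq> U"
  shows "free_eval \<iota> x f = (\<Sum>u\<in>U. \<iota> (Poly_Mapping.lookup f u) * prod_list (map x u))"
proof -
  have "\<iota> (0 + 0) = \<iota> 0 + \<iota> 0" using assms(1) unfolding complex_algebra_def by blast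
  then have "\<iota> 0 = 0" by simp
  then show ?thesis unfolding free_eval_def using assms(2,3)
    by (intro sum.mono_neutral_left) (auto simp: in_keys_iff)
qed

lemma free_eval_add:
  assumes "complex_algebra \<iota>"
  shows "free_eval \<iota> x (f + g) = free_eval \<iota> x f + free_eval \<iota> x g"
proof -
  let ?U = "Poly_Mapping.keys f \<union> Poly_Mapping.keys g"
  have add: "\<iota> (c + e) = \<iota> c + \<iota> e" for c e using assms unfolding complex_algebra_def by blast
  have "Poly_Mapping.keys (f + g) \<subseteq> ?U" by (rule Poly_Mapping.keys_add)
  then show ?thesis
    by (simp add: free_eval_superset[OF assms, where U = ?U] lookup_add add distrib_right sum.distrib)
qed

lemma free_eval_diff:
  assumes "complex_algebra \<iota>"
  shows "free_eval \<iota> x (f - g) = free_eval \<iota> x f - free_eval \<iota> x g"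
  using free_eval_add[OF assms, of x "f - g" g] by simp

lemma free_eval_sum:
  assumes "complex_algebra \<iota>"
  shows "free_eval \<iota> x (\<Sum>i\<in>I. f i) = (\<Sum>i\<in>I. free_eval \<iota> x (f i))"
  by (induction I rule: infinite_finite_induct) (simp_all add: free_eval_add[OF assms], simp_all add: free_eval_def)

lemma free_eval_single: 
  assumes "complex_algebra \<iota>"
  shows "free_eval \<iota> x (Poly_Mapping.single u c) = \<iota> c * prod_list (map x u)"
  using free_eval_superset[OF assms, of "{u}" "Poly_Mapping.single u c" x] by simp

lemma free_eval_monomial:
  assumes "complex_algebra \<iota>"
  shows "free_eval \<iota> x (free_scalar c) = \<iota> c"
    "free_eval \<iota> x (free_scalar c * free_gen g) = \<iota> c * x g"
    "free_eval \<iota> x (free_scalar c * (free_gen g * free_gen h)) = \<iota> c * (x g * x h)"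
  unfolding free_scalar_def free_gen_def mult_single free_eval_single[OF assms]
  by (simp_all add: plus_list_def)

lemma module_eval_linear:
  fixes la :: "'b::ring_1 \<Rightarrow> 'x::ab_group_add \<Rightarrow> 'x" and x :: "'g::finite \<Rightarrow> 'x"
  assumes "\<And>b c x. la (b + c) x = la b x + la c x" "\<And>b c x. la (b * c) x = la b (la c x)"
    "\<And>b x y. la b (x + y) = la b x + la b y" "\<And>x. la 1 x = x"
  shows "module_eval la x (f + f') = module_eval la x f + module_eval la x f'"
    "module_eval la x (f - f') = module_eval la x f - module_eval la x f'"
    "module_eval la x (\<Sum>i\<in>I. F i) = (\<Sum>i\<in>I. module_eval la x (F i))"
    "module_eval la x (b *s f) = la b (module_eval la x f)"
    "module_eval la x (axis g 1) = x g"
proof -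
  have z: "la b 0 = 0" "la 0 y = 0" for b y using assms(1)[of 0 0] assms(3)[of b 0 0] by simp_all
  show add: "module_eval la x (f + f') = module_eval la x f + module_eval la x f'" for f f'
    by (simp add: module_eval_def assms(1) sum.distrib)
  show "module_eval la x (f - f') = module_eval la x f - module_eval la x f'"
    using add[of "f - f'" f'] by simp
  have zero: "module_eval la x 0 = 0" by (simp add: module_eval_def z)
  show "module_eval la x (\<Sum>i\<in>I. F i) = (\<Sum>i\<in>I. module_eval la x (F i))"
    by (induction I rule: infinite_finite_induct) (simp_all add: zero add)
  have sum: "la b (\<Sum>i\<in>I. h i) = (\<Sum>i\<in>I. la b (h i))" for h :: "_ \<Rightarrow> 'x" and I
    by (induction I rule: infinite_finite_induct) (simp_all add: z assms(3))
  show "module_eval la x (b *s f) = la b (module_eval la x f)"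
    by (simp add: module_eval_def sum assms(2))
  have "module_eval la x (axis g 1) = (\<Sum>h\<in>UNIV. if h = g then x g else 0)"
    unfolding module_eval_def by (intro sum.cong refl) (auto simp: axis_def assms(4) z)
  then show "module_eval la x (axis g 1) = x g" by simp
qed

text \<open>
  The balancing relations hold in the tensor square because evaluation of formal combinations is
  additive, which takes the following facts on integer multiples.
\<close>

lemma int_multiple_difference: "int_multiple (int a - int b) x = (\<Sum>i<a. x) - (\<Sum>i<b. x)"
proof -
  have split: "(\<Sum>i<a + b. x) = (\<Sum>i<a. x) + (\<Sum>i<b. x)" for a b :: nat
    by (induction b) (simp_all add: add.assoc)
  show ?thesis
  proof (cases "b \<le> a")
    case True
    then have "nat (int a - int b) = a - b" "nat (int b - int a) = 0" by linarith+
    then show ?thesis using True split[of "a - b" b] by (simp add: int_multiple_def)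
  next
    case False
    then have "nat (int a - int b) = 0" "nat (int b - int a) = b - a" by linarith+
    then show ?thesis using False split[of "b - a" a] by (simp add: int_multiple_def)
  qed
qed

lemma int_multiple_add: "int_multiple (k + l) x = int_multiple k x + int_multiple l x"
proof -
  obtain a b c d where kl: "k = int a - int b" "l = int c - int d" by (metis int_diff_cases)
  have split: "(\<Sum>i<a + b. x) = (\<Sum>i<a. x) + (\<Sum>i<b. x)" for a b :: nat
    by (induction b) (simp_all add: add.assoc)
  have "k + l = int (a + c) - int (b + d)" by (simp add: kl)
  then show ?thesis unfolding kl int_multiple_difference by (simp only: int_multiple_difference split) simp
qed

lemma frag_eval_superset:
  assumes "finite U" "Poly_Mapping.keys z \<subseteq> U"
  shows "frag_eval f z = (\<Sum>u\<in>U. int_multiple (Poly_Mapping.lookup z u) (f u))"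
  unfolding frag_eval_def using assms
  by (intro sum.mono_neutral_left) (auto simp: in_keys_iff int_multiple_def)

lemma frag_eval_add: "frag_eval f (y + z) = frag_eval f y + frag_eval f z"
proof -
  let ?U = "Poly_Mapping.keys y \<union> Poly_Mapping.keys z"
  have "Poly_Mapping.keys (y + z) \<subseteq> ?U" by (rule Poly_Mapping.keys_add)
  then show ?thesis
    by (simp add: frag_eval_superset[where U = ?U] lookup_add int_multiple_add sum.distrib)
qed

lemma frag_eval_diff: "frag_eval f (y - z) = frag_eval f y - frag_eval f z"
  using frag_eval_add[of f "y - z" z] by simp

lemma frag_eval_frag_of: "frag_eval f (frag_of a) = f a"
  using frag_eval_superset[of "{a}" "frag_of a" f] by (simp add: int_multiple_def)

lemma additive_span_base: "x \<in> X \<Longrightarrow> x \<in> additive_span X"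
  using additive_span.add[OF _ additive_span.zero] by fastforce

lemma tensor_square_balanced:
  assumes "tensor_square \<iota> la ra lt rt tens"
  shows "tens (x + x') y = tens x y + tens x' y" "tens x (y + y') = tens x y + tens x y'"
    "tens (ra x b) y = tens x (la b y)"
proof -
  have 0: "frag_eval (\<lambda>(x, y). tens x y) z = 0" if "z \<in> balanced_relators la ra" for z
    using assms additive_span_base[OF that] unfolding tensor_square_def by blast
  have "frag_eval (\<lambda>(x, y). tens x y) (frag_of (x + x', y) - frag_of (x, y) - frag_of (x', y)) = 0"
    by (rule 0) (unfold balanced_relators_def, blast)
  then show "tens (x + x') y = tens x y + tens x' y"
    unfolding frag_eval_diff frag_eval_frag_of by (simp add: algebra_simps)
  have "frag_eval (\<lambda>(x, y). tens x y) (frag_of (x, y + y') - frag_of (x, y) - frag_of (x, y')) = 0"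
    by (rule 0) (unfold balanced_relators_def, blast)
  then show "tens x (y + y') = tens x y + tens x y'"
    unfolding frag_eval_diff frag_eval_frag_of by (simp add: algebra_simps)
  have "frag_eval (\<lambda>(x, y). tens x y) (frag_of (ra x b, y) - frag_of (x, la b y)) = 0"
    by (rule 0) (unfold balanced_relators_def, blast)
  then show "tens (ra x b) y = tens x (la b y)"
    unfolding frag_eval_diff frag_eval_frag_of by simp
qed

section \<open>The quantum projective space in an ordered weight basis\<close>

locale ordered_space_data = projective_space_data r s q \<pi> wt RVV RVD RDD
  for r s q and \<pi> :: "uq_gen \<Rightarrow> complex^'n^'n" and wt RVV RVD RDD +
  fixes pos :: "'n \<Rightarrow> nat"
  assumes pos: "bij_betw pos UNIV {1..r + 1}"
    and RVV_eq: "RVV = hecke_R (qc w) (1 / of_real q) (\<lambda>i. int (pos i))"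
    and RDD_eq: "RDD = hecke_R (qc w) (1 / of_real q) (\<lambda>i. - int (pos i))"
    and RVD_eq: "RVD = mixed_R (\<lambda>i. qc (ip r (wt i) (two_rho r)))
      (hecke_R (qc (- w)) (of_real q) (\<lambda>i. - int (pos i)))"
    and qdim: "qc (ip r (wt i) (two_rho r)) = of_real q ^ (r + 2) * (1 / of_real q) ^ (2 * pos i)"
begin

definition zq :: complex where "zq = 1 / of_real q"
definition Dq :: complex where "Dq = of_real q ^ (r + 2)"

sublocale hd: hecke_data pos "r + 1" "qc w" zq Dq
  by unfold_locales (use pos qc_nz q in \<open>simp_all add: zq_def Dq_def\<close>)

lemma hd_d: "qc (ip r (wt i) (two_rho r)) = hd.d i"
  unfolding qdim hd.d_def by (simp only: zq_def Dq_def)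

lemma hd_braidings: "RVV = hd.G" "RDD = hd.H" "RVD = hd.A" "matrix_inv RVD = hd.Ai" "matrix_inv RDD = hd.Hi"
proof -
  show 1: "RVV = hd.G" "RDD = hd.H" unfolding hd.G_def hd.H_def by (unfold zq_def, rule RVV_eq, rule RDD_eq)
  show 2: "RVD = hd.A"
    unfolding hd.A_def hd.Gi_def RVD_eq hd_d qc_minus by (simp add: zq_def)
  show "matrix_inv RVD = hd.Ai" unfolding hd.Ai_def 2 ..
  show "matrix_inv RDD = hd.Hi" unfolding 1 by (rule matrix_inv_unique[OF hd.inverses(3,4)])
qed

lemma hd_S: "S = leg23 hd.A ** leg12 hd.G ** leg23 hd.Ai" "matrix_inv S = leg23 hd.A ** leg12 hd.Gi ** leg23 hd.Ai"
proof -
  have "S = leg23 RVD ** leg12 RVV ** leg23 (matrix_inv RVD)" by (rule S_def)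
  also have "\<dots> = leg23 hd.A ** leg12 hd.G ** leg23 hd.Ai" by (simp only: hd_braidings(4,5)) (simp only: hd_braidings(1-3))
  finally show S: "S = leg23 hd.A ** leg12 hd.G ** leg23 hd.Ai" .
  show "matrix_inv S = leg23 hd.A ** leg12 hd.Gi ** leg23 hd.Ai"
    by (rule trans[OF arg_cong[where f = matrix_inv, OF S] hd.leg_inverse(1)])
qed

lemma hd_St: "St = leg23 hd.A ** leg34 hd.Hi ** leg23 hd.Ai" "matrix_inv St = leg23 hd.A ** leg34 hd.H ** leg23 hd.Ai"
proof -
  have "St = leg23 RVD ** leg34 (matrix_inv RDD) ** leg23 (matrix_inv RVD)" by (rule St_def)
  also have "\<dots> = leg23 hd.A ** leg34 hd.Hi ** leg23 hd.Ai" by (simp only: hd_braidings(4,5)) (simp only: hd_braidings(1-3))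
  finally show St: "St = leg23 hd.A ** leg34 hd.Hi ** leg23 hd.Ai" .
  show "matrix_inv St = leg23 hd.A ** leg34 hd.H ** leg23 hd.Ai"
    by (rule trans[OF arg_cong[where f = matrix_inv, OF St] hd.leg_inverse(2)])
qed

lemma hd_c: "hd.c = qc (w + m)"
proof -
  have "x ^ (r + 2) * (1 / x)\<^sup>2 = x ^ r" if "x \<noteq> 0" for x :: complex
  proof -
    have "x\<^sup>2 * (1 / x)\<^sup>2 = 1" using that by (simp only: power_mult_distrib[symmetric]) simp
    then show ?thesis by (simp only: power_add mult.assoc mult_1_right)
  qed
  from this[of "of_real q"] have "Dq * zq\<^sup>2 = of_real q ^ r"
    unfolding zq_def Dq_def using q(1) by simp
  then have "hd.c = qc w * of_real q ^ r" by (simp only: hd.c_def mult.assoc)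
  also have "\<dots> = qc (w + m)" by (simp only: qc_add m_eq qc_nat)
  finally show ?thesis .
qed

text \<open>
  The coefficients of the quadratic relations of \<open>S\<close> and \<open>T\<close> in terms of powers of \<open>q\<close>.
\<close>

lemma hd_uz: "qc w * qc w * zq * zq = qc (2 * w - a)"
    "qc w * (1 - zq * zq) = qc w - qc (w - a)"
    "1 / qc w * (1 - 1 / (zq * zq)) = qc (- w) - qc (a - w)"
proof -
  have a: "qc a = of_real q * of_real q" "qc (- a) = zq * zq"
    unfolding zq_def qc_minus a_eq using qc_nat[of 2] by (simp_all add: power2_eq_square)
  have y: "1 / (zq * zq) = qc a" unfolding a zq_def by simp
  have "qc (2 * w - a) = qc w * qc w * qc (- a)"
    using qc_add[of "2 * w" "- a"] qc_add[of w w] by (simp only: diff_conv_add_uminus mult_2)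
  then show "qc w * qc w * zq * zq = qc (2 * w - a)" unfolding a(2) by (simp only: mult.assoc)
  have "qc (w - a) = qc w * qc (- a)"
    using qc_add[of w "- a"] by (simp only: diff_conv_add_uminus)
  then show "qc w * (1 - zq * zq) = qc w - qc (w - a)"
    unfolding a(2) by (simp only: right_diff_distrib mult_1_right)
  have "qc (a - w) = qc (- w) * qc a"
    using qc_add[of "- w" a] by (simp only: diff_conv_add_uminus add.commute)
  then show "1 / qc w * (1 - 1 / (zq * zq)) = qc (- w) - qc (a - w)"
    unfolding y qc_minus[symmetric] by (simp only: right_diff_distrib mult_1_right)
qed

end

locale ordered_calculus =
  heckenberger_kolb_calculus r s q \<pi> wt RVV RVD RDD \<iota> p lo ro \<Omega>p \<Omega>m dp dbp lt rt tens
  + ordered_space_data r s q \<pi> wt RVV RVD RDD pos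
  for r s q and \<pi> :: "uq_gen \<Rightarrow> complex^'n^'n" and wt RVV RVD RDD
    and \<iota> :: "complex \<Rightarrow> 'b::ring_1" and p
    and lo :: "'b \<Rightarrow> 'o::ab_group_add \<Rightarrow> 'o" and ro \<Omega>p \<Omega>m dp dbp
    and lt :: "'b \<Rightarrow> 't::ab_group_add \<Rightarrow> 't" and rt tens and pos
begin

lemma complex_alg: "complex_algebra \<iota>" using algebra by (simp add: presented_algebra_def)

lemma iota: "\<iota> 1 = 1" "\<iota> (c + e) = \<iota> c + \<iota> e" "\<iota> (c * e) = \<iota> c * \<iota> e" "\<iota> c * b = b * \<iota> c"
  using complex_alg unfolding complex_algebra_def by blast+

lemma lo: "lo b (x + y) = lo b x + lo b y" "lo (b + b') x = lo b x + lo b' x"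
    "lo (b * b') x = lo b (lo b' x)" "lo 1 x = x"
  using bimodule unfolding bimodule_def by simp_all

lemma ro: "ro (x + y) b = ro x b + ro y b" "ro x (b + b') = ro x b + ro x b'"
    "ro x (b * b') = ro (ro x b) b'" "ro x 1 = x"
  using bimodule unfolding bimodule_def by blast+

lemma lro: "ro (lo b x) b' = lo b (ro x b')" "lo (\<iota> c) x = ro x (\<iota> c)"
  using bimodule unfolding bimodule_def by blast+

lemma bimod_t: "bimodule \<iota> lt rt" using tensor by (simp add: tensor_square_def)

lemma lt: "lt b (x + y) = lt b x + lt b y" "lt (b + b') x = lt b x + lt b' x"
    "lt (b * b') x = lt b (lt b' x)" "lt 1 x = x"
  using bimod_t unfolding bimodule_def by simp_all

lemma rt: "rt (x + y) b = rt x b + rt y b"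
  using bimod_t unfolding bimodule_def by blast+

lemma lrt: "rt (lt b x) b' = lt b (rt x b')"
  using bimod_t unfolding bimodule_def by blast+

lemma tens_lr: "lt b (tens x y) = tens (lo b x) y" "rt (tens x y) b = tens x (ro y b)"
  using tensor unfolding tensor_square_def by blast+

lemmas tens = tensor_square_balanced[OF tensor]

sublocale BL: braided_legs pos "r + 1" "qc w" zq Dq "\<lambda>c x. \<iota> c * x"
  by (intro braided_legs.intro hd.hecke_data_axioms leg_space.intro module.intro)
    (simp_all add: iota(1-3) distrib_left distrib_right mult.assoc)

sublocale OL: braided_legs pos "r + 1" "qc w" zq Dq "\<lambda>c x. lo (\<iota> c) x"
  by (intro braided_legs.intro hd.hecke_data_axioms leg_space.intro module.intro)
    (simp_all add: iota(1-3) lo)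

sublocale TL: braided_legs pos "r + 1" "qc w" zq Dq "\<lambda>c x. lt (\<iota> c) x"
  by (intro braided_legs.intro hd.hecke_data_axioms leg_space.intro module.intro)
    (simp_all add: iota(1-3) lt)

abbreviation "scB \<equiv> \<lambda>c x. \<iota> c * x"
abbreviation "scO \<equiv> \<lambda>c x. lo (\<iota> c) x"
abbreviation "scT \<equiv> \<lambda>c x. lt (\<iota> c) x"

lemma lin_mult_right: "linear_family scB scB (\<lambda>a x. x * f a)"
  and lin_lo: "linear_family scO scO (\<lambda>a. lo (f a))"
  and lin_lo_arg: "linear_family scB scO (\<lambda>a x. lo x (g a))"
  and lin_tens: "linear_family scO scT (\<lambda>a x. tens (g a) x)"
  and lin_tens_arg: "linear_family scO scT (\<lambda>a x. tens x (g a))"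
  and lin_lt: "linear_family scT scT (\<lambda>a. lt (f a))"
  and lin_rt: "linear_family scT scT (\<lambda>a x. rt x (f a))"
  and lin_lt_arg: "linear_family scB scT (\<lambda>a x. lt x (h a))"
proof -
  show "linear_family scB scB (\<lambda>a x. x * f a)"
    unfolding linear_family_def by (simp only: distrib_right mult.assoc; simp)
  show "linear_family scO scO (\<lambda>a. lo (f a))"
    unfolding linear_family_def by (simp only: lo(1) lo(3)[symmetric] iota(4); simp)
  show "linear_family scB scO (\<lambda>a x. lo x (g a))"
    unfolding linear_family_def by (simp only: lo(2,3); simp)
  show "linear_family scO scT (\<lambda>a x. tens (g a) x)"
    unfolding linear_family_def by (simp only: tens(2) tens(3)[symmetric] lro(2)[symmetric] tens_lr(1); simp)
  show "linear_family scO scT (\<lambda>a x. tens x (g a))"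
    unfolding linear_family_def by (simp only: tens(1) tens_lr(1); simp)
  show "linear_family scT scT (\<lambda>a. lt (f a))"
    unfolding linear_family_def by (simp only: lt(1) lt(3)[symmetric] iota(4); simp)
  show "linear_family scT scT (\<lambda>a x. rt x (f a))"
    unfolding linear_family_def by (simp only: rt lrt; simp)
  show "linear_family scB scT (\<lambda>a x. lt x (h a))"
    unfolding linear_family_def by (simp only: lt(2,3); simp)
qed

section \<open>The defining relations as identities of leg families\<close>

text \<open>
  The names list the factors of a product: \<open>p\<close> for the family \<open>p\<close>, and \<open>d\<close> or \<open>x\<close> for a family of
  one-forms. A product can be read as multiplication from the right, as defined here, or from the left,
  as in the equations \<open>pd_alt\<close>, \<open>dxp_alt\<close> and \<open>xx_alt\<close>. With the first reading a relation for the left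
  factor can be applied to the product, with the second one a relation for the right factor.
\<close>

definition "pp = after 2 (\<lambda>I x. x * p I) (fam2 p)"
definition "pd x = after 2 (\<lambda>I b. lo b (x I)) (fam2 p)"
definition "dxp x = after 2 (\<lambda>I y. ro y (p I)) (fam2 x)"
definition "xx x y = after 2 (\<lambda>I v. tens v (y I)) (fam2 x)"

lemma pd_alt: "pd x = before (\<lambda>I. lo (p I)) (fam2 x)"
  and dxp_alt: "dxp x = before (\<lambda>I b. ro (x I) b) (fam2 p)"
  and xx_alt: "xx x y = before (\<lambda>I. tens (x I)) (fam2 y)"
  unfolding pd_def dxp_def xx_def by (rule fam4_family_prod(2)[symmetric, THEN trans, OF fam4_family_prod(1)])+

lemma fam4_prod:
  "fam4 (family_prod (*) p p) = pp" "fam4 (family_prod lo p x) = pd x" "fam4 (family_prod ro x p) = dxp x"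
  "fam4 (family_prod tens x y) = xx x y"
  unfolding pp_def pd_def dxp_def xx_def by (rule fam4_family_prod(2))+

lemma fam4_smul: "fam4 (\<lambda>I. f (x I)) = (\<lambda>\<nu>. f (fam4 x \<nu>))"
  by (simp add: fam4_def fun_eq_iff)

lemma BL_S: "fam4 (leg_map scB S x) = BL.S hd.G 0 (fam4 x)"
  and BL_T: "fam4 (leg_map scB St x) = BL.T hd.Hi 1 (fam4 x)"
  and OL_S: "fam4 (leg_map scO S y) = OL.S hd.G 0 (fam4 y)"
  and OL_T: "fam4 (leg_map scO St y) = OL.T hd.Hi 1 (fam4 y)"
  and TL_S: "fam4 (leg_map scT S v) = TL.S hd.G 0 (fam4 v)"
  and TL_T: "fam4 (leg_map scT St v) = TL.T hd.Hi 1 (fam4 v)"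
  unfolding hd_S(1) hd_St(1) by (rule BL.fam4_S BL.fam4_T OL.fam4_S OL.fam4_T TL.fam4_S TL.fam4_T)+

lemma TL_S': "fam4 (leg_map scT (matrix_inv S) v) = TL.S hd.Gi 0 (fam4 v)"
  and TL_T': "fam4 (leg_map scT (matrix_inv St) v) = TL.T hd.H 1 (fam4 v)"
  unfolding hd_S(2) hd_St(2) by (rule TL.fam4_S TL.fam4_T)+

lemma two_sided_ideal_relator: "x \<in> X \<Longrightarrow> x \<in> two_sided_ideal X"
  using two_sided_ideal.step[OF _ two_sided_ideal.zero, of x X 1 1] by simp

lemma left_submodule_relator: "x \<in> X \<Longrightarrow> x \<in> left_submodule X"
  using left_submodule.step[OF _ left_submodule.zero, of x X 1] by simp

lemma relation_algebra:
  assumes "f \<in> algebra_relators" shows "free_eval \<iota> p f = 0"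
  using algebra two_sided_ideal_relator[OF assms] unfolding presented_algebra_def by blast

lemma free_eval_pp: "free_eval \<iota> p (free_scalar c * family_prod (*) free_gen free_gen I) = \<iota> c * family_prod (*) p p I"
  by (cases I) (simp add: free_eval_monomial[OF complex_alg])

lemma pp_rel:
  assumes "M = S \<and> c = qc w \<or> M = St \<and> c = qc (- w)"
  shows "leg_map scB M (family_prod (*) p p) = (\<lambda>I. \<iota> c * family_prod (*) p p I)"
proof
  fix I
  let ?ff = "family_prod (*) free_gen free_gen" and ?sc = "\<lambda>c x. free_scalar c * x"
  have "leg_map ?sc M ?ff I - ?sc c (?ff I) \<in> algebra_relators"
    unfolding algebra_relators_def eigen_relators_def Let_def using assms by auto
  then have "free_eval \<iota> p (leg_map ?sc M ?ff I - ?sc c (?ff I)) = 0" by (rule relation_algebra)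
  then show "leg_map scB M (family_prod (*) p p) I = \<iota> c * family_prod (*) p p I"
    unfolding free_eval_diff[OF complex_alg] leg_map_def free_eval_sum[OF complex_alg] free_eval_pp by simp
qed

lemma pp_S: "BL.S hd.G 0 pp = BL.smul (qc w) pp"
  using arg_cong[OF pp_rel[of S "qc w"], of fam4] unfolding BL_S fam4_prod fam4_smul by simp

lemma pp_T: "BL.T hd.Hi 1 pp = BL.smul (qc (- w)) pp"
  using arg_cong[OF pp_rel[of St "qc (- w)"], of fam4] unfolding BL_T fam4_prod fam4_smul by simp

lemma p_trace: "BL.con 0 hd.d (fam2 p) = (\<lambda>\<nu>. \<iota> (qc m))"
proof
  fix \<nu>
  let ?sc = "\<lambda>c x. free_scalar c * x"
  have "E12' r q wt ?sc free_gen - free_scalar (qc m) \<in> algebra_relators"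
    unfolding algebra_relators_def Let_def by auto
  then have "free_eval \<iota> p (E12' r q wt ?sc free_gen - free_scalar (qc m)) = 0" by (rule relation_algebra)
  then have "E12' r q wt scB p = \<iota> (qc m)"
    unfolding free_eval_diff[OF complex_alg] E12'_def free_eval_sum[OF complex_alg] free_eval_monomial[OF complex_alg]
    by simp
  then show "BL.con 0 hd.d (fam2 p) \<nu> = \<iota> (qc m)"
    using BL.E12'_eq_contract[of q r wt hd.d p \<nu>] hd_d by (simp add: qc_def)
qed

lemma pd_rel:
  assumes forms: "presented_left_module lo X x Rel"
    and rel: "Rel = eigen_relators (\<lambda>c x. \<iota> c *s x) M c (family_prod (*s) p (\<lambda>g. axis g 1))
      \<union> {E12' r q wt (\<lambda>c x. \<iota> c *s x) (\<lambda>g. axis g 1)}"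
  shows "leg_map scO M (family_prod lo p x) = (\<lambda>I. lo (\<iota> c) (family_prod lo p x I))"
    and "OL.con 0 hd.d (fam2 x) = (\<lambda>\<nu>. 0)"
proof -
  have 0: "module_eval lo x f = 0" if "f \<in> Rel" for f
    using forms left_submodule_relator[OF that] unfolding presented_left_module_def by blast
  note ev = module_eval_linear[where la = lo and x = x, OF lo(2,3,1,4)]
  let ?ff = "family_prod (*s) p (\<lambda>g. axis g 1)" and ?sc = "\<lambda>c x. \<iota> c *s x"
  have entry: "module_eval lo x (?ff I) = family_prod lo p x I" for I
    by (cases I) (simp add: ev)
  show "leg_map scO M (family_prod lo p x) = (\<lambda>I. lo (\<iota> c) (family_prod lo p x I))"
  proof
    fix I
    have "module_eval lo x (leg_map ?sc M ?ff I - ?sc c (?ff I)) = 0"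
      by (rule 0) (auto simp: rel eigen_relators_def)
    then show "leg_map scO M (family_prod lo p x) I = lo (\<iota> c) (family_prod lo p x I)"
      unfolding ev(2) leg_map_def ev(3,4) entry by simp
  qed
  show "OL.con 0 hd.d (fam2 x) = (\<lambda>\<nu>. 0)"
  proof
    fix \<nu>
    have "module_eval lo x (E12' r q wt ?sc (\<lambda>g. axis g 1)) = 0"
      by (rule 0) (auto simp: rel)
    then have "E12' r q wt scO x = 0"
      unfolding E12'_def ev(3,4,5) by simp
    then show "OL.con 0 hd.d (fam2 x) \<nu> = 0"
      using OL.E12'_eq_contract[of q r wt hd.d x \<nu>] hd_d by (simp add: qc_def)
  qed
qed

lemma pdp_T: "OL.T hd.Hi 1 (pd dp) = OL.smul (qc (- w)) (pd dp)"
  and dp_trace: "OL.con 0 hd.d (fam2 dp) = (\<lambda>\<nu>. 0)"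
  using arg_cong[OF pd_rel(1)[OF forms_plus forms_plus_relators_def[unfolded Let_def]], of fam4]
    pd_rel(2)[OF forms_plus forms_plus_relators_def[unfolded Let_def]]
  unfolding OL_T fam4_prod fam4_smul by simp_all

lemma pdb_S: "OL.S hd.G 0 (pd dbp) = OL.smul (qc w) (pd dbp)"
  and dbp_trace: "OL.con 0 hd.d (fam2 dbp) = (\<lambda>\<nu>. 0)"
  using arg_cong[OF pd_rel(1)[OF forms_minus forms_minus_relators_def[unfolded Let_def]], of fam4]
    pd_rel(2)[OF forms_minus forms_minus_relators_def[unfolded Let_def]]
  unfolding OL_S fam4_prod fam4_smul by simp_all

lemma OL_ST: "fam4 (leg_map scO T x) = OL.S hd.G 0 (OL.T hd.Hi 1 (fam4 x))"
  unfolding T_def OL.leg_map_product OL_S OL_T ..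

lemma dp_right: "dxp dp = OL.smul (qc a) (OL.S hd.G 0 (OL.T hd.Hi 1 (pd dp)))"
proof -
  have "family_prod ro dp p = (\<lambda>I. lo (\<iota> (qc a)) (leg_map scO T (family_prod lo p dp) I))"
    by (rule ext) (rule right_plus)
  from arg_cong[OF this, of fam4] show ?thesis unfolding fam4_smul fam4_prod OL_ST .
qed

lemma dbp_right: "dxp dbp = OL.smul (qc (- a)) (OL.S hd.G 0 (OL.T hd.Hi 1 (pd dbp)))"
proof -
  have "family_prod ro dbp p = (\<lambda>I. lo (\<iota> (qc (- a))) (leg_map scO T (family_prod lo p dbp) I))"
    by (rule ext) (rule right_minus)
  from arg_cong[OF this, of fam4] show ?thesis unfolding fam4_smul fam4_prod OL_ST .
qed

end

section \<open>One-forms and their tensor products\<close>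

context leg_space
begin

lemma smul_inverse: "x = smul b y \<Longrightarrow> b \<noteq> 0 \<Longrightarrow> y = smul (1 / b) x"
  by (simp add: fun_eq_iff)

end

text \<open>
  The general facts on \<open>S\<close>, \<open>T\<close> and contractions are restated for the positions in use, with numerals as leg
  numbers, so that rewriting finds them.
\<close>

lemma leg_numbers:
  "0 + 2 = (2::nat)" "1 + 2 = (3::nat)" "2 + 2 = (4::nat)" "Suc 0 = 1" "Suc 1 = (2::nat)" "Suc 2 = (3::nat)"
  "Suc 3 = (4::nat)"
  by simp_all

context braided_legs
begin

lemmas S_T_commute_0 = S_T_commute[where k = 0, unfolded leg_numbers]
lemmas S_T_commute_2 = S_T_commute[where k = 2, unfolded leg_numbers]
lemmas con_d_S_0 = con_d_S[where k = 0, unfolded leg_numbers]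
lemmas con_1_S_0 = con_1_S[where k = 0, unfolded leg_numbers]
lemmas con_d_T_1 = con_d_T[where k = 1, unfolded leg_numbers]
lemmas con_d_T_3 = con_d_T[where k = 3, unfolded leg_numbers]
lemmas con_d_S_T_0 = con_d_S_T[where k = 0, unfolded leg_numbers]
lemmas con_T_after_1 = con_T_after[OF order_refl, where k = 1, unfolded leg_numbers]
lemmas con_S_after_0 = con_S_after[OF order_refl, where k = 0, unfolded leg_numbers]
lemmas S_braid_0 = S_braid[where k = 0, unfolded leg_numbers]
lemmas T_braid_1 = T_braid[where k = 1, unfolded leg_numbers]
lemmas con_con_1 = con_con[OF order_refl, where k = 1, unfolded leg_numbers]

lemma con_con_01: "con 0 e (con 3 e' x) = con 1 e' (con 0 e x)"
  using con_con[of 0 1, unfolded leg_numbers] by blast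

lemma con_S_before_3: "con 3 e (S K 0 x) = S K 0 (con 3 e x)"
  by (rule con_S_before) simp

lemma con_T_before_4: "con 4 e (T K 1 x) = T K 1 (con 4 e x)"
  by (rule con_T_before) simp

end

lemmas con_before_0 = con_before[where k = 0, unfolded leg_numbers]
lemmas con_before_1 = con_before[where k = 1, unfolded leg_numbers]
lemmas con_after_0 = con_after[where k = 0 and n = 0, OF _ order_refl, unfolded leg_numbers]

lemma con_after_1:
  "linear_family sc sc' \<phi> \<Longrightarrow> contract sc' 1 d (after 4 \<phi> x) = after 2 \<phi> (contract sc 1 d x)"
  using con_after[of sc sc' \<phi> 1 2 d x, unfolded leg_numbers] by simp

context ordered_calculus
begin

lemma smulO: "OL.smul b (OL.smul b' x) = OL.smul (b * b') x"
  by simp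

lemma smulT: "TL.smul b (TL.smul b' x) = TL.smul (b * b') x"
  by simp

abbreviation "one \<equiv> \<lambda>_::'n. (1::complex)"

lemma pd_trace: "OL.con 0 hd.d (pd x) = OL.smul (qc m) (fam2 x)"
proof -
  have "OL.con 0 hd.d (pd x) = after 0 (\<lambda>I b. lo b (x I)) (BL.con 0 hd.d (fam2 p))"
    unfolding pd_def by (rule con_after_0[OF lin_lo_arg])
  then show ?thesis unfolding p_trace by (simp add: fun_eq_iff after_def fam2_def)
qed

lemma pdp_T': "OL.T hd.H 1 (pd dp) = OL.smul (qc w) (pd dp)"
proof -
  have "pd dp = OL.smul (qc (- w)) (OL.T hd.H 1 (pd dp))"
    using arg_cong[OF pdp_T, of "OL.T hd.H 1"] unfolding OL.T_inverse OL.T_smul .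
  then have "OL.T hd.H 1 (pd dp) = OL.smul (1 / qc (- w)) (pd dp)" by (rule OL.smul_inverse) (rule qc_nz)
  then show ?thesis by (simp add: qc_minus)
qed

text \<open>
  \<open>E\<^sub>2\<^sub>3\<close> is a multiple of \<open>E'\<^sub>3\<^sub>4 T\<^sup>-\<^sup>1\<close>, and \<open>p \<partial>p\<close> is an eigenvector of \<open>T\<close>, so the claim reduces to the
  vanishing trace of \<open>\<partial>p\<close>.
\<close>

lemma pdp_contract: "OL.con 1 one (pd dp) = (\<lambda>\<nu>. 0)"
proof -
  have "OL.con 2 hd.d (pd dp) = before (\<lambda>I. lo (p I)) (OL.con 0 hd.d (fam2 dp))"
    unfolding pd_alt by (rule con_before_0[OF lin_lo])
  also have "\<dots> = (\<lambda>\<nu>. 0)" unfolding dp_trace using lo(1)[of _ 0 0] by (simp add: before_def fun_eq_iff)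
  finally have "OL.con 2 hd.d (pd dp) = (\<lambda>\<nu>. 0)" .
  moreover have "OL.smul hd.c (OL.con 1 one (pd dp)) = OL.con 2 hd.d (OL.T hd.H 1 (pd dp))"
    by (rule OL.con_d_T_1[symmetric])
  ultimately have "OL.smul hd.c (OL.con 1 one (pd dp)) = (\<lambda>\<nu>. 0)"
    unfolding pdp_T' OL.con_smul by (simp add: OL.scale_zero_right)
  then have "OL.con 1 one (pd dp) = OL.smul (1 / hd.c) (\<lambda>\<nu>. 0)"
    by (intro OL.smul_inverse hd.c_nz) simp
  then show ?thesis by (simp add: OL.scale_zero_right)
qed

text \<open>
  Here \<open>E\<^sub>2\<^sub>3\<close> is expressed by \<open>E'\<^sub>1\<^sub>2 S\<close>, and the trace of \<open>p\<close> is \<open>q\<^bsup>m\<^esup>\<close>. The factors cancel since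
  \<open>c = q\<^bsup>w + m\<^esup>\<close>.
\<close>

lemma pdb_contract: "OL.con 1 one (pd dbp) = fam2 dbp"
proof -
  have "OL.smul hd.c (OL.con 1 one (pd dbp)) = OL.con 0 hd.d (OL.S hd.G 0 (pd dbp))"
    by (rule OL.con_d_S_0[symmetric])
  also have "\<dots> = OL.smul hd.c (fam2 dbp)"
    unfolding pdb_S OL.con_smul pd_trace smulO hd_c qc_add ..
  finally have "OL.con 1 one (pd dbp) = OL.smul (1 / hd.c) (OL.smul hd.c (fam2 dbp))"
    by (intro OL.smul_inverse hd.c_nz) simp
  then show ?thesis unfolding smulO using hd.c_nz by simp
qed

lemma dpp_S: "dxp dp = OL.smul (qc (a - w)) (OL.S hd.G 0 (pd dp))"
  unfolding dp_right pdp_T OL.S_smul smulO by (simp add: qc_mult)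

lemma dbpp_T: "dxp dbp = OL.smul (qc (w - a)) (OL.T hd.Hi 1 (pd dbp))"
  unfolding dbp_right OL.S_T_commute_0 pdb_S OL.T_smul smulO by (simp only: qc_mult minus_add_distrib add_uminus_conv_diff uminus_add_conv_diff)

lemma dpp_T: "OL.T hd.Hi 1 (dxp dp) = OL.smul (qc (- w)) (dxp dp)"
proof -
  have "OL.T hd.Hi 1 (OL.S hd.G 0 (pd dp)) = OL.smul (qc (- w)) (OL.S hd.G 0 (pd dp))"
    by (simp only: OL.S_T_commute_0[symmetric] pdp_T OL.S_smul)
  then show ?thesis unfolding dpp_S OL.T_smul smulO by (simp add: smulO mult.commute)
qed

lemma dbpp_S: "OL.S hd.G 0 (dxp dbp) = OL.smul (qc w) (dxp dbp)"
proof -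
  have "OL.S hd.G 0 (OL.T hd.Hi 1 (pd dbp)) = OL.smul (qc w) (OL.T hd.Hi 1 (pd dbp))"
    by (simp only: OL.S_T_commute_0 pdb_S OL.T_smul)
  then show ?thesis unfolding dbpp_T OL.S_smul smulO by (simp add: smulO mult.commute)
qed

text \<open>
  By the right module structure this is a contraction of \<open>S (p \<partial>p)\<close>. In the quadratic relation of \<open>S\<close> the
  multiple of \<open>p \<partial>p\<close> itself contributes nothing by \<open>pdp_contract\<close>, and \<open>E\<^sub>2\<^sub>3 S\<^sup>-\<^sup>1\<close> is a multiple of
  \<open>E'\<^sub>1\<^sub>2\<close>.
\<close>

lemma dpp_contract: "OL.con 1 one (dxp dp) = fam2 dp"
proof -
  have S: "OL.con 1 one (OL.S hd.Gi 0 (pd dp)) = OL.smul (1 / hd.c) (OL.smul (qc m) (fam2 dp))"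
    by (simp only: OL.con_1_S_0 pd_trace)
  have "OL.con 1 one (OL.S hd.G 0 (pd dp)) = OL.smul (qc (2 * w - a)) (OL.smul (1 / hd.c) (OL.smul (qc m) (fam2 dp)))"
    unfolding OL.S_quadratic[of 0 "pd dp"] OL.con_add OL.con_smul S pdp_contract hd_uz(1)
    by (simp add: OL.scale_zero_right)
  then have "OL.con 1 one (dxp dp) = OL.smul (qc (a - w) * (qc (2 * w - a) * (1 / hd.c * qc m))) (fam2 dp)"
    unfolding dpp_S OL.con_smul smulO by (simp add: smulO mult.assoc)
  moreover have "qc (a - w) * (qc (2 * w - a) * (1 / hd.c * qc m)) = 1"
    unfolding hd_c by (simp add: qc_mult qc_0)
  ultimately show ?thesis by simp
qed

text \<open>
  Products of three families. In \<open>xpd\<close> the middle factor \<open>p\<close> may act on either side of the tensor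
  sign. Contracting it away after applying a relation of \<open>p\<close> with one factor gives a relation for
  \<open>x \<otimes> y\<close> (\<open>dpdp_T\<close>, \<open>dbdb_S\<close>).
\<close>

definition "xpd x y = after 4 (\<lambda>I v. tens v (y I)) (dxp x)"
definition "pxx x y = after 4 (\<lambda>I v. tens v (y I)) (pd x)"
definition "xxp x y = after 4 (\<lambda>I v. rt v (p I)) (xx x y)"

lemma xpd_alt: "xpd x y = before (\<lambda>I. tens (x I)) (pd y)"
  unfolding xpd_def dxp_alt pd_def by (simp add: fun_eq_iff after_def before_def fam2_def shift2_def tens(3))

lemma pxx_alt: "pxx x y = before (\<lambda>I. lt (p I)) (xx x y)"
  unfolding pxx_def pd_alt xx_def by (simp add: fun_eq_iff after_def before_def fam2_def shift2_def tens_lr)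

lemma xxp_alt: "xxp x y = before (\<lambda>I. tens (x I)) (dxp y)"
  unfolding xxp_def dxp_def xx_alt by (simp add: fun_eq_iff after_def before_def fam2_def shift2_def tens_lr)

lemma OT_before:
  assumes "linear_family scO scT \<phi>"
  shows "TL.S K (k + 2) (before \<phi> x) = before \<phi> (OL.S K k x)"
    "TL.T K (k + 2) (before \<phi> x) = before \<phi> (OL.T K k x)"
  unfolding TL.S_def OL.S_def TL.T_def OL.T_def
  using op_before[OF assms, of k] op_before[OF assms, of "Suc k"] by simp_all

lemma OT_after:
  assumes "linear_family scO scT \<phi>" "k + 3 \<le> n"
  shows "TL.S K k (after n \<phi> x) = after n \<phi> (OL.S K k x)"
    "TL.T K k (after n \<phi> x) = after n \<phi> (OL.T K k x)"
  unfolding TL.S_def OL.S_def TL.T_def OL.T_def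
  using op_after[OF assms(1), of k n] op_after[OF assms(1), of "Suc k" n] assms(2) by simp_all

lemmas OT_before_0 = OT_before[where k = 0, unfolded leg_numbers]
lemmas OT_before_1 = OT_before[where k = 1, unfolded leg_numbers]

lemma OT_after_0: "linear_family scO scT \<phi> \<Longrightarrow> TL.S K 0 (after 4 \<phi> x) = after 4 \<phi> (OL.S K 0 x)"
  by (rule OT_after(1)) simp_all

lemma OT_after_1: "linear_family scO scT \<phi> \<Longrightarrow> TL.T K 1 (after 4 \<phi> x) = after 4 \<phi> (OL.T K 1 x)"
  by (rule OT_after(2)) simp_all

lemma before_smul: "linear_family scO scT \<phi> \<Longrightarrow> before \<phi> (OL.smul b x) = TL.smul b (before \<phi> x)"
  unfolding linear_family_def by (rule ext) (simp only: before_def)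

lemma after_smul: "linear_family scO scT \<phi> \<Longrightarrow> after n \<phi> (OL.smul b x) = TL.smul b (after n \<phi> x)"
  unfolding linear_family_def by (rule ext) (simp only: after_def)

lemmas T_smuls = before_smul[OF lin_tens] after_smul[OF lin_tens_arg]

lemma xpd_contract: "TL.con 1 one (xpd dp y) = xx dp y" "TL.con 3 one (xpd x dbp) = xx x dbp"
proof -
  have "TL.con 1 one (xpd dp y) = after 2 (\<lambda>I v. tens v (y I)) (OL.con 1 one (dxp dp))"
    unfolding xpd_def by (rule con_after_1[OF lin_tens_arg])
  then show "TL.con 1 one (xpd dp y) = xx dp y" unfolding dpp_contract xx_def .
  have "TL.con 3 one (xpd x dbp) = before (\<lambda>I. tens (x I)) (OL.con 1 one (pd dbp))"
    unfolding xpd_alt by (rule con_before_1[OF lin_tens])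
  then show "TL.con 3 one (xpd x dbp) = xx x dbp" unfolding pdb_contract xx_alt .
qed

lemma dpdp_T: "TL.T hd.Hi 1 (xx dp dp) = TL.smul (qc (- w)) (xx dp dp)"
proof -
  have "TL.T hd.Hi 3 (xpd dp dp) = TL.smul (qc (- w)) (xpd dp dp)"
    unfolding xpd_alt OT_before_1[OF lin_tens] pdp_T T_smuls ..
  then have "TL.con 1 one (TL.T hd.Hi 3 (xpd dp dp)) = TL.smul (qc (- w)) (xx dp dp)"
    by (simp only: TL.con_smul xpd_contract)
  then show ?thesis by (simp only: TL.con_T_after_1 xpd_contract)
qed

lemma dbdb_S: "TL.S hd.G 0 (xx dbp dbp) = TL.smul (qc w) (xx dbp dbp)"
proof -
  have "TL.S hd.G 0 (xpd dbp dbp) = TL.smul (qc w) (xpd dbp dbp)"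
    unfolding xpd_def OT_after_0[OF lin_tens_arg] dbpp_S T_smuls ..
  then have "TL.con 3 one (TL.S hd.G 0 (xpd dbp dbp)) = TL.smul (qc w) (xx dbp dbp)"
    by (simp only: TL.con_smul xpd_contract)
  then show ?thesis by (simp only: TL.con_S_before_3 xpd_contract)
qed

definition metric :: "('n \<times> 'n \<Rightarrow> 'o) \<Rightarrow> ('n \<times> 'n \<Rightarrow> 'o) \<Rightarrow> 't" where
  "metric x y = E12' r q wt scT (E23 scT (family_prod tens x y))"

lemma metric_eq: "TL.con 0 hd.d (TL.con 1 one (xx x y)) = (\<lambda>\<nu>. metric x y)"
proof
  fix \<nu>
  show "TL.con 0 hd.d (TL.con 1 one (xx x y)) \<nu> = metric x y"
    unfolding metric_def
    using TL.E12'_eq_contract[of q r wt hd.d "E23 scT (family_prod tens x y)" \<nu>] hd_d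
    by (simp add: qc_def TL.E23_eq_contract fam4_prod)
qed

lemma metric_right: "TL.con 0 hd.d (TL.con 1 one (xxp x y)) = (\<lambda>\<nu>. rt (metric x y) (p (\<nu> 0, \<nu> 1)))"
proof -
  have "TL.con 1 one (xxp x y) = after 2 (\<lambda>I v. rt v (p I)) (TL.con 1 one (xx x y))"
    unfolding xxp_def by (rule con_after_1[OF lin_rt])
  then have "TL.con 0 hd.d (TL.con 1 one (xxp x y)) = after 0 (\<lambda>I v. rt v (p I)) (TL.con 0 hd.d (TL.con 1 one (xx x y)))"
    by (simp only: con_after_0[OF lin_rt])
  then show ?thesis unfolding metric_eq by (simp add: after_def fun_eq_iff)
qed

lemma metric_left: "TL.con 2 hd.d (TL.con 3 one (pxx x y)) = (\<lambda>\<nu>. lt (p (\<nu> 0, \<nu> 1)) (metric x y))"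
proof -
  have "TL.con 3 one (pxx x y) = before (\<lambda>I. lt (p I)) (TL.con 1 one (xx x y))"
    unfolding pxx_alt by (rule con_before_1[OF lin_lt])
  then have "TL.con 2 hd.d (TL.con 3 one (pxx x y)) = before (\<lambda>I. lt (p I)) (TL.con 0 hd.d (TL.con 1 one (xx x y)))"
    by (simp only: con_before_0[OF lin_lt])
  then show ?thesis unfolding metric_eq by (simp add: before_def fun_eq_iff)
qed

text \<open>
  Insert \<open>p\<close> between the two forms of \<open>\<partial>p \<otimes> \<partial>p\<^sup>-\<close>. Moving it out to the right costs a \<open>T\<close>, to the left an \<open>S\<^sup>-\<^sup>1\<close>
  (\<open>dbpp_T\<close>, \<open>dpp_S\<close>). Contracting, both products become the same: \<open>E'\<^sub>3\<^sub>4 S\<^sup>-\<^sup>1\<close> and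
  \<open>E'\<^sub>1\<^sub>2 T\<close> agree because \<open>E'\<^sub>1\<^sub>2 S T = E'\<^sub>3\<^sub>4\<close>.
\<close>

lemma metric_pm_central: "rt (metric dp dbp) (p I) = lt (p I) (metric dp dbp)"
proof -
  let ?Y = "xx dp dbp"
  have "xxp dp dbp = TL.smul (qc (w - a)) (TL.T hd.Hi 3 (xpd dp dbp))"
    unfolding xxp_alt xpd_alt dbpp_T T_smuls OT_before_1[OF lin_tens] ..
  then have "TL.con 1 one (xxp dp dbp) = TL.smul (qc (w - a)) (TL.T hd.Hi 1 ?Y)"
    by (simp only: TL.con_T_after_1 TL.con_smul xpd_contract)
  then have right: "TL.con 0 hd.d (TL.con 1 one (xxp dp dbp)) = TL.smul (qc (w - a)) (TL.con 0 hd.d (TL.T hd.Hi 1 ?Y))"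
    by (simp only: TL.con_smul)
  have "OL.S hd.Gi 0 (dxp dp) = OL.smul (qc (a - w)) (pd dp)"
    unfolding dpp_S OL.S_smul OL.S_inverse ..
  then have "pd dp = OL.smul (1 / qc (a - w)) (OL.S hd.Gi 0 (dxp dp))"
    by (rule OL.smul_inverse) (rule qc_nz)
  then have "pd dp = OL.smul (qc (w - a)) (OL.S hd.Gi 0 (dxp dp))" by (simp add: qc_mult)
  then have "pxx dp dbp = TL.smul (qc (w - a)) (TL.S hd.Gi 0 (xpd dp dbp))"
    unfolding pxx_def xpd_def OT_after_0[OF lin_tens_arg] T_smuls(2)[symmetric] by (rule arg_cong)
  then have "TL.con 3 one (pxx dp dbp) = TL.smul (qc (w - a)) (TL.S hd.Gi 0 ?Y)"
    by (simp only: TL.con_S_before_3 TL.con_smul xpd_contract)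
  then have "TL.con 2 hd.d (TL.con 3 one (pxx dp dbp)) = TL.smul (qc (w - a)) (TL.con 2 hd.d (TL.S hd.Gi 0 ?Y))"
    by (simp only: TL.con_smul)
  also have "TL.con 2 hd.d (TL.S hd.Gi 0 ?Y) = TL.con 0 hd.d (TL.T hd.Hi 1 ?Y)"
    by (simp only: TL.con_d_S_T_0[symmetric] TL.S_T_commute_0 TL.S_inverse)
  finally have left: "TL.con 2 hd.d (TL.con 3 one (pxx dp dbp))
      = TL.smul (qc (w - a)) (TL.con 0 hd.d (TL.T hd.Hi 1 ?Y))" .
  have "(\<lambda>\<nu> :: nat \<Rightarrow> 'n. rt (metric dp dbp) (p (\<nu> 0, \<nu> 1))) = (\<lambda>\<nu>. lt (p (\<nu> 0, \<nu> 1)) (metric dp dbp))"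
    by (rule trans[OF trans[OF metric_right[symmetric] right] trans[OF left[symmetric] metric_left]])
  from fun_cong[OF this, of "\<lambda>n. if n = 0 then fst I else snd I"] show ?thesis by simp
qed

text \<open>
  The six-leg families \<open>P\<close> (with \<open>p\<close> on the left) and \<open>Q\<close> (with \<open>p\<close> on the right) are related by \<open>S\<close> and
  \<open>T\<close>. Since \<open>P\<close> is an eigenvector of the first copy of \<open>S\<close>, the braid relation computes the double
  contraction of \<open>Q\<close>; since \<open>Q\<close> is one of the last copy of \<open>T\<close>, it also computes that of \<open>P\<close>. Both turn
  out to be the same multiple of \<open>E\<^sub>2\<^sub>3\<close> applied to \<open>\<partial>p\<^sup>- \<otimes> \<partial>p\<close>.
\<close>

lemma metric_mp_central: "rt (metric dbp dp) (p I) = lt (p I) (metric dbp dp)"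
proof -
  let ?Z = "xx dbp dp" and ?P = "pxx dbp dp" and ?Q = "xxp dbp dp"
  let ?S = "TL.S hd.G" and ?S' = "TL.S hd.Gi" and ?T = "TL.T hd.Hi" and ?T' = "TL.T hd.H"
  have "?Q = TL.smul (qc (a - w)) (?S 2 (xpd dbp dp))"
    unfolding xxp_alt xpd_alt dpp_S T_smuls OT_before_0[OF lin_tens] ..
  moreover have "xpd dbp dp = TL.smul (qc (w - a)) (?T 1 ?P)"
    unfolding xpd_def pxx_def dbpp_T T_smuls OT_after_1[OF lin_tens_arg] ..
  ultimately have QP: "?Q = ?S 2 (?T 1 ?P)"
    by (simp only: TL.S_smul smulT qc_mult diff_add_cancel add_diff_eq diff_self qc_0 TL.smul_one)
  have SP: "?S 0 ?P = TL.smul (qc w) ?P"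
    unfolding pxx_def OT_after_0[OF lin_tens_arg] pdb_S T_smuls ..
  have TQ: "?T 3 ?Q = TL.smul (qc (- w)) ?Q"
    unfolding xxp_alt OT_before_1[OF lin_tens] dpp_T T_smuls ..
  have "TL.con 3 one ?Q = before (\<lambda>I. tens (dbp I)) (OL.con 1 one (dxp dp))"
    unfolding xxp_alt by (rule con_before_1[OF lin_tens])
  then have Q3: "TL.con 3 one ?Q = ?Z" unfolding dpp_contract xx_alt .
  have "TL.con 1 one ?P = after 2 (\<lambda>I v. tens v (dp I)) (OL.con 1 one (pd dbp))"
    unfolding pxx_def by (rule con_after_1[OF lin_tens_arg])
  then have P1: "TL.con 1 one ?P = ?Z" unfolding pdb_contract xx_def .

  \<comment> \<open>contract both sides of the braid relation with \<open>E'\<^sub>1\<^sub>2 E'\<^sub>1\<^sub>2\<close>\<close>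
  have "TL.smul (qc w) (?S 0 ?Q) = ?S 0 (?S 2 (?T 1 (TL.smul (qc w) ?P)))"
    unfolding QP TL.S_smul TL.T_smul ..
  also have "\<dots> = ?S 0 (?S 2 (?S 0 (?T 1 ?P)))"
    unfolding SP[symmetric] TL.S_T_commute_0 ..
  also have "\<dots> = ?S 2 (?S 0 ?Q)"
    unfolding QP by (rule TL.S_braid_0)
  finally have "TL.smul (qc w) (TL.con 0 hd.d (TL.con 0 hd.d (?S 0 ?Q))) = TL.con 0 hd.d (TL.con 0 hd.d (?S 2 (?S 0 ?Q)))"
    by (simp only: TL.con_smul[symmetric])
  also have "TL.con 0 hd.d (TL.con 0 hd.d (?S 2 (?S 0 ?Q))) = TL.smul hd.c (TL.con 1 one (TL.con 0 hd.d (?S 0 ?Q)))"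
    by (simp only: TL.con_S_after_0 TL.con_d_S_0[of "TL.con 0 hd.d (?S 0 ?Q)"])
  also have "TL.con 1 one (TL.con 0 hd.d (?S 0 ?Q)) = TL.con 0 hd.d (TL.con 3 one (?S 0 ?Q))"
    by (rule TL.con_con_01[symmetric])
  also have "\<dots> = TL.smul hd.c (TL.con 1 one ?Z)"
    by (simp only: TL.con_S_before_3 Q3 TL.con_d_S_0)
  also have "TL.con 0 hd.d (?S 0 ?Q) = TL.smul hd.c (TL.con 1 one ?Q)"
    by (rule TL.con_d_S_0)
  finally have "TL.smul (qc w * hd.c) (TL.con 0 hd.d (TL.con 1 one ?Q)) = TL.smul (hd.c * hd.c) (TL.con 1 one ?Z)"
    unfolding TL.con_smul smulT .
  then have right: "TL.con 0 hd.d (TL.con 1 one ?Q) = TL.smul (1 / (qc w * hd.c)) (TL.smul (hd.c * hd.c) (TL.con 1 one ?Z))"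
    by (intro TL.smul_inverse) (simp_all add: qc_nz hd.c_nz)

  \<comment> \<open>the same on the last legs, contracting first \<open>E'\<^sub>5\<^sub>6\<close>, then \<open>E'\<^sub>3\<^sub>4\<close>\<close>
  have "?T' 3 (?T 3 ?Q) = TL.smul (qc (- w)) (?T' 3 ?Q)" unfolding TQ TL.T_smul ..
  then have "?Q = TL.smul (qc (- w)) (?T' 3 ?Q)" unfolding TL.T_inverse .
  then have "?T' 3 ?Q = TL.smul (1 / qc (- w)) ?Q" by (rule TL.smul_inverse) (rule qc_nz)
  then have TQ': "?T' 3 ?Q = TL.smul (qc w) ?Q" unfolding qc_mult minus_minus .
  have PQ: "?P = ?T' 1 (?S' 2 ?Q)" unfolding QP TL.S_inverse TL.T_inverse ..
  have "TL.smul (qc w) (?T' 3 ?P) = ?T' 3 (?T' 1 (?S' 2 (TL.smul (qc w) ?Q)))"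
    unfolding PQ TL.S_smul TL.T_smul ..
  also have "\<dots> = ?T' 3 (?T' 1 (?T' 3 (?S' 2 ?Q)))"
    unfolding TQ'[symmetric] TL.S_T_commute_2 ..
  also have "\<dots> = ?T' 1 (?T' 3 ?P)"
    unfolding PQ by (rule TL.T_braid_1[symmetric])
  finally have "TL.smul (qc w) (TL.con 2 hd.d (TL.con 4 hd.d (?T' 3 ?P))) = TL.con 2 hd.d (TL.con 4 hd.d (?T' 1 (?T' 3 ?P)))"
    by (simp only: TL.con_smul[symmetric])
  also have "\<dots> = TL.smul hd.c (TL.con 1 one (TL.con 4 hd.d (?T' 3 ?P)))"
    by (simp only: TL.con_T_before_4 TL.con_d_T_1)
  also have "TL.con 4 hd.d (?T' 3 ?P) = TL.smul hd.c (TL.con 3 one ?P)"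
    by (rule TL.con_d_T_3)
  finally have "TL.smul (qc w * hd.c) (TL.con 2 hd.d (TL.con 3 one ?P)) = TL.smul (hd.c * hd.c) (TL.con 1 one (TL.con 3 one ?P))"
    unfolding TL.con_smul smulT .
  then have left: "TL.con 2 hd.d (TL.con 3 one ?P) = TL.smul (1 / (qc w * hd.c)) (TL.smul (hd.c * hd.c) (TL.con 1 one (TL.con 3 one ?P)))"
    by (intro TL.smul_inverse) (simp_all add: qc_nz hd.c_nz)
  have eq: "TL.con 1 one (TL.con 3 one ?P) = TL.con 1 one ?Z"
    by (simp only: TL.con_con_1 P1)
  have "(\<lambda>\<nu> :: nat \<Rightarrow> 'n. rt (metric dbp dp) (p (\<nu> 0, \<nu> 1))) = (\<lambda>\<nu>. lt (p (\<nu> 0, \<nu> 1)) (metric dbp dp))"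
    by (rule trans[OF trans[OF metric_right[symmetric] right] trans[OF left[unfolded eq, symmetric] metric_left]])
  \<comment> \<open>any sequence of indices that starts with \<open>I\<close> will do\<close>
  from fun_cong[OF this, of "\<lambda>n. if n = 0 then fst I else snd I"] show ?thesis by simp
qed

end

section \<open>Tensor products of the summands\<close>

lemma op_map:
  assumes "linear_family sc sc' (\<lambda>_::'n::finite \<times> 'n. \<phi>)"
  shows "leg_op sc' k (K :: complex^('n \<times> 'n)^('n \<times> 'n)) (\<lambda>\<nu>. \<phi> (x \<nu>)) = (\<lambda>\<nu>. \<phi> (leg_op sc k K x \<nu>))"
  using op_after[OF assms order_refl, of k K x] unfolding after_def .

lemma con_map:
  assumes "linear_family sc sc' (\<lambda>_::'n::finite \<times> 'n. \<phi>)"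
  shows "contract sc' k (d :: 'n \<Rightarrow> complex) (\<lambda>\<nu>. \<phi> (x \<nu>)) = (\<lambda>\<nu>. \<phi> (contract sc k d x \<nu>))"
  using con_after[OF assms order_refl, of k d x] unfolding after_def .

lemma additive_span_closed:
  assumes "x \<in> additive_span X" "y \<in> additive_span X"
  shows "x + y \<in> additive_span X" "- x \<in> additive_span X"
proof -
  show "x + y \<in> additive_span X"
    using assms(1)
  proof induction
    case zero then show ?case using assms(2) by simp
  next
    case (add z x)
    then show ?case using additive_span.add[OF add(1,3)] by (simp add: ac_simps)
  next
    case (diff z x)
    then show ?case using additive_span.diff[OF diff(1,3)] by (simp add: algebra_simps)
  qed
  show "- x \<in> additive_span X"
    using assms(1)
  proof induction
    case zero then show ?case using additive_span.zero by simp
  next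
    case (add z x)
    then show ?case using additive_span.diff[OF add(1,3)] by simp
  next
    case (diff z x)
    then show ?case using additive_span.add[OF diff(1,3)] by simp
  qed
qed

lemma additive_span_sum: "(\<And>i. i \<in> I \<Longrightarrow> f i \<in> additive_span X) \<Longrightarrow> (\<Sum>i\<in>I. f i) \<in> additive_span X"
proof (induction I rule: infinite_finite_induct)
  case (insert i I)
  then show ?case unfolding sum.insert[OF insert(1,2)] by (intro additive_span_closed(1)) simp_all
qed (simp_all add: additive_span.zero)

locale ordered_braiding =
  generalized_braiding r s q \<pi> wt RVV RVD RDD \<iota> p lo ro \<Omega>p \<Omega>m dp dbp lt rt tens \<sigma>
  + ordered_calculus r s q \<pi> wt RVV RVD RDD \<iota> p lo ro \<Omega>p \<Omega>m dp dbp lt rt tens pos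
  for r s q and \<pi> :: "uq_gen \<Rightarrow> complex^'n^'n" and wt RVV RVD RDD
    and \<iota> :: "complex \<Rightarrow> 'b::ring_1" and p
    and lo :: "'b \<Rightarrow> 'o::ab_group_add \<Rightarrow> 'o" and ro \<Omega>p \<Omega>m dp dbp
    and lt :: "'b \<Rightarrow> 't::ab_group_add \<Rightarrow> 't" and rt tens \<sigma> and pos
begin

text \<open>
  The second condition makes the submodule spanned by the family \<open>x\<close> closed under the right action:
  \<open>x p\<close> lies in it, and products of the \<open>p\<close> span the algebra (\<open>generates_right\<close>).
\<close>

definition generates :: "'o set \<Rightarrow> ('n \<times> 'n \<Rightarrow> 'o) \<Rightarrow> bool" where
  "generates N x \<longleftrightarrow> range (module_eval lo x) = N \<and> (\<forall>I. family_prod ro x p I \<in> N)"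

lemma ev:
  fixes x :: "'n \<times> 'n \<Rightarrow> 'o"
  shows "module_eval lo x (f + f') = module_eval lo x f + module_eval lo x f'"
    "module_eval lo x (b *s f) = lo b (module_eval lo x f)"
    "module_eval lo x (\<Sum>i\<in>I. F i) = (\<Sum>i\<in>I. module_eval lo x (F i))"
    "module_eval lo x (axis g 1) = x g"
  by (rule module_eval_linear[where la = lo, OF lo(2,3,1,4)])+

lemma generates_closed:
  assumes "generates N x"
  shows "y \<in> N \<Longrightarrow> z \<in> N \<Longrightarrow> y + z \<in> N" "y \<in> N \<Longrightarrow> lo b y \<in> N" "0 \<in> N" "x g \<in> N"
proof -
  have N: "N = range (module_eval lo x)" using assms by (simp add: generates_def)
  show "y + z \<in> N" if y: "y \<in> N" and z: "z \<in> N" for y z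
  proof -
    obtain f g where "y = module_eval lo x f" "z = module_eval lo x g" using y z unfolding N by blast
    then have "y + z = module_eval lo x (f + g)" by (simp only: ev(1))
    then show ?thesis unfolding N by blast
  qed
  show lo_N: "lo b y \<in> N" if y: "y \<in> N" for b y
  proof -
    obtain f where "y = module_eval lo x f" using y unfolding N by blast
    then have "lo b y = module_eval lo x (b *s f)" by (simp only: ev(2))
    then show ?thesis unfolding N by blast
  qed
  show x: "x g \<in> N" for g unfolding N ev(4)[of x g, symmetric] by (rule rangeI)
  have "lo 0 (x g) = 0" using lo(2)[of 0 0 "x g"] by simp
  then show "0 \<in> N" using lo_N[OF x, of 0] by metis
qed

lemma generates_sum: "generates N x \<Longrightarrow> (\<And>i. i \<in> I \<Longrightarrow> f i \<in> N) \<Longrightarrow> (\<Sum>i\<in>I. f i) \<in> N"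
proof (induction I rule: infinite_finite_induct)
  case (insert i I)
  then show ?case unfolding sum.insert[OF insert(1,2)] by (intro generates_closed(1)) simp_all
qed (simp_all add: generates_closed(3))

lemma ro_sum: "ro (\<Sum>i\<in>I. f i) b = (\<Sum>i\<in>I. ro (f i) b)"
proof -
  have "ro 0 b = 0" using ro(1)[of 0 0 b] by simp
  then show ?thesis by (induction I rule: infinite_finite_induct) (simp_all add: ro(1))
qed

lemma generates_right:
  assumes N: "generates N x" and y: "y \<in> N"
  shows "ro y b \<in> N"
proof -
  have p: "ro y (p J) \<in> N" if "y \<in> N" for y J
  proof -
    obtain f where y: "y = module_eval lo x f" using N \<open>y \<in> N\<close> unfolding generates_def by blast
    have "ro (x g) (p J) \<in> N" for g
    proof (cases g; cases J)
      fix i j k l assume "g = (i, j)" "J = (k, l)"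
      moreover have "family_prod ro x p (i, j, k, l) \<in> N" using N unfolding generates_def by blast
      ultimately show ?thesis by simp
    qed
    then show ?thesis
      unfolding y module_eval_def ro_sum lro(1) by (intro generates_sum[OF N] generates_closed(2)[OF N])
  qed
  have mono: "ro y (prod_list (map p u)) \<in> N" if "y \<in> N" for u y
    using that
  proof (induction u arbitrary: y)
    case Nil then show ?case by (simp add: ro(4))
  next
    case (Cons J u)
    show ?case unfolding list.map prod_list.Cons ro(3) by (rule Cons.IH) (rule p[OF Cons.prems])
  qed
  obtain F where b: "b = free_eval \<iota> p F"
    using algebra surjD[of "free_eval \<iota> p" b] unfolding presented_algebra_def by blast
  have "ro y (\<Sum>u\<in>U. h u) = (\<Sum>u\<in>U. ro y (h u))" for h and U :: "('n \<times> 'n) list set"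
  proof -
    have "ro y 0 = 0" using ro(2)[of y 0 0] by simp
    then show ?thesis by (induction U rule: infinite_finite_induct) (simp_all add: ro(2))
  qed
  then have "ro y b = (\<Sum>u\<in>Poly_Mapping.keys F. ro y (\<iota> (Poly_Mapping.lookup F u) * prod_list (map p u)))"
    unfolding b free_eval_def .
  moreover have "ro y (\<iota> c * prod_list (map p u)) \<in> N" for c u
    unfolding ro(3) lro(2)[symmetric] lro(1) by (intro generates_closed(2)[OF N] mono y)
  ultimately show ?thesis by (simp only:) (rule generates_sum[OF N])
qed

lemma generates_plus: "generates \<Omega>p dp"
  and generates_minus: "generates \<Omega>m dbp"
proof -
  have aux: "generates N x" if forms: "presented_left_module lo N x Rel"
    and right: "\<And>I. family_prod ro x p I = lo (\<iota> c) (leg_map scO T (family_prod lo p x) I)" for N x Rel c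
  proof -
    have N: "N = range (module_eval lo x)" using forms by (simp add: presented_left_module_def)
    have F: "\<exists>f. family_prod lo p x J = module_eval lo x f" for J
    proof (cases J)
      case (fields i j k l)
      have "module_eval lo x (p (i, j) *s axis (k, l) 1) = lo (p (i, j)) (x (k, l))" by (simp only: ev(2,4))
      then show ?thesis unfolding fields family_prod.simps by (intro exI) (rule sym)
    qed
    obtain F where F: "\<And>J. family_prod lo p x J = module_eval lo x (F J)"
      using choice[of "\<lambda>J f. family_prod lo p x J = module_eval lo x f"] F by blast
    have "family_prod ro x p I = module_eval lo x (\<iota> c *s (\<Sum>J\<in>UNIV. \<iota> (T $ I $ J) *s F J))" for I
      unfolding right leg_map_def F ev(2,3) ..
    then have "family_prod ro x p I \<in> range (module_eval lo x)" for I by (simp only: rangeI)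
    then show ?thesis unfolding generates_def N by simp
  qed
  show "generates \<Omega>p dp" by (rule aux[OF forms_plus right_plus])
  show "generates \<Omega>m dbp" by (rule aux[OF forms_minus right_minus])
qed

lemma lt_additive: "lt b 0 = 0" "lt b (- t) = - lt b t" "lt b (t - t') = lt b t - lt b t'"
proof -
  show 0: "lt b 0 = 0" using lt(1)[of b 0 0] by simp
  show neg: "lt b (- t) = - lt b t" for t
    using minus_unique[of "lt b t" "lt b (- t)"] lt(1)[of b t "- t"] 0 by simp
  show "lt b (t - t') = lt b t - lt b t'" using lt(1)[of b t "- t'"] neg by simp
qed

lemma rt_additive: "rt 0 b = 0" "rt (t - t') b = rt t b - rt t' b"
proof -
  show "rt 0 b = 0" using rt[of 0 0 b] by simp
  show "rt (t - t') b = rt t b - rt t' b" using rt[of "t - t'" t' b] by (simp only: diff_add_cancel add_diff_cancel)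
qed

lemma tensor_sub_closed:
  assumes N: "generates N1 x" "generates N2 y"
  shows "t \<in> tensor_sub tens N1 N2 \<Longrightarrow> u \<in> tensor_sub tens N1 N2 \<Longrightarrow> t + u \<in> tensor_sub tens N1 N2"
    "t \<in> tensor_sub tens N1 N2 \<Longrightarrow> - t \<in> tensor_sub tens N1 N2"
    "0 \<in> tensor_sub tens N1 N2"
    "t \<in> tensor_sub tens N1 N2 \<Longrightarrow> lt b t \<in> tensor_sub tens N1 N2"
    "t \<in> tensor_sub tens N1 N2 \<Longrightarrow> rt t b \<in> tensor_sub tens N1 N2"
    "family_prod tens x y I \<in> tensor_sub tens N1 N2"
    "(\<And>j. j \<in> J \<Longrightarrow> f j \<in> tensor_sub tens N1 N2) \<Longrightarrow> (\<Sum>j\<in>J. f j) \<in> tensor_sub tens N1 N2"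
proof -
  show "t \<in> tensor_sub tens N1 N2 \<Longrightarrow> u \<in> tensor_sub tens N1 N2 \<Longrightarrow> t + u \<in> tensor_sub tens N1 N2"
    unfolding tensor_sub_def by (rule additive_span_closed(1))
  show "t \<in> tensor_sub tens N1 N2 \<Longrightarrow> - t \<in> tensor_sub tens N1 N2"
    unfolding tensor_sub_def by (rule additive_span_closed(2))
  show "0 \<in> tensor_sub tens N1 N2" unfolding tensor_sub_def by (rule additive_span.zero)
  show "(\<And>j. j \<in> J \<Longrightarrow> f j \<in> tensor_sub tens N1 N2) \<Longrightarrow> (\<Sum>j\<in>J. f j) \<in> tensor_sub tens N1 N2"
    unfolding tensor_sub_def by (rule additive_span_sum)
  let ?X = "{tens x y |x y. x \<in> N1 \<and> y \<in> N2}"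
  have base: "tens v v' \<in> tensor_sub tens N1 N2" if "v \<in> N1" "v' \<in> N2" for v v'
    unfolding tensor_sub_def using that by (intro additive_span_base) blast
  show "family_prod tens x y I \<in> tensor_sub tens N1 N2"
  proof (cases I)
    case (fields i j k l)
    then show ?thesis
      using base[OF generates_closed(4)[OF N(1), of "(i, j)"] generates_closed(4)[OF N(2), of "(k, l)"]] by simp
  qed
  have lt_gen: "lt b v \<in> ?X" if "v \<in> ?X" for v
  proof -
    from that obtain y z where v: "v = tens y z" "y \<in> N1" "z \<in> N2" by blast
    show ?thesis unfolding v(1) tens_lr(1) using generates_closed(2)[OF N(1) v(2)] v(3) by blast
  qed
  have rt_gen: "rt v b \<in> ?X" if "v \<in> ?X" for v
  proof -
    from that obtain y z where v: "v = tens y z" "y \<in> N1" "z \<in> N2" by blast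
    show ?thesis unfolding v(1) tens_lr(2) using generates_right[OF N(2) v(3)] v(2) by blast
  qed
  show "lt b t \<in> tensor_sub tens N1 N2" if "t \<in> tensor_sub tens N1 N2"
    using that unfolding tensor_sub_def
  proof induction
    case zero then show ?case by (simp add: lt_additive additive_span.zero)
  next
    case (add v v')
    show ?case unfolding lt(1) by (rule additive_span.add[OF lt_gen[OF add(1)] add(3)])
  next
    case (diff v v')
    show ?case unfolding lt_additive(3) by (rule additive_span.diff[OF lt_gen[OF diff(1)] diff(3)])
  qed
  show "rt t b \<in> tensor_sub tens N1 N2" if "t \<in> tensor_sub tens N1 N2"
    using that unfolding tensor_sub_def
  proof induction
    case zero then show ?case by (simp add: rt_additive additive_span.zero)
  next
    case (add v v')
    show ?case unfolding rt by (rule additive_span.add[OF rt_gen[OF add(1)] add(3)])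
  next
    case (diff v v')
    show ?case unfolding rt_additive(2) by (rule additive_span.diff[OF rt_gen[OF diff(1)] diff(3)])
  qed
qed

lemma tens_sum: "tens (\<Sum>i\<in>I. f i) v = (\<Sum>i\<in>I. tens (f i) v)" "tens v (\<Sum>i\<in>I. f i) = (\<Sum>i\<in>I. tens v (f i))"
proof -
  have "tens 0 v = 0" "tens v 0 = 0" using tens(1)[of 0 0 v] tens(2)[of v 0 0] by simp_all
  then show "tens (\<Sum>i\<in>I. f i) v = (\<Sum>i\<in>I. tens (f i) v)" "tens v (\<Sum>i\<in>I. f i) = (\<Sum>i\<in>I. tens v (f i))"
    by (induction I rule: infinite_finite_induct) (simp_all add: tens(1,2))
qed

text \<open>
  A coefficient in front of the second factor can be moved across the tensor sign into the first one,
  where it is absorbed by \<open>generates_right\<close>. So the products of generators span over the left action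
  alone.
\<close>

lemma tensor_sub_induct [consumes 3, case_names gen zero add minus left]:
  assumes t: "t \<in> tensor_sub tens N1 N2" and N: "generates N1 x" "generates N2 y"
    and P: "\<And>I. P (family_prod tens x y I)" "P 0" "\<And>t u. P t \<Longrightarrow> P u \<Longrightarrow> P (t + u)" "\<And>t. P t \<Longrightarrow> P (- t)"
      "\<And>b t. P t \<Longrightarrow> P (lt b t)"
  shows "P t"
proof -
  have Psum: "P (\<Sum>i\<in>I. f i)" if "\<And>i. i \<in> I \<Longrightarrow> P (f i)" for I and f :: "'n \<times> 'n \<Rightarrow> 't"
    using that
  proof (induction I rule: infinite_finite_induct)
    case (insert i I)
    then show ?case unfolding sum.insert[OF insert(1,2)] by (intro P(3)) simp_all
  qed (simp_all add: P(2))
  have base: "P (tens v v')" if v: "v \<in> N1" and v': "v' \<in> N2" for v v'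
  proof -
    obtain f' where f': "v' = module_eval lo y f'" using N(2) v' unfolding generates_def by blast
    have gen: "P (tens z (y h))" if "z \<in> N1" for z h
    proof -
      from N(1) that obtain f where f: "z = module_eval lo x f" unfolding generates_def by blast
      have "P (tens (x g) (y h))" for g
      proof (cases g; cases h)
        fix i j k l assume "g = (i, j)" "h = (k, l)"
        then show ?thesis using P(1)[of "(i, j, k, l)"] by simp
      qed
      then show ?thesis
        unfolding f module_eval_def tens_sum(1) tens_lr(1)[symmetric] by (intro Psum P(5))
    qed
    show ?thesis
      unfolding f' module_eval_def tens_sum(2) tens(3)[symmetric]
      by (intro Psum) (rule gen[OF generates_right[OF N(1) v]])
  qed
  from t show ?thesis
    unfolding tensor_sub_def
  proof induction
    case zero then show ?case by (rule P)
  next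
    case (add v v')
    then show ?case using P(3) base by blast
  next
    case (diff v v')
    then have "P (v' + (- v))" using P(3,4) base by blast
    then show ?case by simp
  qed
qed

end

section \<open>The braiding on families of generators\<close>

lemma fam4_add: "fam4 (\<lambda>I. x I + y I) = (\<lambda>\<nu>. fam4 x \<nu> + fam4 y \<nu>)"
  by (simp add: fam4_def fun_eq_iff)

context ordered_braiding
begin

text \<open>
  As a left linear map, \<open>\<sigma>\<close> commutes with all operators and contractions of legs.
\<close>

definition map_sigma :: "((nat \<Rightarrow> 'n) \<Rightarrow> 't) \<Rightarrow> (nat \<Rightarrow> 'n) \<Rightarrow> 't" where
  "map_sigma x = (\<lambda>\<nu>. \<sigma> (x \<nu>))"

lemma lin_\<sigma>: "linear_family scT scT (\<lambda>_::'n \<times> 'n. \<sigma>)"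
  unfolding linear_family_def by (intro conjI allI \<sigma>_add \<sigma>_left)

lemma map_sigma_S: "map_sigma (TL.S K k x) = TL.S K k (map_sigma x)"
  and map_sigma_T: "map_sigma (TL.T K k x) = TL.T K k (map_sigma x)"
  by (simp_all only: map_sigma_def TL.S_def TL.T_def op_map[OF lin_\<sigma>])

lemma map_sigma_con: "map_sigma (TL.con k (e :: 'n \<Rightarrow> complex) x) = TL.con k e (map_sigma x)"
  by (simp only: map_sigma_def con_map[OF lin_\<sigma>])

lemma map_sigma_smul: "map_sigma (TL.smul b x) = TL.smul b (map_sigma x)"
  by (simp only: map_sigma_def \<sigma>_left)

lemma map_sigma_add: "map_sigma (\<lambda>\<nu>. x \<nu> + y \<nu>) = (\<lambda>\<nu>. map_sigma x \<nu> + map_sigma y \<nu>)"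
  by (simp only: map_sigma_def \<sigma>_add)

lemma fam4_\<sigma>: "fam4 (\<lambda>I. \<sigma> (x I)) = map_sigma (fam4 x)"
  and fam4_scT: "fam4 (\<lambda>I. scT b (x I)) = TL.smul b (fam4 x)"
  by (simp_all add: fam4_def map_sigma_def fun_eq_iff)

lemma \<sigma>_additive: "\<sigma> 0 = 0" "\<sigma> (- t) = - \<sigma> t"
proof -
  show 0: "\<sigma> 0 = 0" using \<sigma>_add[of 0 0] by simp
  show "\<sigma> (- t) = - \<sigma> t" using minus_unique[of "\<sigma> t" "\<sigma> (- t)"] \<sigma>_add[of t "- t"] 0 by simp
qed

text \<open>
  Of the two operators in the formula for \<open>\<sigma>\<close>, the factor \<open>T\<close> acts on \<open>\<partial>p \<otimes> \<partial>p\<close> as the scalar \<open>q\<^bsup>- w\<^esup>\<close>.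
\<close>

lemma map_sigma_dpdp: "map_sigma (xx dp dp) = TL.smul (qc (a - w)) (TL.S hd.G 0 (xx dp dp))"
proof -
  have "(\<lambda>I. \<sigma> (family_prod tens dp dp I)) = (\<lambda>I. scT (qc a) (leg_map scT (S ** St) (family_prod tens dp dp) I))"
    by (rule ext) (rule \<sigma>_pp)
  from arg_cong[OF this, of fam4]
  have "map_sigma (xx dp dp) = TL.smul (qc a) (TL.smul (qc (- w)) (TL.S hd.G 0 (xx dp dp)))"
    unfolding fam4_\<sigma> fam4_scT TL.leg_map_product TL_S TL_T fam4_prod dpdp_T TL.S_smul .
  then show ?thesis unfolding smulT qc_mult by (simp only: add_uminus_conv_diff)
qed

lemma map_sigma_dbdb: "map_sigma (xx dbp dbp) = TL.smul (qc (w - a)) (TL.T hd.Hi 1 (xx dbp dbp))"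
proof -
  have "(\<lambda>I. \<sigma> (family_prod tens dbp dbp I)) = (\<lambda>I. scT (qc (- a)) (leg_map scT (S ** St) (family_prod tens dbp dbp) I))"
    by (rule ext) (rule \<sigma>_mm)
  from arg_cong[OF this, of fam4]
  have "map_sigma (xx dbp dbp) = TL.smul (qc (- a)) (TL.smul (qc w) (TL.T hd.Hi 1 (xx dbp dbp)))"
    unfolding fam4_\<sigma> fam4_scT TL.leg_map_product TL_S TL_T fam4_prod
      TL.S_T_commute_0 dbdb_S TL.T_smul .
  then show ?thesis unfolding smulT qc_mult by (simp only: uminus_add_conv_diff)
qed

lemma dpdp_quadratic: "\<sigma> (\<sigma> (xx dp dp \<nu>)) = scT (qc a) (xx dp dp \<nu>) + scT (qc a - 1) (\<sigma> (xx dp dp \<nu>))"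
proof -
  let ?X = "xx dp dp" and ?S = "TL.S hd.G 0"
  have "map_sigma (map_sigma ?X) = TL.smul (qc (a - w) * qc (a - w)) (?S (?S ?X))"
    by (simp only: map_sigma_dpdp map_sigma_smul map_sigma_S TL.S_smul smulT)
  also have "?S (?S ?X) = (\<lambda>\<nu>. TL.smul (qc (2 * w - a)) ?X \<nu> + TL.smul (qc w - qc (w - a)) (?S ?X) \<nu>)"
    by (simp only: TL.S_quadratic[of 0 "?S ?X"] TL.S_inverse hd_uz(1,2))
  finally have "\<sigma> (\<sigma> (?X \<nu>)) = scT (qc (a - w) * qc (a - w)) (scT (qc (2 * w - a)) (?X \<nu>) + scT (qc w - qc (w - a)) (?S ?X \<nu>))"
    by (simp only: map_sigma_def fun_eq_iff)
  moreover have "\<sigma> (?X \<nu>) = scT (qc (a - w)) (?S ?X \<nu>)"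
    using map_sigma_dpdp by (simp only: map_sigma_def fun_eq_iff)
  moreover have "qc (a - w) * qc (a - w) * qc (2 * w - a) = qc a"
    "qc (a - w) * qc (a - w) * (qc w - qc (w - a)) = (qc a - 1) * qc (a - w)"
    by (simp_all add: qc_diff qc_double qc_nz field_simps)
  ultimately show ?thesis by (simp only: TL.scale_right_distrib TL.scale_scale)
qed

lemma dbdb_quadratic: "\<sigma> (\<sigma> (xx dbp dbp \<nu>)) = scT (qc (- a)) (xx dbp dbp \<nu>) + scT (qc (- a) - 1) (\<sigma> (xx dbp dbp \<nu>))"
proof -
  let ?X = "xx dbp dbp" and ?T = "TL.T hd.Hi 1"
  have "map_sigma (map_sigma ?X) = TL.smul (qc (w - a) * qc (w - a)) (?T (?T ?X))"
    by (simp only: map_sigma_dbdb map_sigma_smul map_sigma_T TL.T_smul smulT)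
  also have "?T (?T ?X) = (\<lambda>\<nu>. TL.smul (1 / qc (2 * w - a)) ?X \<nu> + TL.smul (qc (- w) - qc (a - w)) (?T ?X) \<nu>)"
    by (simp only: TL.T_quadratic[of 1 "?T ?X"] TL.T_inverse hd_uz(1,3))
  finally have "\<sigma> (\<sigma> (?X \<nu>)) = scT (qc (w - a) * qc (w - a)) (scT (1 / qc (2 * w - a)) (?X \<nu>) + scT (qc (- w) - qc (a - w)) (?T ?X \<nu>))"
    by (simp only: map_sigma_def fun_eq_iff)
  moreover have "\<sigma> (?X \<nu>) = scT (qc (w - a)) (?T ?X \<nu>)"
    using map_sigma_dbdb by (simp only: map_sigma_def fun_eq_iff)
  moreover have "qc (w - a) * qc (w - a) * (1 / qc (2 * w - a)) = qc (- a)"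
    "qc (w - a) * qc (w - a) * (qc (- w) - qc (a - w)) = (qc (- a) - 1) * qc (w - a)"
    by (simp_all add: qc_diff qc_double qc_minus qc_nz field_simps)
  ultimately show ?thesis by (simp only: TL.scale_right_distrib TL.scale_scale)
qed

section \<open>The mixed components of the braiding\<close>

text \<open>
  For central \<open>g\<close> this is the family \<open>p g p\<close>; written with \<open>g\<close> on the right it inherits all relations
  of \<open>p p\<close>.
\<close>

definition "ppg g = (\<lambda>\<nu>. lt (pp \<nu>) g)"

lemma ppg_S: "TL.S hd.G 0 (ppg g) = TL.smul (qc w) (ppg g)"
  and ppg_T: "TL.T hd.Hi 1 (ppg g) = TL.smul (qc (- w)) (ppg g)"
proof -
  have "TL.S K k (\<lambda>\<nu>. lt (x \<nu>) g) = (\<lambda>\<nu>. lt (BL.S K k x \<nu>) g)"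
    "TL.T K k (\<lambda>\<nu>. lt (x \<nu>) g) = (\<lambda>\<nu>. lt (BL.T K k x \<nu>) g)" for K k x
    by (simp_all only: TL.S_def BL.S_def TL.T_def BL.T_def op_map[OF lin_lt_arg[of "\<lambda>_. g"]])
  then show "TL.S hd.G 0 (ppg g) = TL.smul (qc w) (ppg g)"
    "TL.T hd.Hi 1 (ppg g) = TL.smul (qc (- w)) (ppg g)"
    by (simp_all only: ppg_def pp_S pp_T lt(3))
qed

lemma ppg_S': "TL.S hd.Gi 0 (ppg g) = TL.smul (qc (- w)) (ppg g)"
proof -
  have "ppg g = TL.smul (qc w) (TL.S hd.Gi 0 (ppg g))"
    by (simp only: TL.S_smul[symmetric] ppg_S[symmetric] TL.S_inverse)
  then have "TL.S hd.Gi 0 (ppg g) = TL.smul (1 / qc w) (ppg g)" by (rule TL.smul_inverse) (rule qc_nz)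
  then show ?thesis unfolding qc_mult(3) .
qed

lemma ppg_T': "TL.T hd.H 1 (ppg g) = TL.smul (qc w) (ppg g)"
proof -
  have "ppg g = TL.smul (qc (- w)) (TL.T hd.H 1 (ppg g))"
    by (simp only: TL.T_smul[symmetric] ppg_T[symmetric] TL.T_inverse)
  then have "TL.T hd.H 1 (ppg g) = TL.smul (1 / qc (- w)) (ppg g)" by (rule TL.smul_inverse) (rule qc_nz)
  then show ?thesis unfolding qc_mult(3) minus_minus .
qed

lemma pp_contract: "BL.con 1 one pp = fam2 p"
proof -
  have "BL.con 0 hd.d pp = after 0 (\<lambda>I b. b * p I) (BL.con 0 hd.d (fam2 p))"
    unfolding pp_def by (rule con_after_0[OF lin_mult_right])
  then have d: "BL.con 0 hd.d pp = BL.smul (qc m) (fam2 p)"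
    unfolding p_trace by (simp add: fun_eq_iff after_def fam2_def)
  have "BL.smul hd.c (BL.con 1 one pp) = BL.con 0 hd.d (BL.S hd.G 0 pp)"
    by (rule BL.con_d_S_0[symmetric])
  also have "\<dots> = BL.smul (qc w) (BL.smul (qc m) (fam2 p))"
    by (simp only: pp_S BL.con_smul d)
  also have "\<dots> = BL.smul hd.c (fam2 p)"
    by (simp only: BL.scale_scale qc_mult hd_c)
  finally show ?thesis using BL.smul_inverse[of "BL.smul hd.c (fam2 p)" hd.c "BL.con 1 one pp"] hd.c_nz
    by (simp add: fun_eq_iff)
qed

lemma ppg_contract: "TL.con 0 hd.d (TL.con 1 one (ppg g)) = (\<lambda>\<nu>. scT (qc m) g)"
proof -
  have "TL.con k e (\<lambda>\<nu>. lt (x \<nu>) g) = (\<lambda>\<nu>. lt (BL.con k e x \<nu>) g)" for k x and e :: "'n \<Rightarrow> complex"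
    by (simp only: con_map[OF lin_lt_arg[of "\<lambda>_. g"]])
  then show ?thesis by (simp only: ppg_def pp_contract p_trace)
qed

lemma ppg_fam4:
  assumes "\<And>I. rt g (p I) = lt (p I) g"
  shows "fam4 (family_prod (\<lambda>x y. rt (lt x g) y) p p) = ppg g"
proof -
  have "family_prod (\<lambda>x y. rt (lt x g) y) p p I = lt (family_prod (*) p p I) g" for I
    by (cases I) (simp only: family_prod.simps lrt assms lt(3))
  then have "family_prod (\<lambda>x y. rt (lt x g) y) p p = (\<lambda>I. lt (family_prod (*) p p I) g)" by (rule ext)
  from arg_cong[OF this, of fam4] show ?thesis
    unfolding ppg_def fam4_prod(1)[symmetric] fam4_smul[of "\<lambda>x. lt x g"] .
qed

lemma g_metric: "g_pm = metric dp dbp" "g_mp = metric dbp dp"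
  unfolding g_pm_def g_mp_def metric_def by (rule refl)+

lemma map_sigma_pm: "map_sigma (xx dp dbp) = (\<lambda>\<nu>. TL.smul (qc (2 * a - 2 * w)) (TL.S hd.G 0 (TL.T hd.H 1 (xx dbp dp))) \<nu>
    + TL.smul ((1 - qc a) * qc a * qc (- m)) (ppg g_mp) \<nu>)"
proof -
  have "(\<lambda>I. \<sigma> (family_prod tens dp dbp I)) = (\<lambda>I. scT (qc (2 * a - 2 * w)) (leg_map scT (S ** matrix_inv St) (family_prod tens dbp dp) I)
    + scT ((1 - qc a) * qc a * qc (- m)) (family_prod (\<lambda>x y. rt (lt x g_mp) y) p p I))"
    by (rule ext) (rule \<sigma>_pm)
  from arg_cong[OF this, of fam4]
  have "map_sigma (xx dp dbp) = (\<lambda>\<nu>. TL.smul (qc (2 * a - 2 * w)) (TL.S hd.G 0 (TL.T hd.H 1 (xx dbp dp))) \<nu>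
      + TL.smul ((1 - qc a) * qc a * qc (- m)) (fam4 (family_prod (\<lambda>x y. rt (lt x g_mp) y) p p)) \<nu>)"
    unfolding fam4_\<sigma> fam4_add fam4_scT TL.leg_map_product TL_S TL_T' fam4_prod .
  moreover have "fam4 (family_prod (\<lambda>x y. rt (lt x g_mp) y) p p) = ppg g_mp"
    unfolding g_metric by (rule ppg_fam4) (rule metric_mp_central)
  ultimately show ?thesis by simp
qed

lemma map_sigma_mp: "map_sigma (xx dbp dp) = (\<lambda>\<nu>. TL.smul (qc (2 * w - 2 * a)) (TL.S hd.Gi 0 (TL.T hd.Hi 1 (xx dp dbp))) \<nu>
    + TL.smul ((1 - qc (- a)) * qc (- m)) (ppg g_pm) \<nu>)"
proof -
  have "(\<lambda>I. \<sigma> (family_prod tens dbp dp I)) = (\<lambda>I. scT (qc (2 * w - 2 * a)) (leg_map scT (matrix_inv S ** St) (family_prod tens dp dbp) I)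
    + scT ((1 - qc (- a)) * qc (- m)) (family_prod (\<lambda>x y. rt (lt x g_pm) y) p p I))"
    by (rule ext) (rule \<sigma>_mp)
  from arg_cong[OF this, of fam4]
  have "map_sigma (xx dbp dp) = (\<lambda>\<nu>. TL.smul (qc (2 * w - 2 * a)) (TL.S hd.Gi 0 (TL.T hd.Hi 1 (xx dp dbp))) \<nu>
      + TL.smul ((1 - qc (- a)) * qc (- m)) (fam4 (family_prod (\<lambda>x y. rt (lt x g_pm) y) p p)) \<nu>)"
    unfolding fam4_\<sigma> fam4_add fam4_scT TL.leg_map_product TL_S' TL_T fam4_prod .
  moreover have "fam4 (family_prod (\<lambda>x y. rt (lt x g_pm) y) p p) = ppg g_pm"
    unfolding g_metric by (rule ppg_fam4) (rule metric_pm_central)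
  ultimately show ?thesis by simp
qed

lemma mixed_trace: "TL.con 2 hd.d (xx dp dbp) = (\<lambda>\<nu>. 0)" "TL.con 2 hd.d (xx dbp dp) = (\<lambda>\<nu>. 0)"
proof -
  have "tens x 0 = 0" for x using tens(2)[of x 0 0] by simp
  then have 0: "before (\<lambda>I. tens (x I)) (\<lambda>\<nu>. 0) = (\<lambda>\<nu>. 0)" for x :: "'n \<times> 'n \<Rightarrow> 'o"
    by (simp add: before_def fun_eq_iff)
  show "TL.con 2 hd.d (xx dp dbp) = (\<lambda>\<nu>. 0)"
    unfolding xx_alt con_before_0[OF lin_tens] dbp_trace by (rule 0)
  show "TL.con 2 hd.d (xx dbp dp) = (\<lambda>\<nu>. 0)"
    unfolding xx_alt con_before_0[OF lin_tens] dp_trace by (rule 0)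
qed

lemma con_con_0: "TL.con 0 hd.d (TL.con 0 hd.d x) = TL.con 0 hd.d (TL.con 2 hd.d x)"
  using TL.con_con[of 0 0 hd.d hd.d x, unfolded leg_numbers] by simp

text \<open>
  Contract the formula for \<open>\<sigma>\<close> on \<open>\<partial>p\<^sup>- \<otimes> \<partial>p\<close>. The operator term gives \<open>q\<^bsup>- a\<^esup> g\<^sub>+\<^sub>-\<close>, by the quadratic
  relation of \<open>T\<close> and \<open>mixed_trace\<close>. The term with \<open>p g p\<close> gives the missing \<open>(1 - q\<^bsup>- a\<^esup>) g\<^sub>+\<^sub>-\<close>.
\<close>

lemma \<sigma>_g_mp: "\<sigma> g_mp = g_pm"
proof -
  let ?Y = "xx dp dbp"
  let ?TY = "TL.T hd.Hi 1 ?Y"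
  have "TL.con 2 hd.d ?TY = TL.smul (1 / qc (2 * w - a) * hd.c) (TL.con 1 one ?Y)"
    by (simp only: TL.T_quadratic[of 1 ?Y] TL.con_add TL.con_smul TL.con_d_T_1 mixed_trace hd_uz(1)
      TL.scale_zero_right add_0_right smulT)
  then have "TL.con 0 hd.d (TL.con 1 one (TL.S hd.Gi 0 ?TY))
      = TL.smul (1 / hd.c * (1 / qc (2 * w - a) * hd.c)) (\<lambda>\<nu>. g_pm)"
    by (simp only: TL.con_1_S_0 TL.con_smul con_con_0 smulT metric_eq g_metric)
  moreover have "map_sigma (TL.con 0 hd.d (TL.con 1 one (xx dbp dp))) = TL.con 0 hd.d (TL.con 1 one (map_sigma (xx dbp dp)))"
    by (simp only: map_sigma_con)
  ultimately have "map_sigma (\<lambda>\<nu> :: nat \<Rightarrow> 'n. g_mp) = (\<lambda>\<nu>. scT (qc (2 * w - 2 * a) * (1 / hd.c * (1 / qc (2 * w - a) * hd.c))) g_pm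
      + scT ((1 - qc (- a)) * qc (- m) * qc m) g_pm)"
    by (simp only: metric_eq g_metric map_sigma_mp TL.con_add TL.con_smul ppg_contract TL.scale_scale)
  then have "\<sigma> g_mp = scT (qc (2 * w - 2 * a) * (1 / hd.c * (1 / qc (2 * w - a) * hd.c))
      + (1 - qc (- a)) * qc (- m) * qc m) g_pm"
    by (simp only: map_sigma_def fun_eq_iff TL.scale_left_distrib)
  moreover have "qc (2 * w - 2 * a) * (1 / hd.c * (1 / qc (2 * w - a) * hd.c))
      + (1 - qc (- a)) * qc (- m) * qc m = 1"
    using hd.c_nz by (simp add: qc_diff qc_double qc_minus qc_nz field_simps)
  ultimately show ?thesis by (simp only: TL.scale_one)
qed

text \<open>
  Likewise, but the operator term now contains \<open>S T\<^sup>-\<^sup>1\<close> and both quadratic relations enter. It gives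
  \<open>(q\<^bsup>2a\<^esup> - q\<^bsup>a\<^esup> + 1) g\<^sub>-\<^sub>+\<close>, to which the term with \<open>p g p\<close> adds \<open>(1 - q\<^bsup>a\<^esup>) q\<^bsup>a\<^esup> g\<^sub>-\<^sub>+\<close>.
\<close>

lemma \<sigma>_g_pm: "\<sigma> g_pm = g_mp"
proof -
  let ?Z = "xx dbp dp"
  let ?TZ = "TL.T hd.H 1 ?Z" and ?z = "TL.con 1 one (xx dbp dp)"
  \<comment> \<open>\<open>E\<^sub>2\<^sub>3 T\<close> is a multiple of the trace of the second factor, so the quadratic relation expresses
    \<open>E\<^sub>2\<^sub>3 T\<^sup>-\<^sup>1\<close> by \<open>E\<^sub>2\<^sub>3\<close>\<close>
  have "TL.con 1 one (TL.T hd.Hi 1 ?Z) = (\<lambda>\<nu>. 0)"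
    by (simp only: TL.con_1_T[of 1, unfolded leg_numbers] mixed_trace TL.scale_zero_right)
  then have zero: "scT (1 / qc (2 * w - a)) (TL.con 1 one ?TZ \<nu>) + scT (qc (- w) - qc (a - w)) (?z \<nu>) = 0" for \<nu>
    unfolding TL.T_quadratic[of 1 ?Z] TL.con_add TL.con_smul hd_uz(1,3) by (simp only: fun_eq_iff)
  have "scT (1 / qc (2 * w - a)) (TL.con 1 one ?TZ \<nu>) = scT (qc (a - w) - qc (- w)) (?z \<nu>)" for \<nu>
    using zero[of \<nu>] by (simp only: TL.scale_left_diff_distrib add_eq_0_iff2 minus_diff_eq)
  then have "TL.smul (qc (a - w) - qc (- w)) ?z = TL.smul (1 / qc (2 * w - a)) (TL.con 1 one ?TZ)"
    by (intro ext) (rule sym)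
  from TL.smul_inverse[OF this] have con1: "TL.con 1 one ?TZ = TL.smul (qc (2 * w - a) * (qc (a - w) - qc (- w))) ?z"
    by (simp add: qc_nz)
  have "TL.con 0 hd.d (TL.con 0 hd.d ?TZ) = TL.smul hd.c (\<lambda>\<nu>. g_mp)"
    by (simp only: con_con_0 TL.con_d_T_1 TL.con_smul metric_eq g_metric)
  then have "TL.con 0 hd.d (TL.con 1 one (TL.S hd.G 0 ?TZ))
      = (\<lambda>\<nu>. scT (qc (2 * w - a) * (1 / hd.c) * hd.c) g_mp
        + scT ((qc w - qc (w - a)) * (qc (2 * w - a) * (qc (a - w) - qc (- w)))) g_mp)"
    by (simp only: TL.S_quadratic[of 0 ?TZ] hd_uz(1,2) TL.con_add TL.con_smul TL.con_1_S_0 con1 metric_eq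
      g_metric TL.scale_scale)
  moreover have "map_sigma (TL.con 0 hd.d (TL.con 1 one (xx dp dbp))) = TL.con 0 hd.d (TL.con 1 one (map_sigma (xx dp dbp)))"
    by (simp only: map_sigma_con)
  ultimately have "map_sigma (\<lambda>\<nu> :: nat \<Rightarrow> 'n. g_pm) = (\<lambda>\<nu>. scT (qc (2 * a - 2 * w)) (scT (qc (2 * w - a) * (1 / hd.c) * hd.c) g_mp
        + scT ((qc w - qc (w - a)) * (qc (2 * w - a) * (qc (a - w) - qc (- w)))) g_mp)
      + scT ((1 - qc a) * qc a * qc (- m) * qc m) g_mp)"
    by (simp only: metric_eq g_metric map_sigma_pm TL.con_add TL.con_smul ppg_contract TL.scale_scale)
  then have "\<sigma> g_pm = scT (qc (2 * a - 2 * w) * (qc (2 * w - a) * (1 / hd.c) * hd.c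
        + (qc w - qc (w - a)) * (qc (2 * w - a) * (qc (a - w) - qc (- w))))
      + (1 - qc a) * qc a * qc (- m) * qc m) g_mp"
    by (simp only: map_sigma_def fun_eq_iff TL.scale_left_distrib TL.scale_scale TL.scale_right_distrib distrib_left)
  moreover have "qc (2 * a - 2 * w) * (qc (2 * w - a) * (1 / hd.c) * hd.c
        + (qc w - qc (w - a)) * (qc (2 * w - a) * (qc (a - w) - qc (- w))))
      + (1 - qc a) * qc a * qc (- m) * qc m = 1"
    using hd.c_nz by (simp add: qc_diff qc_double qc_minus qc_nz field_simps)
  ultimately show ?thesis by (simp only: TL.scale_one)
qed

lemma map_sigma_ppg: "map_sigma (ppg g) = ppg (\<sigma> g)"
  by (simp only: map_sigma_def ppg_def \<sigma>_left)

text \<open>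
  The operators \<open>S T\<^sup>-\<^sup>1\<close> and \<open>S\<^sup>-\<^sup>1 T\<close> and their scalars cancel. On \<open>p g p\<close> the operator \<open>S T\<^sup>-\<^sup>1\<close> is
  \<open>q\<^bsup>2w\<^esup>\<close>, which makes the two contributions opposite.
\<close>

lemma mixed_inverse_pm: "\<sigma> (\<sigma> (xx dp dbp \<nu>)) = xx dp dbp \<nu>"
proof -
  let ?Y = "xx dp dbp"
  let ?b = "qc (2 * a - 2 * w)" and ?b' = "qc (2 * w - 2 * a)"
  let ?k = "(1 - qc a) * qc a * qc (- m)" and ?k' = "(1 - qc (- a)) * qc (- m)"
  have ST: "TL.S hd.G 0 (TL.T hd.H 1 (TL.S hd.Gi 0 (TL.T hd.Hi 1 ?Y))) = ?Y"
    by (simp only: TL.S_T_commute_0 TL.T_inverse TL.S_inverse)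
  have "map_sigma (map_sigma ?Y) = (\<lambda>\<nu>. scT ?b (scT ?b' (?Y \<nu>) + scT (?k' * qc w * qc w) (ppg g_pm \<nu>)) + scT ?k (ppg g_pm \<nu>))"
    by (simp only: map_sigma_pm map_sigma_add map_sigma_smul map_sigma_S map_sigma_T map_sigma_mp TL.T_add TL.S_add TL.T_smul TL.S_smul ST ppg_S ppg_T'
      map_sigma_ppg \<sigma>_g_mp TL.scale_scale mult.assoc)
  then have "\<sigma> (\<sigma> (?Y \<nu>)) = scT (?b * ?b') (?Y \<nu>) + scT (?b * (?k' * qc w * qc w) + ?k) (ppg g_pm \<nu>)"
    by (simp only: map_sigma_def fun_eq_iff TL.scale_right_distrib TL.scale_left_distrib TL.scale_scale add.assoc)
  moreover have "?b * ?b' = 1" "?b * (?k' * qc w * qc w) + ?k = 0"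
    by (simp_all add: qc_diff qc_double qc_minus qc_nz field_simps)
  ultimately show ?thesis by (simp only: TL.scale_one TL.scale_zero_left add_0_right)
qed

lemma mixed_inverse_mp: "\<sigma> (\<sigma> (xx dbp dp \<nu>)) = xx dbp dp \<nu>"
proof -
  let ?Z = "xx dbp dp"
  let ?b = "qc (2 * a - 2 * w)" and ?b' = "qc (2 * w - 2 * a)"
  let ?k = "(1 - qc a) * qc a * qc (- m)" and ?k' = "(1 - qc (- a)) * qc (- m)"
  have ST: "TL.S hd.Gi 0 (TL.T hd.Hi 1 (TL.S hd.G 0 (TL.T hd.H 1 ?Z))) = ?Z"
    by (simp only: TL.S_T_commute_0 TL.T_inverse TL.S_inverse)
  have "map_sigma (map_sigma ?Z) = (\<lambda>\<nu>. scT ?b' (scT ?b (?Z \<nu>) + scT (?k * qc (- w) * qc (- w)) (ppg g_mp \<nu>)) + scT ?k' (ppg g_mp \<nu>))"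
    by (simp only: map_sigma_pm map_sigma_add map_sigma_smul map_sigma_S map_sigma_T map_sigma_mp TL.T_add TL.S_add TL.T_smul TL.S_smul ST ppg_S' ppg_T
      map_sigma_ppg \<sigma>_g_pm TL.scale_scale mult.assoc)
  then have "\<sigma> (\<sigma> (?Z \<nu>)) = scT (?b' * ?b) (?Z \<nu>) + scT (?b' * (?k * qc (- w) * qc (- w)) + ?k') (ppg g_mp \<nu>)"
    by (simp only: map_sigma_def fun_eq_iff TL.scale_right_distrib TL.scale_left_distrib TL.scale_scale add.assoc)
  moreover have "?b' * ?b = 1" "?b' * (?k * qc (- w) * qc (- w)) + ?k' = 0"
    by (simp_all add: qc_diff qc_double qc_minus qc_nz field_simps)
  ultimately show ?thesis by (simp only: TL.scale_one TL.scale_zero_left add_0_right)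
qed

section \<open>From generators to all elements\<close>

lemma tensor_sub_cases:
  assumes t: "t \<in> tensor_sub tens N1 N2" and N: "generates N1 x" "generates N2 y"
    and P: "\<And>\<nu>. P (xx x y \<nu>)" "P 0" "\<And>t u. P t \<Longrightarrow> P u \<Longrightarrow> P (t + u)" "\<And>t. P t \<Longrightarrow> P (- t)"
      "\<And>b t. P t \<Longrightarrow> P (lt b t)"
  shows "P t"
  using t N
proof (rule tensor_sub_induct[where P = P])
  fix I :: "'n legs4"
  obtain i j k l where I: "I = (i, j, k, l)" by (cases I)
  have "xx x y (\<lambda>n. [i, j, k, l] ! n) = family_prod tens x y I"
    unfolding fam4_prod(4)[symmetric] fam4_def I by simp
  then show "P (family_prod tens x y I)" using P(1) by metis
qed (fact P)+

text \<open>
  In the form \<open>\<sigma> (\<sigma> t + t) = c (\<sigma> t + t)\<close>, the relation is preserved by sums and by the left action,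
  because the scalars are central.
\<close>

lemma quadratic_relation:
  assumes t: "t \<in> tensor_sub tens N1 N2" and N: "generates N1 x" "generates N2 y"
    and gen: "\<And>\<nu>. \<sigma> (\<sigma> (xx x y \<nu>)) = scT c (xx x y \<nu>) + scT (c - 1) (\<sigma> (xx x y \<nu>))"
  shows "\<sigma> (\<sigma> t + t) - scT c (\<sigma> t + t) = 0"
proof -
  have com: "scT c (lt b v) = lt b (scT c v)" for b v
    by (simp only: lt(3)[symmetric] iota(4)[of c b])
  have "\<sigma> (\<sigma> t + t) = scT c (\<sigma> t + t)"
    using t N
  proof (rule tensor_sub_cases)
    fix \<nu>
    have "\<sigma> (\<sigma> (xx x y \<nu>) + xx x y \<nu>) = scT c (xx x y \<nu>) + (scT (c - 1) (\<sigma> (xx x y \<nu>)) + scT 1 (\<sigma> (xx x y \<nu>)))"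
      by (simp only: \<sigma>_add gen TL.scale_one add.assoc)
    then show "\<sigma> (\<sigma> (xx x y \<nu>) + xx x y \<nu>) = scT c (\<sigma> (xx x y \<nu>) + xx x y \<nu>)"
      by (simp only: TL.scale_left_distrib[symmetric] diff_add_cancel TL.scale_right_distrib
        add.commute[of "scT c (xx x y \<nu>)"])
  next
    show "\<sigma> (\<sigma> 0 + 0) = scT c (\<sigma> 0 + 0)" by (simp add: \<sigma>_additive lt_additive)
  next
    fix t u assume "\<sigma> (\<sigma> t + t) = scT c (\<sigma> t + t)" "\<sigma> (\<sigma> u + u) = scT c (\<sigma> u + u)"
    moreover have "\<sigma> (t + u) + (t + u) = (\<sigma> t + t) + (\<sigma> u + u)" by (simp only: \<sigma>_add ac_simps)
    ultimately show "\<sigma> (\<sigma> (t + u) + (t + u)) = scT c (\<sigma> (t + u) + (t + u))"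
      by (simp only: \<sigma>_add[of "\<sigma> t + t"] lt(1)[of _ "\<sigma> t + t"])
  next
    fix t assume "\<sigma> (\<sigma> t + t) = scT c (\<sigma> t + t)"
    moreover have "\<sigma> (- t) + - t = - (\<sigma> t + t)" by (simp add: \<sigma>_additive)
    ultimately show "\<sigma> (\<sigma> (- t) + - t) = scT c (\<sigma> (- t) + - t)"
      by (simp only: \<sigma>_additive(2)[of "\<sigma> t + t"] lt_additive(2)[of _ "\<sigma> t + t"])
  next
    fix b t assume "\<sigma> (\<sigma> t + t) = scT c (\<sigma> t + t)"
    moreover have "\<sigma> (lt b t) + lt b t = lt b (\<sigma> t + t)" by (simp only: \<sigma>_left lt(1))
    ultimately show "\<sigma> (\<sigma> (lt b t) + lt b t) = scT c (\<sigma> (lt b t) + lt b t)"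
      by (simp only: \<sigma>_left[of b "\<sigma> t + t"] com)
  qed
  then show ?thesis by (simp only: diff_self)
qed

lemma involution_relation:
  assumes t: "t \<in> tensor_sub tens N1 N2" and N: "generates N1 x" "generates N2 y"
    and gen: "\<And>\<nu>. \<sigma> (\<sigma> (xx x y \<nu>)) = xx x y \<nu>"
  shows "\<sigma> (\<sigma> t) = t"
  using t N by (rule tensor_sub_cases) (simp_all only: gen \<sigma>_additive \<sigma>_add \<sigma>_left)

lemma maps_tensor_sub:
  assumes N: "generates N1 x" "generates N2 y" and M: "generates M1 x'" "generates M2 y'"
    and gen: "\<And>I. \<sigma> (family_prod tens x y I) \<in> tensor_sub tens M1 M2"
  shows "\<sigma> \<in> tensor_sub tens N1 N2 \<rightarrow> tensor_sub tens M1 M2"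
proof
  fix t assume "t \<in> tensor_sub tens N1 N2"
  from this N show "\<sigma> t \<in> tensor_sub tens M1 M2"
  proof (rule tensor_sub_induct)
    show "\<sigma> (family_prod tens x y I) \<in> tensor_sub tens M1 M2" for I by (rule gen)
    show "\<sigma> 0 \<in> tensor_sub tens M1 M2" unfolding \<sigma>_additive by (rule tensor_sub_closed(3)[OF M])
    show "\<sigma> (t + u) \<in> tensor_sub tens M1 M2"
      if "\<sigma> t \<in> tensor_sub tens M1 M2" "\<sigma> u \<in> tensor_sub tens M1 M2" for t u
      unfolding \<sigma>_add using that by (rule tensor_sub_closed(1)[OF M])
    show "\<sigma> (- t) \<in> tensor_sub tens M1 M2" if "\<sigma> t \<in> tensor_sub tens M1 M2" for t
      unfolding \<sigma>_additive using that by (rule tensor_sub_closed(2)[OF M])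
    show "\<sigma> (lt b t) \<in> tensor_sub tens M1 M2" if "\<sigma> t \<in> tensor_sub tens M1 M2" for b t
      unfolding \<sigma>_left using that by (rule tensor_sub_closed(4)[OF M])
  qed
qed

lemma leg_map_in_tensor_sub:
  assumes M: "generates M1 x" "generates M2 y"
  shows "scT b (leg_map scT K (family_prod tens x y) I) \<in> tensor_sub tens M1 M2"
  unfolding leg_map_def by (intro tensor_sub_closed(4,6,7)[OF M])

lemma metric_in_tensor_sub:
  assumes M: "generates M1 x" "generates M2 y"
  shows "metric x y \<in> tensor_sub tens M1 M2"
  unfolding metric_def E12'_def E23_def prod.case by (intro tensor_sub_closed(4,6,7)[OF M])

lemma \<sigma>_maps:
  "\<sigma> \<in> tensor_sub tens \<Omega>p \<Omega>p \<rightarrow> tensor_sub tens \<Omega>p \<Omega>p"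
  "\<sigma> \<in> tensor_sub tens \<Omega>m \<Omega>m \<rightarrow> tensor_sub tens \<Omega>m \<Omega>m"
  "\<sigma> \<in> tensor_sub tens \<Omega>p \<Omega>m \<rightarrow> tensor_sub tens \<Omega>m \<Omega>p"
  "\<sigma> \<in> tensor_sub tens \<Omega>m \<Omega>p \<rightarrow> tensor_sub tens \<Omega>p \<Omega>m"
proof -
  note plus = generates_plus and minus = generates_minus
  have pgp: "scT b (family_prod (\<lambda>v v'. rt (lt v (metric x y)) v') p p I) \<in> tensor_sub tens M1 M2"
    if M: "generates M1 x" "generates M2 y" for M1 M2 x y b I
  proof (cases I)
    case (fields i j k l)
    show ?thesis unfolding fields family_prod.simps
      by (intro tensor_sub_closed(4,5)[OF M] metric_in_tensor_sub M)
  qed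
  show "\<sigma> \<in> tensor_sub tens \<Omega>p \<Omega>p \<rightarrow> tensor_sub tens \<Omega>p \<Omega>p"
    by (rule maps_tensor_sub[OF plus plus plus plus], unfold \<sigma>_pp) (rule leg_map_in_tensor_sub[OF plus plus])
  show "\<sigma> \<in> tensor_sub tens \<Omega>m \<Omega>m \<rightarrow> tensor_sub tens \<Omega>m \<Omega>m"
    by (rule maps_tensor_sub[OF minus minus minus minus], unfold \<sigma>_mm) (rule leg_map_in_tensor_sub[OF minus minus])
  show "\<sigma> \<in> tensor_sub tens \<Omega>p \<Omega>m \<rightarrow> tensor_sub tens \<Omega>m \<Omega>p"
    by (rule maps_tensor_sub[OF plus minus minus plus], unfold \<sigma>_pm g_metric)
      (intro tensor_sub_closed(1)[OF minus plus] leg_map_in_tensor_sub pgp minus plus)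
  show "\<sigma> \<in> tensor_sub tens \<Omega>m \<Omega>p \<rightarrow> tensor_sub tens \<Omega>p \<Omega>m"
    by (rule maps_tensor_sub[OF minus plus plus minus], unfold \<sigma>_mp g_metric)
      (intro tensor_sub_closed(1)[OF plus minus] leg_map_in_tensor_sub pgp minus plus)
qed

end

theorem proposition3p2:
  fixes r s :: nat
    and q :: real
    and \<pi> :: "uq_gen \<Rightarrow> complex^'n^'n"
    and wt :: "'n \<Rightarrow> weight"
    and RVV RVD RDD :: "complex^('n \<times> 'n)^('n \<times> 'n)"
    and \<iota> :: "complex \<Rightarrow> 'b::ring_1"
    and p :: "'n \<times> 'n \<Rightarrow> 'b"
    and lo :: "'b \<Rightarrow> 'o::ab_group_add \<Rightarrow> 'o"
    and ro :: "'o \<Rightarrow> 'b \<Rightarrow> 'o"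
    and \<Omega>p \<Omega>m :: "'o set"
    and dp dbp :: "'n \<times> 'n \<Rightarrow> 'o"
    and lt :: "'b \<Rightarrow> 't::ab_group_add \<Rightarrow> 't"
    and rt :: "'t \<Rightarrow> 'b \<Rightarrow> 't"
    and tens :: "'o \<Rightarrow> 'o \<Rightarrow> 't"
    and \<sigma> :: "'t \<Rightarrow> 't"
  assumes "generalized_braiding r s q \<pi> wt RVV RVD RDD \<iota> p lo ro \<Omega>p \<Omega>m dp dbp lt rt tens \<sigma>"
  shows
    "\<sigma> \<in> tensor_sub tens \<Omega>p \<Omega>p \<rightarrow> tensor_sub tens \<Omega>p \<Omega>p \<and>
     \<sigma> \<in> tensor_sub tens \<Omega>m \<Omega>m \<rightarrow> tensor_sub tens \<Omega>m \<Omega>m \<and>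
     \<sigma> \<in> tensor_sub tens \<Omega>p \<Omega>m \<rightarrow> tensor_sub tens \<Omega>m \<Omega>p \<and>
     \<sigma> \<in> tensor_sub tens \<Omega>m \<Omega>p \<rightarrow> tensor_sub tens \<Omega>p \<Omega>m \<and>
     (\<forall>t \<in> tensor_sub tens \<Omega>p \<Omega>p.
        \<sigma> (\<sigma> t + t)
        - lt (\<iota> (complex_of_real (q powr ip r (simple_root s) (simple_root s)))) (\<sigma> t + t) = 0) \<and>
     (\<forall>t \<in> tensor_sub tens \<Omega>m \<Omega>m.
        \<sigma> (\<sigma> t + t)
        - lt (\<iota> (complex_of_real (q powr (- ip r (simple_root s) (simple_root s))))) (\<sigma> t + t) = 0) \<and>
     (\<forall>t \<in> tensor_sub tens \<Omega>p \<Omega>m. \<sigma> (\<sigma> t) = t) \<and>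
     (\<forall>t \<in> tensor_sub tens \<Omega>m \<Omega>p. \<sigma> (\<sigma> t) = t)"
proof -
  interpret B: generalized_braiding r s q \<pi> wt RVV RVD RDD \<iota> p lo ro \<Omega>p \<Omega>m dp dbp lt rt tens \<sigma>
    by (rule assms)
  obtain pos where "ordered_space_data_axioms r s q wt RVV RVD RDD pos"
    using B.braidings_explicit unfolding ordered_space_data_axioms_def by metis
  then interpret B: ordered_braiding r s q \<pi> wt RVV RVD RDD \<iota> p lo ro \<Omega>p \<Omega>m dp dbp lt rt tens \<sigma> pos
    by (intro ordered_braiding.intro ordered_calculus.intro ordered_space_data.intro assms
      B.projective_space_data_axioms B.heckenberger_kolb_calculus_axioms)
  note plus = B.generates_plus and minus = B.generates_minus
  show ?thesis
    using B.quadratic_relation[OF _ plus plus B.dpdp_quadratic] B.quadratic_relation[OF _ minus minus B.dbdb_quadratic]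
      B.involution_relation[OF _ plus minus B.mixed_inverse_pm] B.involution_relation[OF _ minus plus B.mixed_inverse_mp]
    unfolding B.qc_def B.a_def by (intro conjI ballI B.\<sigma>_maps)
qed

end
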